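(* Let $(M,\Omega)$ be a connected symplectic manifold. The sequence $$\{0\}\to\mathbb R\xrightarrow{\ \iota\ }(\widehat{\mathsf H}(M),[\cdot,\cdot])\xrightarrow{\ \pi_1\ }(\widehat{\mathsf B}_1(M),[\cdot,\cdot]_\top)\to\{0\}$$ of Lie algebras is exact, where $\iota(c)$ is the constant function on $M$ equal to $-c$ and $\pi_1(\alpha)=\alpha-\alpha_0$.
   Context: Abstract indices and the summation convention are used; $(\cdots)$ around indices denotes complete symmetrization. $\Omega^{ij}$ is defined by $\Omega^{ip}\Omega_{pj}=-\delta_j{}^i$; indices are raised/lowered by $X^i=\Omega^{ip}X_p$, $X_i=X^p\Omega_{pi}$, keeping horizontal position. $\mathsf S^k(M)=\Gamma(S^k(T^*M))$ (with $\mathsf S^0(M)=C^\infty(M)$), $\widehat{\mathsf S}(M)=\prod_{k\ge0}\mathsf S^k(M)$; $\alpha_k$ denotes the component of $\alpha$ in $\mathsf S^k(M)$. On functions, $\delta^*f=-df$. For $\alpha\in\mathsf S^k(M)$, $\beta\in\mathsf S^l(M)$: the algebraic bracket is $(\alpha,\beta)_{i_1\dots i_{k+l-2}}=kl\,\alpha_{p(i_1\dots i_{k-1}}\beta_{i_k\dots i_{k+l-2})}{}^p$ (zero if $k=0$ or $l=0$); the Schouten bracket is $[\![\alpha,\beta]\!]_{i_1\dots i_{k+l-1}}=-k\alpha_{p(i_1\dots i_{k-1}}\nabla^p\beta_{i_k\dots i_{k+l-1})}+l\beta_{p(i_1\dots i_{l-1}}\nabla^p\alpha_{i_l\dots i_{k+l-1})}$,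 where $\nabla$ is any torsion-free affine connection with $\nabla\Omega=0$ (the result is independent of the choice). Both extend componentwise to $\widehat{\mathsf S}(M)$, and $[\alpha,\beta]=(\alpha,\beta)+[\![\alpha,\beta]\!]$ is a Lie bracket on $\widehat{\mathsf S}(M)$. $\widehat{\mathsf H}(M)=\{\alpha\in\widehat{\mathsf S}(M):\alpha_1=-\delta^*\alpha_0\}$, a Lie subalgebra of $(\widehat{\mathsf S}(M),[\cdot,\cdot])$. Let $\pi_k\alpha=\alpha-\sum_{i=0}^{k-1}\alpha_i$ and $[\alpha,\beta]_\top=(\pi_2\alpha,\pi_2\beta)+[\![\pi_1\alpha,\pi_1\beta]\!]$. $\widehat{\mathsf B}_1(M)=\{\alpha\in\widehat{\mathsf S}(M):\alpha_0=0,\ \alpha_1\text{ is exact}\}$, on which $[\cdot,\cdot]_\top$ is a Lie bracket. *)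

theory Defs
  imports
    "HOL-Analysis.Analysis"
    "HOL-Combinatorics.Permutations"
    "HOL-Library.Function_Algebras"
begin

section \<open>Lie algebras and exact sequences\<close>

instantiation "fun" :: (type, real_vector) real_vector
begin

definition scaleR_fun_def: "scaleR r f = (\<lambda>x. r *\<^sub>R f x)"

instance
  by standard (simp_all add: scaleR_fun_def fun_eq_iff scaleR_add_right scaleR_add_left)

end

text \<open>A real Lie algebra is given by a linear subspace of an ambient real vector space and a
  bracket, which is only required to behave well on that subspace.\<close>

definition lie_algebra :: "'a::real_vector set \<Rightarrow> ('a \<Rightarrow> 'a \<Rightarrow> 'a) \<Rightarrow> bool" where
  "lie_algebra L br \<longleftrightarrow>
     subspace L \<and>
     (\<forall>x\<in>L. \<forall>y\<in>L. br x y \<in> L) \<and>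
     (\<forall>x\<in>L. \<forall>y\<in>L. \<forall>z\<in>L. br (x + y) z = br x z + br y z \<and> br x (y + z) = br x y + br x z) \<and>
     (\<forall>r. \<forall>x\<in>L. \<forall>y\<in>L. br (r *\<^sub>R x) y = r *\<^sub>R br x y \<and> br x (r *\<^sub>R y) = r *\<^sub>R br x y) \<and>
     (\<forall>x\<in>L. br x x = 0) \<and>
     (\<forall>x\<in>L. \<forall>y\<in>L. \<forall>z\<in>L. br x (br y z) + br y (br z x) + br z (br x y) = 0)"

definition lie_hom ::
  "'a::real_vector set \<Rightarrow> ('a \<Rightarrow> 'a \<Rightarrow> 'a) \<Rightarrow> 'b::real_vector set \<Rightarrow> ('b \<Rightarrow> 'b \<Rightarrow> 'b) \<Rightarrow> ('a \<Rightarrow> 'b) \<Rightarrow> bool"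
where
  "lie_hom L br L' br' f \<longleftrightarrow>
     (\<forall>x\<in>L. f x \<in> L') \<and>
     (\<forall>x\<in>L. \<forall>y\<in>L. f (x + y) = f x + f y) \<and>
     (\<forall>r. \<forall>x\<in>L. f (r *\<^sub>R x) = r *\<^sub>R f x) \<and>
     (\<forall>x\<in>L. \<forall>y\<in>L. f (br x y) = br' (f x) (f y))"

definition lie_short_exact ::
  "'a::real_vector set \<Rightarrow> ('a \<Rightarrow> 'a \<Rightarrow> 'a) \<Rightarrow> ('a \<Rightarrow> 'b) \<Rightarrow>
   'b::real_vector set \<Rightarrow> ('b \<Rightarrow> 'b \<Rightarrow> 'b) \<Rightarrow> ('b \<Rightarrow> 'c) \<Rightarrow>
   'c::real_vector set \<Rightarrow> ('c \<Rightarrow> 'c \<Rightarrow> 'c) \<Rightarrow> bool"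
where
  "lie_short_exact K brK f L brL g Q brQ \<longleftrightarrow>
     lie_algebra K brK \<and> lie_algebra L brL \<and> lie_algebra Q brQ \<and>
     lie_hom K brK L brL f \<and> lie_hom L brL Q brQ g \<and>
     {x \<in> K. f x = 0} = {0} \<and>
     {x \<in> L. g x = 0} = f ` K \<and>
     g ` L = Q"


section \<open>Smooth manifolds\<close>

definition pderiv_at :: "'n \<Rightarrow> (real^'n \<Rightarrow> real) \<Rightarrow> real^'n \<Rightarrow> real" where
  "pderiv_at i f y = frechet_derivative f (at y) (axis i 1)"

primrec Ck_on :: "nat \<Rightarrow> (real^'n \<Rightarrow> real) \<Rightarrow> (real^'n) set \<Rightarrow> bool" where
  "Ck_on 0 f V \<longleftrightarrow> continuous_on V f"
| "Ck_on (Suc k) f V \<longleftrightarrow> f differentiable_on V \<and> (\<forall>i. Ck_on k (pderiv_at i f) V)"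

text \<open>Only used for open sets \<open>V\<close>.\<close>

definition smooth_on :: "(real^'n) set \<Rightarrow> (real^'n \<Rightarrow> real) \<Rightarrow> bool" where
  "smooth_on V f \<longleftrightarrow> (\<forall>k. Ck_on k f V)"

text \<open>A chart is a pair of a domain and a coordinate map; the coordinate map is total, but its
  values outside the domain are irrelevant.\<close>

type_synonym ('m, 'n) chart = "'m set \<times> ('m \<Rightarrow> real^'n)"

abbreviation cdom :: "('m, 'n::finite) chart \<Rightarrow> 'm set" where
  "cdom c \<equiv> fst c"

abbreviation coord :: "('m, 'n::finite) chart \<Rightarrow> 'm \<Rightarrow> real^'n" where
  "coord c \<equiv> snd c"

definition coord_inv :: "('m, 'n::finite) chart \<Rightarrow> real^'n \<Rightarrow> 'm" where
  "coord_inv c = inv_into (cdom c) (coord c)"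

definition is_chart :: "('m::topological_space, 'n::finite) chart \<Rightarrow> bool" where
  "is_chart c \<longleftrightarrow>
     open (cdom c) \<and> open (coord c ` cdom c) \<and>
     homeomorphism (cdom c) (coord c ` cdom c) (coord c) (coord_inv c)"

definition smooth_atlas :: "('m::{t2_space, second_countable_topology}, 'n::finite) chart set \<Rightarrow> bool" where
  "smooth_atlas A \<longleftrightarrow>
     (\<forall>c\<in>A. is_chart c) \<and> (\<Union>c\<in>A. cdom c) = UNIV \<and>
     (\<forall>c\<in>A. \<forall>d\<in>A. \<forall>i. smooth_on (coord d ` (cdom c \<inter> cdom d)) (\<lambda>y. coord c (coord_inv d y) $ i))"

definition smooth_fun :: "('m, 'n::finite) chart set \<Rightarrow> ('m \<Rightarrow> real) \<Rightarrow> bool" where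
  "smooth_fun A f \<longleftrightarrow> (\<forall>c\<in>A. smooth_on (coord c ` cdom c) (f \<circ> coord_inv c))"

lemma Ck_on_cong:
  assumes "open V" "\<And>y. y \<in> V \<Longrightarrow> f y = g y" "Ck_on k f V"
  shows "Ck_on k g V"
  using assms(2,3)
proof (induction k arbitrary: f g)
  case 0
  then show ?case
    using continuous_on_cong by fastforce
next
  case (Suc k)
  have der: "(g has_derivative f') (at y) \<longleftrightarrow> (f has_derivative f') (at y)" if y: "y \<in> V" for y f'
  proof
    assume "(g has_derivative f') (at y)"
    then show "(f has_derivative f') (at y)"
      by (rule has_derivative_transform_within_open[OF _ assms(1) y]) (simp add: Suc.prems(1))
  next
    assume "(f has_derivative f') (at y)"
    then show "(g has_derivative f') (at y)"
      by (rule has_derivative_transform_within_open[OF _ assms(1) y]) (simp add: Suc.prems(1))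
  qed
  have "g differentiable_on V"
    using Suc.prems(2) der assms(1)
    by (simp add: differentiable_on_eq_differentiable_at differentiable_def)
  moreover have "Ck_on k (pderiv_at i g) V" for i
  proof (rule Suc.IH)
    show "pderiv_at i f y = pderiv_at i g y" if "y \<in> V" for y
      using der[OF that] by (simp add: pderiv_at_def frechet_derivative_def)
    show "Ck_on k (pderiv_at i f) V"
      using Suc.prems(2) by simp
  qed
  ultimately show ?case
    by simp
qed

lemma smooth_on_cong:
  assumes "open V" "\<And>y. y \<in> V \<Longrightarrow> f y = g y"
  shows "smooth_on V f \<longleftrightarrow> smooth_on V g"
  using Ck_on_cong[OF assms(1), of f g] Ck_on_cong[OF assms(1), of g f] assms(2)
  by (auto simp: smooth_on_def)

text \<open>The partial derivative of a function on the manifold with respect to the \<open>i\<close>-th coordinate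
  of a chart, set to zero outside the domain of the chart.\<close>

definition cpd :: "('m, 'n::finite) chart \<Rightarrow> 'n \<Rightarrow> ('m \<Rightarrow> real) \<Rightarrow> 'm \<Rightarrow> real" where
  "cpd c i f x = (if x \<in> cdom c then pderiv_at i (f \<circ> coord_inv c) (coord c x) else 0)"

text \<open>The Jacobian \<open>jac c d x a i\<close> is the derivative of the \<open>a\<close>-th coordinate of \<open>c\<close> with respect
  to the \<open>i\<close>-th coordinate of \<open>d\<close>.\<close>

definition jac :: "('m, 'n::finite) chart \<Rightarrow> ('m, 'n::finite) chart \<Rightarrow> 'm \<Rightarrow> 'n \<Rightarrow> 'n \<Rightarrow> real" where
  "jac c d x a i = cpd d i (\<lambda>z. coord c z $ a) x"


section \<open>Tensor fields\<close>

text \<open>A covariant tensor field is the family of its components with respect to all charts of the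
  atlas: \<open>T c x [i\<^sub>1, \<dots>, i\<^sub>k]\<close> is the component of \<open>T\<close> with indices \<open>i\<^sub>1, \<dots>, i\<^sub>k\<close> in the chart \<open>c\<close> at
  the point \<open>x\<close>. Components which have no meaning are zero, so that equality of tensor
  fields is equality of functions.\<close>

type_synonym ('m, 'n) tensor = "('m, 'n) chart \<Rightarrow> 'm \<Rightarrow> 'n list \<Rightarrow> real"

definition tensor_field :: "('m, 'n::finite) chart set \<Rightarrow> nat \<Rightarrow> ('m, 'n::finite) tensor \<Rightarrow> bool" where
  "tensor_field A k T \<longleftrightarrow>
     (\<forall>c x is. \<not> (c \<in> A \<and> x \<in> cdom c \<and> length is = k) \<longrightarrow> T c x is = 0) \<and>
     (\<forall>c\<in>A. \<forall>is. smooth_on (coord c ` cdom c) (\<lambda>y. T c (coord_inv c y) is)) \<and>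
     (\<forall>c\<in>A. \<forall>d\<in>A. \<forall>x\<in>cdom c \<inter> cdom d. \<forall>js. length js = k \<longrightarrow>
        T d x js = (\<Sum>is | length is = k. T c x is * (\<Prod>m<k. jac c d x (is ! m) (js ! m))))"

definition Sk :: "('m, 'n::finite) chart set \<Rightarrow> nat \<Rightarrow> ('m, 'n::finite) tensor set" where
  "Sk A k = {T. tensor_field A k T \<and>
     (\<forall>c x is \<sigma>. \<sigma> permutes {..<length is} \<longrightarrow> T c x (permute_list \<sigma> is) = T c x is)}"

definition scalar :: "('m, 'n::finite) chart set \<Rightarrow> ('m \<Rightarrow> real) \<Rightarrow> ('m, 'n::finite) tensor" where
  "scalar A f = (\<lambda>c x is. if c \<in> A \<and> x \<in> cdom c \<and> is = [] then f x else 0)"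

lemma Sk_0:
  assumes A: "smooth_atlas A"
  shows "Sk A 0 = scalar A ` {f. smooth_fun A f}"
proof (intro subset_antisym subsetI)
  have opn: "open (coord c ` cdom c)" if "c \<in> A" for c
    using A that by (simp add: smooth_atlas_def is_chart_def)
  have inv: "coord_inv c y \<in> cdom c" if "y \<in> coord c ` cdom c" for c :: "('a, 'b) chart" and y
    using that by (simp add: coord_inv_def inv_into_into)
  {
    fix T assume "T \<in> Sk A 0"
    then have T: "tensor_field A 0 T"
      by (simp add: Sk_def)
    have "\<exists>c. c \<in> A \<and> x \<in> cdom c" for x
    proof -
      have "x \<in> (\<Union>c\<in>A. cdom c)"
        using A unfolding smooth_atlas_def by blast
      then show ?thesis
        by blast
    qed
    then obtain ch where ch: "ch x \<in> A" "x \<in> cdom (ch x)" for x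
      by metis
    define f where "f x = T (ch x) x []" for x
    have f: "f x = T c x []" if "c \<in> A" "x \<in> cdom c" for c x
    proof -
      have "{is. length is = 0} = {[] :: 'b list}"
        by auto
      moreover have "T (ch x) x [] = (\<Sum>is | length is = 0. T c x is * (\<Prod>m<0. jac c (ch x) x (is ! m) ([] ! m)))"
        using T that ch[of x] unfolding tensor_field_def by blast
      ultimately show ?thesis
        by (simp add: f_def)
    qed
    have T0: "T c x is = 0" if "\<not> (c \<in> A \<and> x \<in> cdom c \<and> length is = 0)" for c x "is"
      using T that unfolding tensor_field_def by blast
    have "T = scalar A f"
    proof (intro ext)
      fix c x "is"
      show "T c x is = scalar A f c x is"
        using T0[of c x "is"] f[of c x] by (cases "c \<in> A \<and> x \<in> cdom c \<and> is = []") (auto simp: scalar_def)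
    qed
    moreover have "smooth_fun A f"
      unfolding smooth_fun_def
    proof
      fix c assume c: "c \<in> A"
      then have "smooth_on (coord c ` cdom c) (\<lambda>y. T c (coord_inv c y) [])"
        using T unfolding tensor_field_def by blast
      then show "smooth_on (coord c ` cdom c) (f \<circ> coord_inv c)"
        using smooth_on_cong[OF opn[OF c], of "\<lambda>y. T c (coord_inv c y) []" "f \<circ> coord_inv c"]
          f[OF c inv] by simp
    qed
    ultimately show "T \<in> scalar A ` {f. smooth_fun A f}"
      by blast
  next
    fix T :: "('a, 'b) tensor" assume "T \<in> scalar A ` {f. smooth_fun A f}"
    then obtain f where f: "smooth_fun A f" and T: "T = scalar A f"
      by blast
    have zero: "smooth_on V (\<lambda>_. 0)" for V :: "(real^'b) set"
    proof -
      have "Ck_on k (\<lambda>_. 0) V" for k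
        by (induction k) (simp_all add: pderiv_at_def [abs_def])
      then show ?thesis
        by (simp add: smooth_on_def)
    qed
    have "smooth_on (coord c ` cdom c) (\<lambda>y. T c (coord_inv c y) is)" if c: "c \<in> A" for c "is"
    proof (cases "is = []")
      case True
      then show ?thesis
        using smooth_on_cong[OF opn[OF c], of "\<lambda>y. T c (coord_inv c y) is" "f \<circ> coord_inv c"]
          f c inv[of _ c] by (simp add: T scalar_def smooth_fun_def)
    next
      case False
      then show ?thesis
        using zero by (simp add: T scalar_def)
    qed
    moreover have "T d x js = (\<Sum>is | length is = 0. T c x is * (\<Prod>m<0. jac c d x (is ! m) (js ! m)))"
      if "c \<in> A" "d \<in> A" "x \<in> cdom c \<inter> cdom d" "length js = 0" for c d x js
    proof -
      have "{is. length is = 0} = {[] :: 'b list}"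
        by auto
      then show ?thesis
        using that by (simp add: T scalar_def)
    qed
    moreover have "T c x is = 0" if "\<not> (c \<in> A \<and> x \<in> cdom c \<and> length is = 0)" for c x "is"
      using that by (auto simp: T scalar_def)
    ultimately have "tensor_field A 0 T"
      unfolding tensor_field_def by blast
    moreover have "permute_list \<sigma> is = [] \<longleftrightarrow> is = []" for \<sigma> and "is" :: "'b list"
      by (simp add: permute_list_def)
    ultimately show "T \<in> Sk A 0"
      by (simp add: Sk_def T scalar_def)
  }
qed

definition differential :: "('m, 'n::finite) chart set \<Rightarrow> ('m \<Rightarrow> real) \<Rightarrow> ('m, 'n::finite) tensor" where
  "differential A f = (\<lambda>c x is. case is of [i] \<Rightarrow> (if c \<in> A then cpd c i f x else 0) | _ \<Rightarrow> 0)"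

definition delta_star :: "('m, 'n::finite) chart set \<Rightarrow> ('m \<Rightarrow> real) \<Rightarrow> ('m, 'n::finite) tensor" where
  "delta_star A f = - differential A f"

definition symmetrize :: "('n list \<Rightarrow> real) \<Rightarrow> 'n list \<Rightarrow> real" where
  "symmetrize t is =
     (\<Sum>\<sigma> | \<sigma> permutes {..<length is}. t (permute_list \<sigma> is)) / fact (length is)"


section \<open>Symplectic manifolds and their brackets\<close>

definition symplectic_form :: "('m, 'n::finite) chart set \<Rightarrow> ('m, 'n::finite) tensor \<Rightarrow> bool" where
  "symplectic_form A \<Omega> \<longleftrightarrow>
     tensor_field A 2 \<Omega> \<and>
     (\<forall>c\<in>A. \<forall>x\<in>cdom c.
        (\<forall>i j. \<Omega> c x [i, j] = - \<Omega> c x [j, i]) \<and>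
        invertible (\<chi> i j. \<Omega> c x [i, j]) \<and>
        (\<forall>i j k. cpd c i (\<lambda>z. \<Omega> c z [j, k]) x + cpd c j (\<lambda>z. \<Omega> c z [k, i]) x
               + cpd c k (\<lambda>z. \<Omega> c z [i, j]) x = 0))"

text \<open>The components of \<open>\<Omega>\<close> with upper indices; the sign of the inverse matrix is determined by
  \<open>\<Omega>\<^sup>i\<^sup>p \<Omega>\<^sub>p\<^sub>j = - \<delta>\<^sub>j\<^sup>i\<close>, see the lemma below.\<close>

definition Omega_up :: "('m, 'n::finite) tensor \<Rightarrow> ('m, 'n::finite) chart \<Rightarrow> 'm \<Rightarrow> 'n \<Rightarrow> 'n \<Rightarrow> real" where
  "Omega_up \<Omega> c x i j = - matrix_inv (\<chi> i j. \<Omega> c x [i, j]) $ i $ j"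

lemma Omega_up_Omega:
  assumes "symplectic_form A \<Omega>" "c \<in> A" "x \<in> cdom c"
  shows "(\<Sum>p\<in>UNIV. Omega_up \<Omega> c x i p * \<Omega> c x [p, j]) = - (if i = j then 1 else 0)"
proof -
  let ?W = "\<chi> i j. \<Omega> c x [i, j]"
  have "invertible ?W"
    using assms unfolding symplectic_form_def by blast
  then have "?W ** matrix_inv ?W = mat 1 \<and> matrix_inv ?W ** ?W = mat 1"
    unfolding invertible_def matrix_inv_def by (rule someI_ex)
  then have "(matrix_inv ?W ** ?W) $ i $ j = mat 1 $ i $ j"
    by simp
  then show ?thesis
    by (simp add: matrix_matrix_mult_def mat_def Omega_up_def sum_negf)
qed

text \<open>An affine connection is given by its Christoffel symbols in all charts:
  \<open>\<nabla>\<^bsub>\<partial>\<^sub>i\<^esub> \<partial>\<^sub>j = \<Gamma> c x i j k \<partial>\<^sub>k\<close>.\<close>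

type_synonym ('m, 'n) connection = "('m, 'n) chart \<Rightarrow> 'm \<Rightarrow> 'n \<Rightarrow> 'n \<Rightarrow> 'n \<Rightarrow> real"

definition affine_connection :: "('m, 'n::finite) chart set \<Rightarrow> ('m, 'n::finite) connection \<Rightarrow> bool" where
  "affine_connection A \<Gamma> \<longleftrightarrow>
     (\<forall>c\<in>A. \<forall>i j k. smooth_on (coord c ` cdom c) (\<lambda>y. \<Gamma> c (coord_inv c y) i j k)) \<and>
     (\<forall>c\<in>A. \<forall>d\<in>A. \<forall>x\<in>cdom c \<inter> cdom d. \<forall>i j k.
        \<Gamma> d x i j k =
          (\<Sum>a\<in>UNIV. \<Sum>b\<in>UNIV. \<Sum>e\<in>UNIV. jac c d x a i * jac c d x b j * jac d c x k e * \<Gamma> c x a b e)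
          + (\<Sum>e\<in>UNIV. jac d c x k e * cpd d i (\<lambda>z. jac c d z e j) x))"

definition torsion_free :: "('m, 'n::finite) chart set \<Rightarrow> ('m, 'n::finite) connection \<Rightarrow> bool" where
  "torsion_free A \<Gamma> \<longleftrightarrow> (\<forall>c\<in>A. \<forall>x\<in>cdom c. \<forall>i j k. \<Gamma> c x i j k = \<Gamma> c x j i k)"

text \<open>\<open>nabla \<Gamma> T c x p is\<close> is the component \<open>\<nabla>\<^sub>p T\<^bsub>is\<^esub>\<close> of the covariant derivative.\<close>

definition nabla ::
  "('m, 'n::finite) connection \<Rightarrow> ('m, 'n::finite) tensor \<Rightarrow> ('m, 'n::finite) chart \<Rightarrow> 'm \<Rightarrow> 'n \<Rightarrow> 'n list \<Rightarrow> real"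
where
  "nabla \<Gamma> T c x p is = cpd c p (\<lambda>z. T c z is) x
     - (\<Sum>m<length is. \<Sum>q\<in>UNIV. \<Gamma> c x p (is ! m) q * T c x (is[m := q]))"

definition symplectic_connection ::
  "('m, 'n::finite) chart set \<Rightarrow> ('m, 'n::finite) tensor \<Rightarrow> ('m, 'n::finite) connection \<Rightarrow> bool"
where
  "symplectic_connection A \<Omega> \<Gamma> \<longleftrightarrow>
     affine_connection A \<Gamma> \<and> torsion_free A \<Gamma> \<and>
     (\<forall>c\<in>A. \<forall>x\<in>cdom c. \<forall>p i j. nabla \<Gamma> \<Omega> c x p [i, j] = 0)"

text \<open>In the following two definitions \<open>\<beta>\<^bsub>J\<^esub>\<^sup>p = \<Omega>\<^sup>p\<^sup>q \<beta>\<^bsub>J q\<^esub>\<close> and \<open>\<nabla>\<^sup>p = \<Omega>\<^sup>p\<^sup>q \<nabla>\<^sub>q\<close>. The factors \<open>k\<close>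
  and \<open>l\<close> make the summands with the truncated \<open>k - 1\<close> or \<open>l - 1\<close> vanish.\<close>

definition alg_bracket_hom ::
  "('m, 'n::finite) tensor \<Rightarrow> nat \<Rightarrow> nat \<Rightarrow> ('m, 'n::finite) tensor \<Rightarrow> ('m, 'n::finite) tensor \<Rightarrow> ('m, 'n::finite) tensor"
where
  "alg_bracket_hom \<Omega> k l \<alpha> \<beta> = (\<lambda>c x. symmetrize (\<lambda>is.
     real k * real l * (\<Sum>p\<in>UNIV. \<Sum>q\<in>UNIV.
       \<alpha> c x (p # take (k - 1) is) * (Omega_up \<Omega> c x p q * \<beta> c x (drop (k - 1) is @ [q])))))"

definition schouten_hom ::
  "('m, 'n::finite) tensor \<Rightarrow> ('m, 'n::finite) connection \<Rightarrow> nat \<Rightarrow> nat \<Rightarrow>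
   ('m, 'n::finite) tensor \<Rightarrow> ('m, 'n::finite) tensor \<Rightarrow> ('m, 'n::finite) tensor"
where
  "schouten_hom \<Omega> \<Gamma> k l \<alpha> \<beta> = (\<lambda>c x. symmetrize (\<lambda>is.
     - real k * (\<Sum>p\<in>UNIV. \<Sum>q\<in>UNIV.
         \<alpha> c x (p # take (k - 1) is) * (Omega_up \<Omega> c x p q * nabla \<Gamma> \<beta> c x q (drop (k - 1) is)))
     + real l * (\<Sum>p\<in>UNIV. \<Sum>q\<in>UNIV.
         \<beta> c x (p # take (l - 1) is) * (Omega_up \<Omega> c x p q * nabla \<Gamma> \<alpha> c x q (drop (l - 1) is)))))"


section \<open>Formal series of symmetric tensors\<close>

type_synonym ('m, 'n) series = "nat \<Rightarrow> ('m, 'n) tensor"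

definition Shat :: "('m, 'n::finite) chart set \<Rightarrow> ('m, 'n::finite) series set" where
  "Shat A = {\<alpha>. \<forall>k. \<alpha> k \<in> Sk A k}"

text \<open>The brackets of components of degrees \<open>k\<close> and \<open>l\<close> have degrees \<open>k + l - 2\<close> and \<open>k + l - 1\<close>.\<close>

definition alg_bracket ::
  "('m, 'n::finite) tensor \<Rightarrow> ('m, 'n::finite) series \<Rightarrow> ('m, 'n::finite) series \<Rightarrow> ('m, 'n::finite) series"
where
  "alg_bracket \<Omega> \<alpha> \<beta> = (\<lambda>m. \<Sum>k\<le>m + 2. alg_bracket_hom \<Omega> k (m + 2 - k) (\<alpha> k) (\<beta> (m + 2 - k)))"

definition schouten ::
  "('m, 'n::finite) tensor \<Rightarrow> ('m, 'n::finite) connection \<Rightarrow>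
   ('m, 'n::finite) series \<Rightarrow> ('m, 'n::finite) series \<Rightarrow> ('m, 'n::finite) series"
where
  "schouten \<Omega> \<Gamma> \<alpha> \<beta> = (\<lambda>m. \<Sum>k\<le>m + 1. schouten_hom \<Omega> \<Gamma> k (m + 1 - k) (\<alpha> k) (\<beta> (m + 1 - k)))"

definition full_bracket ::
  "('m, 'n::finite) tensor \<Rightarrow> ('m, 'n::finite) connection \<Rightarrow>
   ('m, 'n::finite) series \<Rightarrow> ('m, 'n::finite) series \<Rightarrow> ('m, 'n::finite) series"
where
  "full_bracket \<Omega> \<Gamma> \<alpha> \<beta> = alg_bracket \<Omega> \<alpha> \<beta> + schouten \<Omega> \<Gamma> \<alpha> \<beta>"

definition proj :: "nat \<Rightarrow> ('m, 'n::finite) series \<Rightarrow> ('m, 'n::finite) series" where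
  "proj k \<alpha> = (\<lambda>i. if i < k then 0 else \<alpha> i)"

definition top_bracket ::
  "('m, 'n::finite) tensor \<Rightarrow> ('m, 'n::finite) connection \<Rightarrow>
   ('m, 'n::finite) series \<Rightarrow> ('m, 'n::finite) series \<Rightarrow> ('m, 'n::finite) series"
where
  "top_bracket \<Omega> \<Gamma> \<alpha> \<beta> =
     alg_bracket \<Omega> (proj 2 \<alpha>) (proj 2 \<beta>) + schouten \<Omega> \<Gamma> (proj 1 \<alpha>) (proj 1 \<beta>)"

text \<open>The identification of \<open>Sk A 0\<close> with the smooth functions on the manifold is \<open>scalar A\<close>, see the
  lemma \<open>Sk_0\<close> above.\<close>

definition Hhat :: "('m, 'n::finite) chart set \<Rightarrow> ('m, 'n::finite) series set" where
  "Hhat A = {\<alpha> \<in> Shat A. \<exists>f. smooth_fun A f \<and> \<alpha> 0 = scalar A f \<and> \<alpha> 1 = - delta_star A f}"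

definition Bhat1 :: "('m, 'n::finite) chart set \<Rightarrow> ('m, 'n::finite) series set" where
  "Bhat1 A = {\<alpha> \<in> Shat A. \<alpha> 0 = 0 \<and> (\<exists>f. smooth_fun A f \<and> \<alpha> 1 = differential A f)}"

definition iota :: "('m, 'n::finite) chart set \<Rightarrow> real \<Rightarrow> ('m, 'n::finite) series" where
  "iota A r = (\<lambda>k. if k = 0 then scalar A (\<lambda>_. - r) else 0)"

end

theory Submission
  imports Defs "HOL-Computational_Algebra.Formal_Power_Series"
begin

text \<open>In a chart, a symmetric tensor \<open>T\<close> of degree \<open>k\<close> is the same thing as the polynomial
  \<open>v \<mapsto> T\<^bsub>i\<^sub>1\<dots>i\<^sub>k\<^esub> v\<^bsup>i\<^sub>1\<^esup> \<cdots> v\<^bsup>i\<^sub>k\<^esup>\<close> on the tangent spaces, whose iterated derivatives give the components back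
  (\<open>fibre_poly_inject\<close>). A series of symmetric tensors thus becomes a formal power series in one variable \<open>X\<close>
  whose \<open>k\<close>-th coefficient is a polynomial of degree \<open>k\<close> in \<open>v\<close>: its symbol, a function of position \<open>y\<close> and
  velocity \<open>v\<close>. Identities between series can be checked on symbols (\<open>graded_symmetric_eqI\<close>).

  For symbols \<open>F\<close> and \<open>G\<close>, the algebraic bracket is \<open>\<Omega>\<^bsup>pq\<^esup> \<partial>F/\<partial>v\<^sup>p \<partial>G/\<partial>v\<^sup>q\<close>. In the Schouten bracket the
  Christoffel symbols enter only through a combination which, for a torsion-free connection with \<open>\<nabla>\<Omega> = 0\<close>, is a derivative of
  \<open>\<Omega>\<^bsup>pq\<^esup>\<close>. Together, the bracket of two series is the Poisson bracket of their symbols for the bivector on the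
  tangent bundle which is the vertical lift of \<open>\<Omega>\<^bsup>pq\<^esup>\<close> minus \<open>X\<close> times its complete lift
  (\<open>symbol_full_bracket\<close>).

  The general facts about the bracket follow from this description. The two lifts of a Poisson tensor are compatible Poisson
  tensors, which gives the Jacobi identity (\<open>lifted_bivector_jacobi\<close>). Both lifts are natural, that is, preserved by
  the tangent map of a change of coordinates, so the bracket of two series has tensorial components
  (\<open>full_bracket_transform\<close>). Hence all series form a Lie algebra (\<open>lie_algebra_Shat\<close>).

  The symbol of a series in \<open>Hhat A\<close> begins with \<open>f + X v\<^sup>i \<partial>\<^sub>i f\<close>. Comparing the lowest coefficients, the bracket of two
  such series begins with \<open>- \<Omega>\<^bsup>pq\<^esup> \<partial>\<^sub>p f \<partial>\<^sub>q g\<close> followed by the derivative of this function along \<open>v\<close>, so it is again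
  in \<open>Hhat A\<close> (\<open>full_bracket_in_Hhat\<close>). In degrees at least one, the Schouten brackets with the constant parts cancel the algebraic
  brackets with the linear parts, because the latter are the differentials of the former; what remains is
  \<open>top_bracket\<close> of the series without their constant parts (\<open>proj_1_full_bracket\<close>). Thus \<open>proj 1\<close> is a homomorphism onto
  \<open>Bhat1 A\<close>, which inherits the Lie algebra axioms. A series in its kernel is a function with vanishing differential, hence constant
  on a connected manifold (\<open>kernel_proj_1\<close>).\<close>

section \<open>Partial derivatives\<close>

text \<open>Sums over all values of an index, as in the summation convention.\<close>

abbreviation sum_all :: "('i \<Rightarrow> 'a::comm_monoid_add) \<Rightarrow> 'a" (binder "\<Sum>*" 10) where
  "sum_all f \<equiv> sum f UNIV"

lemma has_derivative_pderiv_at: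
  fixes f :: "real^'n \<Rightarrow> real"
  assumes "f differentiable at y"
  shows "(f has_derivative (\<lambda>h. \<Sum>*i. h $ i * pderiv_at i f y)) (at y)"
proof -
  let ?f' = "frechet_derivative f (at y)"
  have f': "(f has_derivative ?f') (at y)"
    using assms frechet_derivative_works by blast
  then have "linear ?f'"
    by (rule has_derivative_linear)
  have "?f' h = (\<Sum>*i. h $ i * pderiv_at i f y)" for h
  proof -
    have "?f' h = ?f' (\<Sum>*i. (h $ i) *\<^sub>R axis i 1)"
      by (simp add: basis_expansion flip: scalar_mult_eq_scaleR)
    also have "\<dots> = (\<Sum>*i. h $ i * ?f' (axis i 1))"
      using \<open>linear ?f'\<close> by (simp add: linear_sum linear_cmul)
    finally show ?thesis
      by (simp add: pderiv_at_def)
  qed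
  then have "?f' = (\<lambda>h. \<Sum>*i. h $ i * pderiv_at i f y)"
    by blast
  with f' show ?thesis
    by simp
qed

lemma pderiv_at_eqI:
  assumes "(f has_derivative f') (at y)"
  shows "pderiv_at i f y = f' (axis i 1)"
  using frechet_derivative_at[OF assms] by (simp add: pderiv_at_def)

lemma pderiv_at_cong:
  assumes "open V" "y \<in> V" "\<And>z. z \<in> V \<Longrightarrow> f z = g z"
  shows "pderiv_at i f y = pderiv_at i g y"
proof -
  have "(f has_derivative f') (at y) \<longleftrightarrow> (g has_derivative f') (at y)" for f'
    by (intro iffI; erule has_derivative_transform_within_open[OF _ assms(1,2)]) (simp_all add: assms(3))
  then show ?thesis
    by (simp add: pderiv_at_def frechet_derivative_def)
qed

lemma pderiv_at_const [simp]: "pderiv_at i (\<lambda>_. c) = (\<lambda>_. 0)"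
  by (simp add: pderiv_at_def [abs_def])

lemma pderiv_at_add:
  assumes "f differentiable at y" "g differentiable at y"
  shows "pderiv_at i (\<lambda>z. f z + g z) y = pderiv_at i f y + pderiv_at i g y"
proof -
  have "((\<lambda>z. f z + g z) has_derivative
      (\<lambda>h. frechet_derivative f (at y) h + frechet_derivative g (at y) h)) (at y)"
    using assms by (intro has_derivative_add) (simp_all flip: frechet_derivative_works)
  from pderiv_at_eqI[OF this] show ?thesis
    by (simp add: pderiv_at_def)
qed

lemma pderiv_at_mult:
  fixes f g :: "real^'n \<Rightarrow> real"
  assumes "f differentiable at y" "g differentiable at y"
  shows "pderiv_at i (\<lambda>z. f z * g z) y = pderiv_at i f y * g y + f y * pderiv_at i g y"
proof -
  have "((\<lambda>z. f z * g z) has_derivative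
      (\<lambda>h. f y * frechet_derivative g (at y) h + frechet_derivative f (at y) h * g y)) (at y)"
    using assms by (intro has_derivative_mult) (simp_all flip: frechet_derivative_works)
  from pderiv_at_eqI[OF this] show ?thesis
    by (simp add: pderiv_at_def)
qed

lemma pderiv_at_sum:
  assumes "finite S" "\<And>s. s \<in> S \<Longrightarrow> f s differentiable at y"
  shows "pderiv_at i (\<lambda>z. \<Sum>s\<in>S. f s z) y = (\<Sum>s\<in>S. pderiv_at i (f s) y)"
  using assms
proof (induction rule: finite_induct)
  case (insert s S)
  then show ?case
    by (simp add: pderiv_at_add differentiable_sum)
qed simp

lemma differentiable_vec_nth: "(\<lambda>z :: real^'a. z $ j) differentiable at w"
  by (rule bounded_linear_imp_differentiable[OF bounded_linear_vec_nth])

lemma pderiv_at_coordinate: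
  "pderiv_at i (\<lambda>z. z $ j) y = (if i = j then 1 else 0)"
  using pderiv_at_eqI[OF bounded_linear.has_derivative[OF bounded_linear_vec_nth has_derivative_ident], of i j y]
  by (simp add: axis_def)

lemma pderiv_at_inverse:
  assumes "f differentiable at y" "f y \<noteq> 0"
  shows "pderiv_at i (\<lambda>z. inverse (f z)) y = - pderiv_at i f y * (inverse (f y) * inverse (f y))"
proof -
  have "((\<lambda>z. inverse (f z)) has_derivative
      (\<lambda>h. - (inverse (f y) * frechet_derivative f (at y) h * inverse (f y)))) (at y)"
    using assms by (intro Deriv.has_derivative_inverse) (simp_all flip: frechet_derivative_works)
  from pderiv_at_eqI[OF this] show ?thesis
    by (simp add: pderiv_at_def)
qed

lemma pderiv_at_chain:
  fixes f :: "real^'b \<Rightarrow> real" and \<Phi> :: "real^'a \<Rightarrow> real^'b"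
  assumes "f differentiable at (\<Phi> y)" "\<And>b. (\<lambda>z. \<Phi> z $ b) differentiable at y"
  shows "pderiv_at i (\<lambda>z. f (\<Phi> z)) y = (\<Sum>*b. pderiv_at b f (\<Phi> y) * pderiv_at i (\<lambda>z. \<Phi> z $ b) y)"
proof -
  have "((\<lambda>z. \<Phi> z) has_derivative (\<lambda>h. \<chi> b. frechet_derivative (\<lambda>z. \<Phi> z $ b) (at y) h)) (at y)"
    (is "(_ has_derivative ?D) _")
  proof (subst has_derivative_componentwise_within, rule ballI)
    fix e :: "real^'b" assume "e \<in> Basis"
    then obtain b where e: "e = axis b 1"
      by (auto simp: Basis_vec_def)
    have "((\<lambda>z. \<Phi> z $ b) has_derivative frechet_derivative (\<lambda>z. \<Phi> z $ b) (at y)) (at y)"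
      using assms(2) frechet_derivative_works by blast
    then show "((\<lambda>z. \<Phi> z \<bullet> e) has_derivative (\<lambda>h. ?D h \<bullet> e)) (at y)"
      by (simp add: e inner_axis)
  qed
  from has_derivative_compose[OF this has_derivative_pderiv_at[OF assms(1)]]
  show ?thesis
    by (subst pderiv_at_eqI, assumption) (simp add: pderiv_at_def mult.commute)
qed

section \<open>Smooth functions on open sets\<close>

lemma smooth_on_differentiable:
  assumes "smooth_on V f" "open V" "y \<in> V"
  shows "f differentiable at y"
proof -
  have "Ck_on (Suc 0) f V"
    using assms(1) by (simp only: smooth_on_def)
  then show ?thesis
    using assms(2,3) by (simp add: differentiable_on_eq_differentiable_at)
qed

lemma smooth_on_pderiv_at:
  assumes "smooth_on V f"
  shows "smooth_on V (pderiv_at i f)"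
  unfolding smooth_on_def
proof
  fix k
  have "Ck_on (Suc k) f V"
    using assms by (simp only: smooth_on_def)
  then show "Ck_on k (pderiv_at i f) V"
    by simp
qed

lemma smooth_on_continuous_on: "smooth_on V f \<Longrightarrow> continuous_on V f"
  unfolding smooth_on_def by (metis Ck_on.simps(1))

text \<open>Smoothness is coinductive, which spares an induction on the order of
  differentiability in proofs of closure properties.\<close>

lemma smooth_on_coinduct:
  assumes "P f" and V: "open V"
    and step: "\<And>f y. P f \<Longrightarrow> y \<in> V \<Longrightarrow> f differentiable at y"
      "\<And>f i. P f \<Longrightarrow> \<exists>g. P g \<and> (\<forall>y\<in>V. pderiv_at i f y = g y)"
  shows "smooth_on V f"
proof -
  have "Ck_on k f V" if "P f" for k f
    using that
  proof (induction k arbitrary: f)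
    case 0
    then show ?case
      using step(1)[OF 0] by (auto intro!: continuous_at_imp_continuous_on differentiable_imp_continuous_within)
  next
    case (Suc k)
    have "Ck_on k (pderiv_at i f) V" for i
    proof -
      obtain g where "P g" "\<forall>y\<in>V. pderiv_at i f y = g y"
        using step(2)[OF Suc.prems] by blast
      then show ?thesis
        using Ck_on_cong[OF V, of g "pderiv_at i f" k] Suc.IH by auto
    qed
    then show ?case
      using step(1)[OF Suc.prems] V by (simp add: differentiable_on_eq_differentiable_at)
  qed
  with assms(1) show ?thesis
    by (simp add: smooth_on_def)
qed

lemma smooth_on_const: "smooth_on V (\<lambda>_. c)"
proof -
  have "Ck_on k (\<lambda>_. c) V" for k c
    by (induction k arbitrary: c) simp_all
  then show ?thesis
    by (simp add: smooth_on_def)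
qed

lemma smooth_on_subset:
  assumes "smooth_on V f" "open V" "open U" "U \<subseteq> V"
  shows "smooth_on U f"
  by (rule smooth_on_coinduct[where P = "smooth_on V", OF assms(1,3)])
    (use assms smooth_on_differentiable smooth_on_pderiv_at in blast)+

lemma sum_lessThan_add:
  fixes h :: "nat \<Rightarrow> 'a::comm_monoid_add"
  shows "(\<Sum>n<N + M. h n) = (\<Sum>n<N. h n) + (\<Sum>n<M. h (N + n))"
  by (induction M) (simp_all add: add.assoc)

text \<open>A single product is not preserved by the Leibniz rule, but a sum of products is. The derivative of a
  sum of \<open>N\<close> products is listed as \<open>2 N\<close> products: first the ones with a differentiated left factor, then those with a
  differentiated right factor.\<close>

lemma smooth_on_sum_mult:
  assumes "\<And>n. n < N \<Longrightarrow> smooth_on V (f n)" "\<And>n. n < N \<Longrightarrow> smooth_on V (g n)" "open V"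
  shows "smooth_on V (\<lambda>y. \<Sum>n<(N::nat). f n y * g n y)"
proof (rule smooth_on_coinduct[where P = "\<lambda>h. \<exists>(N::nat) f g. (\<forall>n<N. smooth_on V (f n) \<and> smooth_on V (g n))
    \<and> h = (\<lambda>y. \<Sum>n<N. f n y * g n y)"])
  show "\<exists>(N'::nat) f' g'. (\<forall>n<N'. smooth_on V (f' n) \<and> smooth_on V (g' n))
      \<and> (\<lambda>y. \<Sum>n<N. f n y * g n y) = (\<lambda>y. \<Sum>n<N'. f' n y * g' n y)"
    using assms by (intro exI[of _ N] exI[of _ f] exI[of _ g]) auto
  fix h assume "\<exists>(N::nat) f g. (\<forall>n<N. smooth_on V (f n) \<and> smooth_on V (g n)) \<and> h = (\<lambda>y. \<Sum>n<N. f n y * g n y)"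
  then obtain N :: nat and f g where fg: "\<And>n. n < N \<Longrightarrow> smooth_on V (f n)" "\<And>n. n < N \<Longrightarrow> smooth_on V (g n)"
    and h: "h = (\<lambda>y. \<Sum>n<N. f n y * g n y)"
    by blast
  have d: "f n differentiable at y" "g n differentiable at y" if "n < N" "y \<in> V" for n y
    using fg that smooth_on_differentiable[OF _ \<open>open V\<close>] by auto
  then show "h differentiable at y" if "y \<in> V" for y
    unfolding h using that by (auto intro!: differentiable_sum differentiable_mult)
  fix i
  let ?f' = "\<lambda>n. if n < N then pderiv_at i (f n) else f (n - N)"
  let ?g' = "\<lambda>n. if n < N then g n else pderiv_at i (g (n - N))"
  have "\<forall>n<N + N. smooth_on V (?f' n) \<and> smooth_on V (?g' n)"
    using fg by (auto intro: smooth_on_pderiv_at)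
  moreover have "pderiv_at i h y = (\<Sum>n<N + N. ?f' n y * ?g' n y)" if "y \<in> V" for y
  proof -
    have "pderiv_at i h y = (\<Sum>n<N. pderiv_at i (f n) y * g n y + f n y * pderiv_at i (g n) y)"
      unfolding h using d[OF _ that] by (subst pderiv_at_sum) (auto simp: pderiv_at_mult differentiable_mult)
    also have "\<dots> = (\<Sum>n<N. ?f' n y * ?g' n y) + (\<Sum>n<N. ?f' (N + n) y * ?g' (N + n) y)"
      by (simp add: sum.distrib)
    also have "\<dots> = (\<Sum>n<N + N. ?f' n y * ?g' n y)"
      by (rule sum_lessThan_add [symmetric])
    finally show ?thesis .
  qed
  ultimately show "\<exists>h'. (\<exists>(N::nat) f g. (\<forall>n<N. smooth_on V (f n) \<and> smooth_on V (g n)) \<and> h' = (\<lambda>y. \<Sum>n<N. f n y * g n y))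
      \<and> (\<forall>y\<in>V. pderiv_at i h y = h' y)"
    by (intro exI[of _ "\<lambda>y. \<Sum>n<N + N. ?f' n y * ?g' n y"] conjI exI[of _ "N + N"] exI[of _ ?f'] exI[of _ ?g'] ballI) simp_all
qed (fact assms)

lemma smooth_on_mult:
  assumes "smooth_on V f" "smooth_on V g" "open V"
  shows "smooth_on V (\<lambda>y. f y * g y)"
  using smooth_on_sum_mult[of 1 V "\<lambda>_. f" "\<lambda>_. g"] assms by simp

lemma smooth_on_add:
  assumes "smooth_on V f" "smooth_on V g" "open V"
  shows "smooth_on V (\<lambda>y. f y + g y)"
  using smooth_on_sum_mult[of 2 V "\<lambda>n. if n = 0 then f else g" "\<lambda>_ _. 1"] assms
  by (simp add: smooth_on_const numeral_2_eq_2)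

lemma smooth_on_sum:
  assumes "\<And>s. s \<in> S \<Longrightarrow> smooth_on V (f s)" "open V"
  shows "smooth_on V (\<lambda>y. \<Sum>s\<in>S. f s y)"
  using assms(1)
proof (induction S rule: infinite_finite_induct)
  case (insert s S)
  then show ?case
    by (simp add: smooth_on_add \<open>open V\<close>)
qed (simp_all add: smooth_on_const)

lemma smooth_on_minus: "smooth_on V f \<Longrightarrow> open V \<Longrightarrow> smooth_on V (\<lambda>y. - f y)"
  using smooth_on_mult[OF smooth_on_const[of V "- 1"]] by fastforce

lemma smooth_on_diff: "smooth_on V f \<Longrightarrow> smooth_on V g \<Longrightarrow> open V \<Longrightarrow> smooth_on V (\<lambda>y. f y - g y)"
  using smooth_on_add[OF _ smooth_on_minus] by fastforce

lemma smooth_on_prod: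
  assumes "\<And>s. s \<in> S \<Longrightarrow> smooth_on V (f s)" "open V"
  shows "smooth_on V (\<lambda>y. \<Prod>s\<in>S. f s y)"
  using assms(1)
proof (induction S rule: infinite_finite_induct)
  case (insert s S)
  then show ?case
    by (simp add: smooth_on_mult \<open>open V\<close>)
qed (simp_all add: smooth_on_const)

lemma smooth_on_coordinate:
  assumes "open V"
  shows "smooth_on V (\<lambda>y. y $ j)"
proof (rule smooth_on_coinduct[where P = "\<lambda>h. h = (\<lambda>y. y $ j) \<or> (\<exists>c. h = (\<lambda>_. c))"])
  show "h differentiable at y" if "h = (\<lambda>y. y $ j) \<or> (\<exists>c. h = (\<lambda>_. c))" for h and y :: "real^'a"
    using that by (auto intro: differentiable_vec_nth)
  show "\<exists>g. (g = (\<lambda>y. y $ j) \<or> (\<exists>c. g = (\<lambda>_. c))) \<and> (\<forall>y\<in>V. pderiv_at i h y = g y)"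
    if "h = (\<lambda>y. y $ j) \<or> (\<exists>c. h = (\<lambda>_. c))" for h i
    using that by (auto simp: pderiv_at_coordinate)
qed (use assms in auto)

text \<open>The functions \<open>g / f\<^sup>n\<close> are closed under differentiation.\<close>

lemma smooth_on_inverse:
  fixes f :: "real^'a \<Rightarrow> real"
  assumes f: "smooth_on V f" and V: "open V" and nz: "\<And>y. y \<in> V \<Longrightarrow> f y \<noteq> 0"
  shows "smooth_on V (\<lambda>y. inverse (f y))"
proof (rule smooth_on_coinduct[where P = "\<lambda>h. \<exists>g n. smooth_on V g \<and> h = (\<lambda>y. g y * inverse (f y) ^ n)"])
  show "\<exists>g n. smooth_on V g \<and> (\<lambda>y. inverse (f y)) = (\<lambda>y. g y * inverse (f y) ^ n)"
    using smooth_on_const[of V 1] by (intro exI[of _ "\<lambda>_. 1"] exI[of _ "1::nat"]) simp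
  fix h assume "\<exists>g n. smooth_on V g \<and> h = (\<lambda>y. g y * inverse (f y) ^ n)"
  then obtain g n where g: "smooth_on V g" and h: "h = (\<lambda>y. g y * inverse (f y) ^ n)"
    by blast
  have df: "f differentiable at y" and dg: "g differentiable at y" if "y \<in> V" for y
    using f g that smooth_on_differentiable[OF _ V] by auto
  have dinv: "(\<lambda>y. inverse (f y)) differentiable at y" if "y \<in> V" for y
    using df nz that by (intro differentiable_inverse) auto
  have dpow: "(\<lambda>y. inverse (f y) ^ m) differentiable at y" if "y \<in> V" for m y
    using dinv that by (intro differentiable_power) auto
  show "h differentiable at y" if "y \<in> V" for y
    unfolding h using dg dpow that by (intro differentiable_mult) auto
  fix i
  have pow: "pderiv_at i (\<lambda>y. inverse (f y) ^ m) y = - real m * pderiv_at i f y * inverse (f y) ^ Suc m"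
    if "y \<in> V" for m y
  proof (induction m)
    case (Suc m)
    then show ?case
      using dinv[OF that] dpow[OF that] df[OF that] nz[OF that]
      by (simp add: pderiv_at_mult pderiv_at_inverse algebra_simps)
  qed simp
  let ?g' = "\<lambda>y. pderiv_at i g y * f y + (- real n) * (g y * pderiv_at i f y)"
  have "smooth_on V ?g'"
    using f g V by (intro smooth_on_add smooth_on_mult smooth_on_const smooth_on_pderiv_at)
  moreover have "\<forall>y\<in>V. pderiv_at i h y = ?g' y * inverse (f y) ^ Suc n"
    unfolding h using dg dpow pow nz by (auto simp: pderiv_at_mult algebra_simps)
  ultimately show "\<exists>h'. (\<exists>g n. smooth_on V g \<and> h' = (\<lambda>y. g y * inverse (f y) ^ n)) \<and> (\<forall>y\<in>V. pderiv_at i h y = h' y)"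
    by (intro exI[of _ "\<lambda>y. ?g' y * inverse (f y) ^ Suc n"]) blast
qed (fact V)

text \<open>By Cramer's rule, an entry of the inverse is a quotient of determinants, which are polynomials in
  the entries.\<close>

lemma smooth_on_matrix_inv:
  fixes M :: "real^'a \<Rightarrow> real^'n^'n"
  assumes M: "\<And>i j. smooth_on V (\<lambda>y. M y $ i $ j)" and V: "open V"
    and inv: "\<And>y. y \<in> V \<Longrightarrow> invertible (M y)"
  shows "smooth_on V (\<lambda>y. matrix_inv (M y) $ i $ j)"
proof -
  let ?N = "\<lambda>y. (\<chi> a b. if b = i then axis j 1 $ a else M y $ a $ b)"
  have "smooth_on V (\<lambda>y. det (M y))"
    unfolding det_def using V M by (intro smooth_on_sum smooth_on_mult smooth_on_const smooth_on_prod)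
  then have 1: "smooth_on V (\<lambda>y. inverse (det (M y)))"
    using V inv by (intro smooth_on_inverse) (auto simp: invertible_det_nz)
  have "smooth_on V (\<lambda>y. ?N y $ a $ b)" for a b
    using M smooth_on_const by (cases "b = i") auto
  then have 2: "smooth_on V (\<lambda>y. det (?N y))"
    unfolding det_def using V by (intro smooth_on_sum smooth_on_mult smooth_on_const smooth_on_prod)
  have eq: "det (?N y) * inverse (det (M y)) = matrix_inv (M y) $ i $ j" if "y \<in> V" for y
  proof -
    have "M y ** matrix_inv (M y) = mat 1"
      using someI_ex[OF inv[OF that, unfolded invertible_def]] by (simp add: matrix_inv_def)
    then have "M y *v (matrix_inv (M y) *v axis j 1) = axis j 1"
      by (simp add: matrix_vector_mul_assoc)
    then have "matrix_inv (M y) *v axis j 1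
        = (\<chi> k. det (\<chi> a b. if b = k then axis j 1 $ a else M y $ a $ b) / det (M y))"
      using cramer[of "M y"] inv[OF that] by (simp add: invertible_det_nz)
    then have "(matrix_inv (M y) *v axis j 1) $ i = det (?N y) / det (M y)"
      by simp
    then show ?thesis
      by (simp add: matrix_vector_mult_basis column_def divide_inverse)
  qed
  have "smooth_on V (\<lambda>y. det (?N y) * inverse (det (M y)))"
    using 1 2 V by (intro smooth_on_mult)
  then show ?thesis
    using smooth_on_cong[of V "\<lambda>y. det (?N y) * inverse (det (M y))" "\<lambda>y. matrix_inv (M y) $ i $ j"] V eq
    by simp
qed

lemma DERIV_along_axis:
  fixes f :: "real^'n \<Rightarrow> real"
  assumes "f differentiable at (z + s *\<^sub>R axis i 1)"
  shows "((\<lambda>s. f (z + s *\<^sub>R axis i 1)) has_real_derivative pderiv_at i f (z + s *\<^sub>R axis i 1)) (at s)"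
proof -
  let ?f' = "frechet_derivative f (at (z + s *\<^sub>R axis i 1))"
  have f': "(f has_derivative ?f') (at (z + s *\<^sub>R axis i 1))"
    using assms frechet_derivative_works by blast
  have "((\<lambda>s. z + s *\<^sub>R axis i 1) has_derivative (\<lambda>h. h *\<^sub>R axis i 1)) (at s)"
    by (auto intro!: derivative_eq_intros)
  from has_derivative_compose[OF this f']
  have "((\<lambda>s. f (z + s *\<^sub>R axis i 1)) has_derivative (\<lambda>h. ?f' (h *\<^sub>R axis i 1))) (at s)" .
  moreover have "?f' (h *\<^sub>R axis i 1) = pderiv_at i f (z + s *\<^sub>R axis i 1) * h" for h
    using has_derivative_linear[OF f'] by (simp add: linear_cmul pderiv_at_def)
  ultimately show ?thesis
    by (simp add: has_field_derivative_def)
qed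

text \<open>The mean value theorem is applied twice, first to the difference in the \<open>j\<close>-direction as a function of
  the \<open>i\<close>-th coordinate, and then to the derivative so obtained.\<close>

lemma second_difference_mean_value:
  fixes f :: "real^'n \<Rightarrow> real"
  assumes f: "smooth_on V f" and V: "open V" and h: "h > 0"
    and ball: "cball y (2 * h) \<subseteq> V"
  obtains z where "dist z y \<le> 2 * h"
    "f (y + h *\<^sub>R axis i 1 + h *\<^sub>R axis j 1) - f (y + h *\<^sub>R axis i 1) - f (y + h *\<^sub>R axis j 1) + f y
      = h * h * pderiv_at j (pderiv_at i f) z"
proof -
  have near: "dist (y + s *\<^sub>R axis i 1 + t *\<^sub>R axis j 1) y \<le> 2 * h" if "0 \<le> s" "s \<le> h" "0 \<le> t" "t \<le> h" for s t
    using that norm_triangle_ineq[of "s *\<^sub>R axis i (1::real)" "t *\<^sub>R axis j (1::real)"]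
    by (simp add: dist_norm add.assoc)
  then have V': "y + s *\<^sub>R axis i 1 + t *\<^sub>R axis j 1 \<in> V" if "0 \<le> s" "s \<le> h" "0 \<le> t" "t \<le> h" for s t
    using that ball by (auto simp: dist_commute subset_iff)
  have d: "f differentiable at (y + s *\<^sub>R axis i 1 + t *\<^sub>R axis j 1)"
      "pderiv_at i f differentiable at (y + s *\<^sub>R axis i 1 + t *\<^sub>R axis j 1)" if "0 \<le> s" "s \<le> h" "0 \<le> t" "t \<le> h" for s t
    using smooth_on_differentiable[OF _ V V'[OF that]] f smooth_on_pderiv_at by blast+
  define u where "u s = f (y + h *\<^sub>R axis j 1 + s *\<^sub>R axis i 1) - f (y + s *\<^sub>R axis i 1)" for s
  let ?u' = "\<lambda>s. pderiv_at i f (y + h *\<^sub>R axis j 1 + s *\<^sub>R axis i 1) - pderiv_at i f (y + s *\<^sub>R axis i 1)"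
  have "(u has_real_derivative ?u' s) (at s)" if "0 \<le> s" "s \<le> h" for s
    unfolding u_def using d(1)[OF that, of h] d(1)[OF that, of 0] h
    by (intro DERIV_diff DERIV_along_axis) (simp_all add: ac_simps)
  then obtain s where s: "0 < s" "s < h" "u h - u 0 = (h - 0) * ?u' s"
    using MVT2[OF h, of u ?u'] by blast
  define w where "w t = pderiv_at i f (y + s *\<^sub>R axis i 1 + t *\<^sub>R axis j 1)" for t
  let ?w' = "\<lambda>t. pderiv_at j (pderiv_at i f) (y + s *\<^sub>R axis i 1 + t *\<^sub>R axis j 1)"
  have "(w has_real_derivative ?w' t) (at t)" if "0 \<le> t" "t \<le> h" for t
    unfolding w_def using d(2)[of s t] that s by (intro DERIV_along_axis) auto
  then obtain t where t: "0 < t" "t < h" "w h - w 0 = (h - 0) * ?w' t"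
    using MVT2[OF h, of w ?w'] by blast
  have "u h - u 0 = h * (w h - w 0)"
    using s by (simp add: w_def ac_simps)
  with t have "u h - u 0 = h * h * ?w' t"
    by simp
  then have "f (y + h *\<^sub>R axis i 1 + h *\<^sub>R axis j 1) - f (y + h *\<^sub>R axis i 1) - f (y + h *\<^sub>R axis j 1) + f y = h * h * ?w' t"
    by (simp add: u_def add.assoc add.commute[of "h *\<^sub>R axis j 1"])
  moreover have "dist (y + s *\<^sub>R axis i 1 + t *\<^sub>R axis j 1) y \<le> 2 * h"
    using s t by (intro near) auto
  ultimately show ?thesis
    by (rule that[rotated])
qed

text \<open>Both mixed derivatives are limits of the same second difference quotient, which is symmetric
  in the two directions.\<close>

lemma pderiv_at_commute:
  fixes f :: "real^'n \<Rightarrow> real"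
  assumes f: "smooth_on V f" and V: "open V" and y: "y \<in> V"
  shows "pderiv_at i (pderiv_at j f) y = pderiv_at j (pderiv_at i f) y"
proof (rule ccontr)
  let ?A = "pderiv_at i (pderiv_at j f)" and ?B = "pderiv_at j (pderiv_at i f)"
  assume "?A y \<noteq> ?B y"
  then have e: "\<bar>?A y - ?B y\<bar> / 2 > 0" (is "?e > 0")
    by simp
  have "smooth_on V ?A" "smooth_on V ?B"
    using smooth_on_pderiv_at[OF smooth_on_pderiv_at[OF f]] by auto
  then have "isCont ?A y" "isCont ?B y"
    using V y by (auto dest!: smooth_on_continuous_on simp: continuous_on_eq_continuous_at)
  note cont = this [unfolded continuous_at_eps_delta, rule_format, OF e]
  obtain a where a: "a > 0" "\<And>z. dist z y < a \<Longrightarrow> dist (?A z) (?A y) < ?e"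
    using cont(1) by blast
  obtain b where b: "b > 0" "\<And>z. dist z y < b \<Longrightarrow> dist (?B z) (?B y) < ?e"
    using cont(2) by blast
  obtain r where r: "r > 0" "cball y r \<subseteq> V"
    using V y open_contains_cball by blast
  \<comment> \<open>Small enough for the two intermediate points, at distance at most \<open>2 h\<close>, to lie in all three balls.\<close>
  define h where "h = min r (min a b) / 3"
  have h: "h > 0" "2 * h < a" "2 * h < b" "2 * h \<le> r"
    using a b r by (auto simp: h_def min_def)
  then have ball: "cball y (2 * h) \<subseteq> V"
    using r by auto
  obtain z where z: "dist z y \<le> 2 * h"
    "f (y + h *\<^sub>R axis i 1 + h *\<^sub>R axis j 1) - f (y + h *\<^sub>R axis i 1) - f (y + h *\<^sub>R axis j 1) + f y = h * h * ?B z"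
    using second_difference_mean_value[OF f V h(1) ball] by blast
  obtain z' where z': "dist z' y \<le> 2 * h"
    "f (y + h *\<^sub>R axis j 1 + h *\<^sub>R axis i 1) - f (y + h *\<^sub>R axis j 1) - f (y + h *\<^sub>R axis i 1) + f y = h * h * ?A z'"
    using second_difference_mean_value[OF f V h(1) ball] by blast
  have "h * h * ?B z = h * h * ?A z'"
    unfolding z(2)[symmetric] z'(2)[symmetric] by (simp add: ac_simps)
  then have "?A z' = ?B z"
    using h by simp
  moreover have "dist (?A z') (?A y) < ?e" "dist (?B z) (?B y) < ?e"
    using a b z z' h by auto
  ultimately show False
    by (simp add: dist_real_def abs_if split: if_splits)
qed

section \<open>Poisson brackets of power series valued functions\<close>

text \<open>Everything is meant coefficientwise. The formal variable will record the degree of a tensor, so that infinite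
  series of tensors are handled without any question of convergence.\<close>

definition fps_smooth_on :: "(real^'a) set \<Rightarrow> (real^'a \<Rightarrow> real fps) \<Rightarrow> bool" where
  "fps_smooth_on V F \<longleftrightarrow> (\<forall>n. smooth_on V (\<lambda>w. fps_nth (F w) n))"

definition fps_pderiv_at :: "'a \<Rightarrow> (real^'a \<Rightarrow> real fps) \<Rightarrow> real^'a \<Rightarrow> real fps" where
  "fps_pderiv_at A F w = Abs_fps (\<lambda>n. pderiv_at A (\<lambda>w. fps_nth (F w) n) w)"

lemma fps_pderiv_at_nth [simp]:
  "fps_nth (fps_pderiv_at A F w) n = pderiv_at A (\<lambda>w. fps_nth (F w) n) w"
  by (simp add: fps_pderiv_at_def)

lemma fps_smooth_on_nth: "fps_smooth_on V F \<Longrightarrow> smooth_on V (\<lambda>w. fps_nth (F w) n)"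
  by (simp add: fps_smooth_on_def)

lemma fps_smooth_on_differentiable:
  "fps_smooth_on V F \<Longrightarrow> open V \<Longrightarrow> w \<in> V \<Longrightarrow> (\<lambda>w. fps_nth (F w) n) differentiable at w"
  using smooth_on_differentiable by (auto simp: fps_smooth_on_def)

lemma fps_smooth_on_fps_pderiv_at: "fps_smooth_on V F \<Longrightarrow> fps_smooth_on V (fps_pderiv_at A F)"
  by (simp add: fps_smooth_on_def smooth_on_pderiv_at)

lemma fps_smooth_on_const: "fps_smooth_on V (\<lambda>_. c)"
  by (simp add: fps_smooth_on_def smooth_on_const)

lemma fps_smooth_on_fps_const: "smooth_on V f \<Longrightarrow> fps_smooth_on V (\<lambda>w. fps_const (f w))"
proof -
  assume "smooth_on V f"
  then have "smooth_on V (\<lambda>w. if n = 0 then f w else 0)" for n :: nat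
    by (cases "n = 0") (simp_all add: smooth_on_const)
  then show ?thesis
    by (simp add: fps_smooth_on_def)
qed

lemma fps_smooth_on_minus: "fps_smooth_on V F \<Longrightarrow> open V \<Longrightarrow> fps_smooth_on V (\<lambda>w. - F w)"
  by (simp add: fps_smooth_on_def smooth_on_minus)

lemma fps_smooth_on_diff:
  "fps_smooth_on V F \<Longrightarrow> fps_smooth_on V G \<Longrightarrow> open V \<Longrightarrow> fps_smooth_on V (\<lambda>w. F w - G w)"
  by (simp add: fps_smooth_on_def smooth_on_diff)

lemma fps_smooth_on_mult:
  "fps_smooth_on V F \<Longrightarrow> fps_smooth_on V G \<Longrightarrow> open V \<Longrightarrow> fps_smooth_on V (\<lambda>w. F w * G w)"
  by (auto simp: fps_smooth_on_def fps_mult_nth intro!: smooth_on_sum smooth_on_mult)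

lemma fps_smooth_on_sum:
  "(\<And>s. s \<in> S \<Longrightarrow> fps_smooth_on V (F s)) \<Longrightarrow> open V \<Longrightarrow> fps_smooth_on V (\<lambda>w. \<Sum>s\<in>S. F s w)"
  by (auto simp: fps_smooth_on_def fps_sum_nth intro!: smooth_on_sum)

lemma fps_pderiv_at_cong:
  "open V \<Longrightarrow> w \<in> V \<Longrightarrow> (\<And>z. z \<in> V \<Longrightarrow> F z = G z) \<Longrightarrow> fps_pderiv_at A F w = fps_pderiv_at A G w"
  unfolding fps_eq_iff by (auto intro!: pderiv_at_cong[of V])

lemma fps_pderiv_at_const [simp]: "fps_pderiv_at A (\<lambda>_. c) = (\<lambda>_. 0)"
  by (simp add: fun_eq_iff fps_eq_iff)

lemma fps_pderiv_at_fps_const: "fps_pderiv_at A (\<lambda>w. fps_const (f w)) w = fps_const (pderiv_at A f w)"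
  by (simp add: fps_eq_iff)

context
  fixes V :: "(real^'a) set" and w
  assumes V: "open V" "w \<in> V"
begin

lemma fps_pderiv_at_add:
  assumes "fps_smooth_on V F" "fps_smooth_on V G"
  shows "fps_pderiv_at A (\<lambda>w. F w + G w) w = fps_pderiv_at A F w + fps_pderiv_at A G w"
  using assms fps_smooth_on_differentiable[OF _ V] by (simp add: fps_eq_iff pderiv_at_add)

lemma fps_pderiv_at_sum:
  assumes "finite S" "\<And>s. s \<in> S \<Longrightarrow> fps_smooth_on V (F s)"
  shows "fps_pderiv_at A (\<lambda>w. \<Sum>s\<in>S. F s w) w = (\<Sum>s\<in>S. fps_pderiv_at A (F s) w)"
  using assms fps_smooth_on_differentiable[OF _ V] by (simp add: fps_eq_iff fps_sum_nth pderiv_at_sum)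

lemma fps_pderiv_at_mult:
  assumes "fps_smooth_on V F" "fps_smooth_on V G"
  shows "fps_pderiv_at A (\<lambda>w. F w * G w) w = fps_pderiv_at A F w * G w + F w * fps_pderiv_at A G w"
proof (rule fps_ext)
  fix n
  have d: "(\<lambda>w. fps_nth (F w) n) differentiable at w" "(\<lambda>w. fps_nth (G w) n) differentiable at w" for n
    using assms fps_smooth_on_differentiable[OF _ V] by auto
  have "pderiv_at A (\<lambda>w. \<Sum>k = 0..n. fps_nth (F w) k * fps_nth (G w) (n - k)) w
      = (\<Sum>k = 0..n. pderiv_at A (\<lambda>w. fps_nth (F w) k * fps_nth (G w) (n - k)) w)"
    using d by (intro pderiv_at_sum) auto
  also have "\<dots> = (\<Sum>k = 0..n. fps_nth (fps_pderiv_at A F w) k * fps_nth (G w) (n - k)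
      + fps_nth (F w) k * fps_nth (fps_pderiv_at A G w) (n - k))"
    using d by (simp add: pderiv_at_mult)
  finally show "fps_nth (fps_pderiv_at A (\<lambda>w. F w * G w) w) n
      = fps_nth (fps_pderiv_at A F w * G w + F w * fps_pderiv_at A G w) n"
    by (simp add: fps_mult_nth sum.distrib)
qed

lemma fps_pderiv_at_minus:
  assumes "fps_smooth_on V F"
  shows "fps_pderiv_at A (\<lambda>w. - F w) w = - fps_pderiv_at A F w"
  using fps_pderiv_at_mult[OF fps_smooth_on_const[of V "- 1"] assms] by simp

lemma fps_pderiv_at_diff:
  assumes "fps_smooth_on V F" "fps_smooth_on V G"
  shows "fps_pderiv_at A (\<lambda>w. F w - G w) w = fps_pderiv_at A F w - fps_pderiv_at A G w"
  using fps_pderiv_at_add[OF assms(1) fps_smooth_on_minus[OF assms(2) V(1)]] fps_pderiv_at_minus[OF assms(2)] by simp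

lemma fps_pderiv_at_commute:
  assumes "fps_smooth_on V F"
  shows "fps_pderiv_at A (fps_pderiv_at B F) w = fps_pderiv_at B (fps_pderiv_at A F) w"
  using pderiv_at_commute[OF fps_smooth_on_nth[OF assms] V] by (simp add: fps_eq_iff)

end

lemma fps_pderiv_at_chain:
  fixes \<Phi> :: "real^'a \<Rightarrow> real^'b"
  assumes "open V" "fps_smooth_on V F" "\<Phi> w \<in> V" "\<And>B. (\<lambda>w. \<Phi> w $ B) differentiable at w"
  shows "fps_pderiv_at A (\<lambda>w. F (\<Phi> w)) w
    = (\<Sum>*B. fps_pderiv_at B F (\<Phi> w) * fps_const (pderiv_at A (\<lambda>w. \<Phi> w $ B) w))"
  using pderiv_at_chain[OF fps_smooth_on_differentiable[OF assms(2,1,3)] assms(4)]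
  by (simp add: fps_eq_iff fps_sum_nth)

text \<open>The bracket defined by a bivector \<open>P\<close>. Its entries are power series because the two brackets on series
  of tensors shift the degree by different amounts.\<close>

definition poisson_bracket ::
  "(real^'a \<Rightarrow> 'a \<Rightarrow> 'a \<Rightarrow> real fps) \<Rightarrow> (real^'a \<Rightarrow> real fps) \<Rightarrow> (real^'a \<Rightarrow> real fps) \<Rightarrow> real^'a \<Rightarrow> real fps"
where
  "poisson_bracket P F G w = (\<Sum>*A B. P w A B * fps_pderiv_at A F w * fps_pderiv_at B G w)"

lemma fps_pderiv_at_poisson_bracket:
  assumes V: "open V" and P: "\<And>A B. fps_smooth_on V (\<lambda>w. P w A B)"
    and FG: "fps_smooth_on V F" "fps_smooth_on V G" and w: "w \<in> V"
  shows "fps_pderiv_at A (poisson_bracket P F G) w = (\<Sum>*C. \<Sum>D\<in>UNIV.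
      fps_pderiv_at A (\<lambda>w. P w C D) w * fps_pderiv_at C F w * fps_pderiv_at D G w
    + P w C D * fps_pderiv_at A (fps_pderiv_at C F) w * fps_pderiv_at D G w
    + P w C D * fps_pderiv_at C F w * fps_pderiv_at A (fps_pderiv_at D G) w)"
proof -
  note smooth = V P FG fps_smooth_on_fps_pderiv_at fps_smooth_on_mult fps_smooth_on_sum
  note D = fps_pderiv_at_sum[OF V w finite] fps_pderiv_at_mult[OF V w]
  have "fps_pderiv_at A (poisson_bracket P F G) w = (\<Sum>*C. \<Sum>D\<in>UNIV.
      fps_pderiv_at A (\<lambda>w. P w C D * fps_pderiv_at C F w * fps_pderiv_at D G w) w)"
    unfolding poisson_bracket_def [abs_def] by (subst D, intro smooth, subst D, intro smooth) (rule refl)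
  also have "\<dots> = (\<Sum>*C. \<Sum>D\<in>UNIV.
      (fps_pderiv_at A (\<lambda>w. P w C D) w * fps_pderiv_at C F w + P w C D * fps_pderiv_at A (fps_pderiv_at C F) w) * fps_pderiv_at D G w
    + P w C D * fps_pderiv_at C F w * fps_pderiv_at A (fps_pderiv_at D G) w)"
    by (simp add: D smooth)
  finally show ?thesis
    by (simp add: distrib_right)
qed

lemma sum_cycle:
  fixes t :: "'a::finite \<Rightarrow> 'a \<Rightarrow> 'a \<Rightarrow> 'b::comm_monoid_add"
  shows "(\<Sum>*A C D. t A C D) = (\<Sum>*A C D. t C D A)"
  by (subst sum.swap [of "\<lambda>A C. \<Sum>*D. t C D A"], subst (2) sum.swap) (rule refl)

text \<open>The terms with second derivatives of one argument cancel in pairs, because the bivector is antisymmetric and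
  second derivatives are symmetric; the remaining terms are the Schouten square of the bivector.\<close>

lemma jacobi_algebra:
  fixes P :: "'a::finite \<Rightarrow> 'a \<Rightarrow> 'b::comm_ring_1"
  assumes P: "\<And>A B. P A B = - P B A"
    and cyc: "\<And>A C D. (\<Sum>*B. P A B * dP B C D) + (\<Sum>*B. P C B * dP B D A) + (\<Sum>*B. P D B * dP B A C) = 0"
    and sym: "\<And>A B. ff A B = ff B A" "\<And>A B. gg A B = gg B A" "\<And>A B. hh A B = hh B A"
  defines "S \<equiv> \<lambda>f g h :: 'a \<Rightarrow> 'b. \<Sum>*A C D B. P A B * dP B C D * f A * g C * h D"
    and "T \<equiv> \<lambda>(f :: 'a \<Rightarrow> 'b) gg h. \<Sum>*A C D B. P A B * P C D * f A * gg B C * h D"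
    and "J \<equiv> \<lambda>f g gg h hh. \<Sum>*A B. P A B * f A *
        (\<Sum>*C D. dP B C D * g C * h D + P C D * gg B C * h D + P C D * g C * hh B D)"
  shows "J f g gg h hh + J g h hh f ff + J h f ff g gg = 0"
proof -
  have T': "(\<Sum>*A C D B. P A B * P C D * f A * g C * hh B D) = - T g hh f"
    if "\<And>A B. hh A B = hh B A" for f g :: "'a \<Rightarrow> 'b" and hh
  proof -
    let ?t = "\<lambda>A B C D. P A B * P C D * f A * g C * hh B D"
    have "(\<Sum>*A C D B. ?t A B C D) = (\<Sum>*C A D B. ?t A B C D)"
      by (rule sum.swap)
    also have "\<dots> = (\<Sum>*C D A B. ?t A B C D)"
      by (intro sum.cong refl sum.swap)
    also have "\<dots> = (\<Sum>*C D B A. ?t A B C D)"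
      by (intro sum.cong refl sum.swap)
    also have "\<dots> = (\<Sum>*C B D A. ?t A B C D)"
      by (intro sum.cong refl sum.swap)
    also have "\<dots> = (\<Sum>*C B A D. ?t A B C D)"
      by (intro sum.cong refl sum.swap)
    also have "\<dots> = (\<Sum>*C B A D. - (P C D * P B A * g C * hh D B * f A))"
      by (intro sum.cong refl) (subst P, subst that, simp add: ac_simps)
    finally show ?thesis
      by (simp add: T_def sum_negf)
  qed
  have J: "J f g gg h hh = S f g h + T f gg h - T g hh f" if "\<And>A B. hh A B = hh B A" for f g gg h hh
  proof -
    let ?t = "\<lambda>A B C D. P A B * dP B C D * f A * g C * h D + P A B * P C D * f A * gg B C * h D
      + P A B * P C D * f A * g C * hh B D"
    have "J f g gg h hh = (\<Sum>*A B C D. ?t A B C D)"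
      unfolding J_def sum_distrib_left by (simp add: distrib_left ac_simps)
    also have "\<dots> = (\<Sum>*A C B D. ?t A B C D)"
      by (intro sum.cong refl sum.swap)
    also have "\<dots> = (\<Sum>*A C D B. ?t A B C D)"
      by (intro sum.cong refl sum.swap)
    also have "\<dots> = S f g h + T f gg h
        + (\<Sum>*A C D B. P A B * P C D * f A * g C * hh B D)"
      by (simp only: sum.distrib S_def T_def)
    also have "\<dots> = S f g h + T f gg h - T g hh f"
      by (simp add: T'[OF that])
    finally show ?thesis .
  qed
  have "S f g h + S g h f + S h f g = 0"
  proof -
    have 1: "S f g h = (\<Sum>*A C D. (\<Sum>*B. P A B * dP B C D) * (f A * g C * h D))" for f g h
      by (simp only: S_def sum_distrib_right mult.assoc)
    have 2: "S g h f = (\<Sum>*A C D. (\<Sum>*B. P C B * dP B D A) * (f A * g C * h D))"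
      unfolding 1 by (subst sum_cycle) (simp add: ac_simps)
    have 3: "S h f g = (\<Sum>*A C D. (\<Sum>*B. P D B * dP B A C) * (f A * g C * h D))"
      unfolding 1 by (subst sum_cycle, subst sum_cycle) (simp add: ac_simps)
    have "S f g h + S g h f + S h f g = (\<Sum>*A C D. ((\<Sum>*B. P A B * dP B C D)
        + (\<Sum>*B. P C B * dP B D A) + (\<Sum>*B. P D B * dP B A C)) * (f A * g C * h D))"
      unfolding 1[of f g h] 2 3 distrib_right by (simp only: sum.distrib)
    then show ?thesis
      by (simp add: cyc)
  qed
  then show ?thesis
    unfolding J[OF sym(1)] J[OF sym(2)] J[OF sym(3)] by (simp add: algebra_simps)
qed

theorem poisson_bracket_jacobi:
  assumes V: "open V" and P: "\<And>A B. fps_smooth_on V (\<lambda>w. P w A B)"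
    and antisym: "\<And>A B. P w A B = - P w B A"
    and cyc: "\<And>A B C. (\<Sum>*D. P w A D * fps_pderiv_at D (\<lambda>w. P w B C) w)
      + (\<Sum>*D. P w B D * fps_pderiv_at D (\<lambda>w. P w C A) w)
      + (\<Sum>*D. P w C D * fps_pderiv_at D (\<lambda>w. P w A B) w) = 0"
    and F: "fps_smooth_on V F" and G: "fps_smooth_on V G" and H: "fps_smooth_on V H" and w: "w \<in> V"
  shows "poisson_bracket P F (poisson_bracket P G H) w + poisson_bracket P G (poisson_bracket P H F) w
    + poisson_bracket P H (poisson_bracket P F G) w = 0"
proof -
  have eq: "poisson_bracket P F (poisson_bracket P G H) w
    = (\<Sum>*A B. P w A B * fps_pderiv_at A F w * fps_pderiv_at B (poisson_bracket P G H) w)" for F G H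
    by (simp only: poisson_bracket_def[of P F "poisson_bracket P G H"])
  show ?thesis
    unfolding eq using fps_pderiv_at_poisson_bracket[OF V P G H w] fps_pderiv_at_poisson_bracket[OF V P H F w]
      fps_pderiv_at_poisson_bracket[OF V P F G w]
    by (simp only:) (rule jacobi_algebra[of "P w" "\<lambda>B C D. fps_pderiv_at B (\<lambda>w. P w C D) w"
      "\<lambda>A B. fps_pderiv_at A (fps_pderiv_at B F) w" "\<lambda>A B. fps_pderiv_at A (fps_pderiv_at B G) w"
      "\<lambda>A B. fps_pderiv_at A (fps_pderiv_at B H) w", OF antisym cyc
      fps_pderiv_at_commute[OF V w F] fps_pderiv_at_commute[OF V w G] fps_pderiv_at_commute[OF V w H]])
qed

text \<open>The assumption on \<open>P\<close> and \<open>P'\<close> says that the bivectors are related by \<open>\<Phi>\<close>.\<close>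

lemma poisson_bracket_pullback:
  fixes \<Phi> :: "real^'a \<Rightarrow> real^'b"
  assumes V: "open V" "\<Phi> w \<in> V" and \<Phi>: "\<And>B. (\<lambda>w. \<Phi> w $ B) differentiable at w"
    and FG: "fps_smooth_on V F" "fps_smooth_on V G"
    and P: "\<And>B C. P' (\<Phi> w) B C = (\<Sum>*A A'. P w A A' * fps_const (pderiv_at A (\<lambda>w. \<Phi> w $ B) w)
      * fps_const (pderiv_at A' (\<lambda>w. \<Phi> w $ C) w))"
  shows "poisson_bracket P (\<lambda>w. F (\<Phi> w)) (\<lambda>w. G (\<Phi> w)) w = poisson_bracket P' F G (\<Phi> w)"
proof -
  let ?J = "\<lambda>A B. fps_const (pderiv_at A (\<lambda>w. \<Phi> w $ B) w)"
  let ?f = "\<lambda>B. fps_pderiv_at B F (\<Phi> w)" and ?g = "\<lambda>B. fps_pderiv_at B G (\<Phi> w)"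
  let ?t = "\<lambda>A A' B C. P w A A' * ?J A B * ?J A' C * ?f B * ?g C"
  have "poisson_bracket P (\<lambda>w. F (\<Phi> w)) (\<lambda>w. G (\<Phi> w)) w
    = (\<Sum>*A A' B C. ?t A A' B C)"
    unfolding poisson_bracket_def fps_pderiv_at_chain[OF V(1) FG(1) V(2) \<Phi>] fps_pderiv_at_chain[OF V(1) FG(2) V(2) \<Phi>]
      mult.assoc sum_product unfolding sum_distrib_left
    by (simp add: ac_simps)
  also have "\<dots> = (\<Sum>*A B A' C. ?t A A' B C)"
    by (intro sum.cong refl sum.swap)
  also have "\<dots> = (\<Sum>*B A A' C. ?t A A' B C)"
    by (rule sum.swap)
  also have "\<dots> = (\<Sum>*B A C A'. ?t A A' B C)"
    by (intro sum.cong refl sum.swap)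
  also have "\<dots> = (\<Sum>*B C A A'. ?t A A' B C)"
    by (intro sum.cong refl sum.swap)
  also have "\<dots> = poisson_bracket P' F G (\<Phi> w)"
    unfolding poisson_bracket_def P sum_distrib_right by simp
  finally show ?thesis .
qed

section \<open>Symmetric tensors as polynomials\<close>

definition symmetric_components :: "('n list \<Rightarrow> real) \<Rightarrow> bool" where
  "symmetric_components t \<longleftrightarrow> (\<forall>is js. mset is = mset js \<longrightarrow> t is = t js)"

lemma symmetric_componentsD: "symmetric_components t \<Longrightarrow> mset is = mset js \<Longrightarrow> t is = t js"
  unfolding symmetric_components_def by blast

lemma symmetric_components_iff_permute_list:
  "symmetric_components t \<longleftrightarrow> (\<forall>is \<sigma>. \<sigma> permutes {..<length is} \<longrightarrow> t (permute_list \<sigma> is) = t is)"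
proof (intro iffI allI impI)
  show "t (permute_list \<sigma> is) = t is" if "symmetric_components t" "\<sigma> permutes {..<length is}" for \<sigma> "is"
    using that by (intro symmetric_componentsD[OF that(1)]) simp
  show "symmetric_components t" if "\<forall>is \<sigma>. \<sigma> permutes {..<length is} \<longrightarrow> t (permute_list \<sigma> is) = t is"
    unfolding symmetric_components_def
  proof (intro allI impI)
    fix "is" js :: "'a list" assume "mset is = mset js"
    then obtain \<sigma> where "\<sigma> permutes {..<length js}" "permute_list \<sigma> js = is"
      using mset_eq_permutation by blast
    with that show "t is = t js"
      by auto
  qed
qed

lemma symmetric_components_Cons: "symmetric_components t \<Longrightarrow> symmetric_components (\<lambda>is. t (i # is))"
  unfolding symmetric_components_def by simp

lemma symmetric_components_symmetrize: "symmetric_components (symmetrize t)"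
  unfolding symmetric_components_iff_permute_list
proof (intro allI impI)
  fix "is" :: "'a list" and \<sigma> assume \<sigma>: "\<sigma> permutes {..<length is}"
  have "(\<Sum>\<tau> | \<tau> permutes {..<length is}. t (permute_list \<tau> (permute_list \<sigma> is)))
      = (\<Sum>\<tau> | \<tau> permutes {..<length is}. t (permute_list (\<sigma> \<circ> \<tau>) is))"
    by (intro sum.cong refl) (simp add: permute_list_compose)
  also have "\<dots> = (\<Sum>\<tau> | \<tau> permutes {..<length is}. t (permute_list \<tau> is))"
    by (rule setum_permutations_compose_left [OF \<sigma>, symmetric])
  finally show "symmetrize t (permute_list \<sigma> is) = symmetrize t is"
    by (simp add: symmetrize_def)
qed

lemma symmetrize_eq_0: "(\<And>js. length js = length is \<Longrightarrow> t js = 0) \<Longrightarrow> symmetrize t is = 0"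
  by (simp add: symmetrize_def)

text \<open>The polynomial \<open>t\<^bsub>i\<^sub>1\<dots>i\<^sub>k\<^esub> v\<^bsup>i\<^sub>1\<^esup> \<cdots> v\<^bsup>i\<^sub>k\<^esup>\<close> of a tensor with components \<open>t\<close>; the recursion peels off the first
  index, so that proofs can be inductions on the degree.\<close>

primrec fibre_poly :: "nat \<Rightarrow> ('n list \<Rightarrow> real) \<Rightarrow> real^'n \<Rightarrow> real" where
  "fibre_poly 0 t v = t []"
| "fibre_poly (Suc k) t v = (\<Sum>*i. v $ i * fibre_poly k (\<lambda>is. t (i # is)) v)"

lemma fibre_poly_cong: "(\<And>is. length is = k \<Longrightarrow> t is = t' is) \<Longrightarrow> fibre_poly k t v = fibre_poly k t' v"
proof (induction k arbitrary: t t')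
  case (Suc k)
  have "fibre_poly k (\<lambda>is. t (i # is)) v = fibre_poly k (\<lambda>is. t' (i # is)) v" for i
    by (rule Suc.IH) (simp add: Suc.prems)
  then show ?case
    by simp
qed simp

lemma fibre_poly_add: "fibre_poly k (\<lambda>is. t is + t' is) v = fibre_poly k t v + fibre_poly k t' v"
  by (induction k arbitrary: t t') (simp_all add: distrib_left sum.distrib)

lemma fibre_poly_mult_left: "fibre_poly k (\<lambda>is. c * t is) v = c * fibre_poly k t v"
  by (induction k arbitrary: t) (simp_all add: sum_distrib_left mult.left_commute)

lemma fibre_poly_minus: "fibre_poly k (\<lambda>is. - t is) v = - fibre_poly k t v"
  using fibre_poly_mult_left[of k "- 1" t] by simp

lemma fibre_poly_diff: "fibre_poly k (\<lambda>is. t is - t' is) v = fibre_poly k t v - fibre_poly k t' v"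
  using fibre_poly_add[of k t "\<lambda>is. - t' is"] by (simp add: fibre_poly_minus)

lemma fibre_poly_0 [simp]: "fibre_poly k (\<lambda>_. 0) v = 0"
  by (induction k) simp_all

lemma fibre_poly_sum: "fibre_poly k (\<lambda>is. \<Sum>s\<in>S. t s is) v = (\<Sum>s\<in>S. fibre_poly k (t s) v)"
  by (induction S rule: infinite_finite_induct) (simp_all add: fibre_poly_add)

lemma fibre_poly_append:
  "fibre_poly (a + b) (\<lambda>is. f (take a is) * g (drop a is)) v = fibre_poly a f v * fibre_poly b g v"
proof (induction a arbitrary: f)
  case (Suc a)
  show ?case
    using Suc.IH[of "\<lambda>is. f (_ # is)"] by (simp add: sum_distrib_right mult.assoc)
qed (simp add: fibre_poly_mult_left)

lemma sum_lists_length_Suc: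
  fixes f :: "'n::finite list \<Rightarrow> 'b::comm_monoid_add"
  shows "(\<Sum>is | length is = Suc k. f is) = (\<Sum>*i. \<Sum>is | length is = k. f (i # is))"
proof -
  have "(\<Sum>is | length is = Suc k. f is) = (\<Sum>(i, is)\<in>UNIV \<times> {is. length is = k}. f (i # is))"
    by (rule sum.reindex_bij_witness[of _ "\<lambda>(i, is). i # is" "\<lambda>is. (hd is, tl is)"])
      (auto simp: length_Suc_conv)
  then show ?thesis
    by (simp add: sum.cartesian_product)
qed

lemma fibre_poly_eq_sum_monomials:
  "fibre_poly k t v = (\<Sum>is | length is = k. t is * (\<Prod>i\<leftarrow>is. v $ i))"
  by (induction k arbitrary: t)
    (simp_all add: sum_lists_length_Suc sum_distrib_left ac_simps)

lemma sum_permute_list: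
  fixes f :: "'n::finite list \<Rightarrow> 'b::comm_monoid_add"
  assumes "\<sigma> permutes {..<k}"
  shows "(\<Sum>is | length is = k. f (permute_list \<sigma> is)) = (\<Sum>is | length is = k. f is)"
proof (rule sum.reindex_bij_witness[of _ "permute_list (inv \<sigma>)" "permute_list \<sigma>"])
  fix "is" assume "is \<in> {is :: 'n list. length is = k}"
  then have k: "\<sigma> permutes {..<length is}" "inv \<sigma> permutes {..<length is}"
    using assms by (auto simp: permutes_inv)
  show "permute_list (inv \<sigma>) (permute_list \<sigma> is) = is"
    using permute_list_compose[OF k(2), of \<sigma>] permutes_inv_o(1)[OF k(1)] by simp
  show "permute_list \<sigma> (permute_list (inv \<sigma>) is) = is"
    using permute_list_compose[OF k(1), of "inv \<sigma>"] permutes_inv_o(2)[OF k(1)] by simp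
qed auto

text \<open>A monomial in commuting variables does not see the order of its indices.\<close>

lemma fibre_poly_symmetrize: "fibre_poly k (symmetrize t) v = fibre_poly k t v"
proof -
  have mon: "(\<Prod>i\<leftarrow>permute_list \<sigma> is. v $ i) = (\<Prod>i\<leftarrow>is. v $ i)" if "\<sigma> permutes {..<length is}" for \<sigma> "is"
    using that by (metis mset_map mset_permute_list prod_mset_prod_list)
  have reindex: "(\<Sum>is | length is = k. t (permute_list \<sigma> is) * (\<Prod>i\<leftarrow>is. v $ i)) = fibre_poly k t v"
    if \<sigma>: "\<sigma> permutes {..<k}" for \<sigma>
  proof -
    have "(\<Sum>is | length is = k. t (permute_list \<sigma> is) * (\<Prod>i\<leftarrow>is. v $ i))
        = (\<Sum>is | length is = k. t (permute_list \<sigma> is) * (\<Prod>i\<leftarrow>permute_list \<sigma> is. v $ i))"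
      using mon \<sigma> by (intro sum.cong refl) auto
    also have "\<dots> = fibre_poly k t v"
      unfolding fibre_poly_eq_sum_monomials by (rule sum_permute_list[OF \<sigma>])
    finally show ?thesis .
  qed
  have "fibre_poly k (symmetrize t) v
      = (\<Sum>is | length is = k. (\<Sum>\<sigma> | \<sigma> permutes {..<k}. t (permute_list \<sigma> is) * (\<Prod>i\<leftarrow>is. v $ i)) / fact k)"
    unfolding fibre_poly_eq_sum_monomials by (intro sum.cong refl) (simp add: symmetrize_def sum_distrib_right)
  also have "\<dots> = (\<Sum>\<sigma> | \<sigma> permutes {..<k}. fibre_poly k t v) / fact k"
    unfolding sum_divide_distrib[symmetric] by (subst sum.swap) (simp add: reindex)
  also have "\<dots> = fibre_poly k t v"
    by (simp add: card_permutations)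
  finally show ?thesis .
qed

lemma fibre_poly_change_of_variables:
  fixes J :: "'n::finite \<Rightarrow> 'n \<Rightarrow> real"
  shows "fibre_poly k (\<lambda>js. \<Sum>is | length is = k. t is * (\<Prod>m<k. J (is ! m) (js ! m))) v
    = fibre_poly k t (\<chi> a. \<Sum>*i. J a i * v $ i)"
proof (induction k arbitrary: t)
  case (Suc k)
  have "fibre_poly k (\<lambda>js. \<Sum>is | length is = Suc k. t is * (\<Prod>m<Suc k. J (is ! m) ((j # js) ! m))) v
      = (\<Sum>*i. J i j * fibre_poly k (\<lambda>is. t (i # is)) (\<chi> a. \<Sum>*i. J a i * v $ i))" for j
  proof -
    have "fibre_poly k (\<lambda>js. \<Sum>is | length is = Suc k. t is * (\<Prod>m<Suc k. J (is ! m) ((j # js) ! m))) v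
      = fibre_poly k (\<lambda>js. \<Sum>*i. J i j * (\<Sum>is | length is = k. t (i # is) * (\<Prod>m<k. J (is ! m) (js ! m)))) v"
      by (simp add: sum_lists_length_Suc prod.lessThan_Suc_shift sum_distrib_left mult.left_commute del: prod.lessThan_Suc)
    also have "\<dots> = (\<Sum>*i. J i j * fibre_poly k (\<lambda>js. \<Sum>is | length is = k. t (i # is) * (\<Prod>m<k. J (is ! m) (js ! m))) v)"
      by (subst fibre_poly_sum) (simp only: fibre_poly_mult_left)
    finally show ?thesis
      by (simp only: Suc)
  qed
  then have "fibre_poly (Suc k) (\<lambda>js. \<Sum>is | length is = Suc k. t is * (\<Prod>m<Suc k. J (is ! m) (js ! m))) v
      = (\<Sum>*j i. J i j * v $ j * fibre_poly k (\<lambda>is. t (i # is)) (\<chi> a. \<Sum>*i. J a i * v $ i))"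
    by (simp add: sum_distrib_left mult.assoc mult.left_commute del: prod.lessThan_Suc)
  also have "\<dots> = (\<Sum>*i j. J i j * v $ j * fibre_poly k (\<lambda>is. t (i # is)) (\<chi> a. \<Sum>*i. J a i * v $ i))"
    by (rule sum.swap)
  finally show ?case
    by (simp add: sum_distrib_right)
qed simp

text \<open>For symmetric \<open>t\<close>, this is the derivative of \<open>fibre_poly k t\<close> in the direction \<open>p\<close>, see
  \<open>pderiv_at_fibre_poly\<close>. The factor \<open>k\<close> makes it vanish in degree zero, where \<open>k - 1\<close> is truncated.\<close>

definition fibre_deriv :: "'n::finite \<Rightarrow> nat \<Rightarrow> ('n list \<Rightarrow> real) \<Rightarrow> real^'n \<Rightarrow> real" where
  "fibre_deriv p k t v = real k * fibre_poly (k - 1) (\<lambda>is. t (p # is)) v"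

text \<open>Euler's relation for the homogeneous polynomial of \<open>t\<close> with one index fixed to \<open>p\<close>.\<close>

lemma fibre_deriv_Cons:
  assumes "symmetric_components t"
  shows "(\<Sum>*i. v $ i * fibre_deriv p k (\<lambda>is. t (i # is)) v) = real k * fibre_poly k (\<lambda>is. t (p # is)) v"
proof (cases k)
  case (Suc l)
  have "t (i # p # is) = t (p # i # is)" for i "is"
    by (rule symmetric_componentsD[OF assms]) simp
  then show ?thesis
    by (simp add: Suc fibre_deriv_def sum_distrib_left mult.left_commute)
qed (simp add: fibre_deriv_def)

lemma fibre_poly_differentiable:
  fixes T :: "'n::finite list \<Rightarrow> real^'a \<Rightarrow> real" and v :: "real^'a \<Rightarrow> real^'n"
  assumes "\<And>is. T is differentiable at w" "\<And>p. (\<lambda>w. v w $ p) differentiable at w"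
  shows "(\<lambda>w. fibre_poly k (\<lambda>is. T is w) (v w)) differentiable at w"
  using assms(1)
proof (induction k arbitrary: T)
  case (Suc k)
  show ?case
    using assms(2) Suc.IH[OF Suc.prems] by (auto intro!: differentiable_sum differentiable_mult)
qed auto

lemma fibre_poly_smooth_on:
  fixes T :: "'n::finite list \<Rightarrow> real^'a \<Rightarrow> real" and v :: "real^'a \<Rightarrow> real^'n"
  assumes "\<And>is. smooth_on W (T is)" "\<And>p. smooth_on W (\<lambda>w. v w $ p)" "open W"
  shows "smooth_on W (\<lambda>w. fibre_poly k (\<lambda>is. T is w) (v w))"
  using assms(1)
proof (induction k arbitrary: T)
  case (Suc k)
  show ?case
    using assms(2,3) Suc.IH[OF Suc.prems] by (auto intro!: smooth_on_sum smooth_on_mult)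
qed auto

text \<open>The product rule: either the components or one of the \<open>k\<close> factors \<open>v\<close> is differentiated, and by symmetry it
  does not matter which of the factors.\<close>

lemma pderiv_at_fibre_poly:
  fixes T :: "'n::finite list \<Rightarrow> real^'a \<Rightarrow> real" and v :: "real^'a \<Rightarrow> real^'n"
  assumes "\<And>is. T is differentiable at w" and v: "\<And>p. (\<lambda>w. v w $ p) differentiable at w"
    and "symmetric_components (\<lambda>is. T is w)"
  shows "pderiv_at A (\<lambda>w. fibre_poly k (\<lambda>is. T is w) (v w)) w
    = fibre_poly k (\<lambda>is. pderiv_at A (T is) w) (v w)
      + (\<Sum>*p. pderiv_at A (\<lambda>w. v w $ p) w * fibre_deriv p k (\<lambda>is. T is w) (v w))"
  using assms(1,3)
proof (induction k arbitrary: T)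
  case 0
  then show ?case
    by (simp add: fibre_deriv_def)
next
  case (Suc k)
  let ?F = "\<lambda>i w. fibre_poly k (\<lambda>is. T (i # is) w) (v w)" and ?v' = "\<lambda>p. pderiv_at A (\<lambda>w. v w $ p) w"
  have d: "?F i differentiable at w" for i
    using Suc.prems(1) v by (intro fibre_poly_differentiable)
  have IH: "pderiv_at A (?F i) w = fibre_poly k (\<lambda>is. pderiv_at A (T (i # is)) w) (v w)
      + (\<Sum>*p. ?v' p * fibre_deriv p k (\<lambda>is. T (i # is) w) (v w))" for i
    using Suc.prems by (intro Suc.IH symmetric_components_Cons)
  have "pderiv_at A (\<lambda>w. fibre_poly (Suc k) (\<lambda>is. T is w) (v w)) w
      = (\<Sum>*i. ?v' i * ?F i w + v w $ i * pderiv_at A (?F i) w)"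
    using v d by (simp add: pderiv_at_sum pderiv_at_mult)
  also have "\<dots> = (\<Sum>*i. ?v' i * ?F i w) + fibre_poly (Suc k) (\<lambda>is. pderiv_at A (T is) w) (v w)
      + (\<Sum>*i. v w $ i * (\<Sum>*p. ?v' p * fibre_deriv p k (\<lambda>is. T (i # is) w) (v w)))"
    by (simp add: IH distrib_left sum.distrib)
  also have "(\<Sum>*i. v w $ i * (\<Sum>*p. ?v' p * fibre_deriv p k (\<lambda>is. T (i # is) w) (v w)))
      = (\<Sum>*p. ?v' p * (\<Sum>*i. v w $ i * fibre_deriv p k (\<lambda>is. T (i # is) w) (v w)))"
    unfolding sum_distrib_left by (subst sum.swap) (simp add: mult.left_commute)
  also have "\<dots> = (\<Sum>*p. ?v' p * (real k * ?F p w))"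
    using fibre_deriv_Cons[OF Suc.prems(2)] by simp
  finally show ?case
    by (simp add: fibre_deriv_def algebra_simps sum.distrib)
qed

lemma fibre_poly_eq_0_imp:
  assumes "symmetric_components t" "\<And>v. fibre_poly k t v = 0" "length is = k"
  shows "t is = 0"
  using assms
proof (induction k arbitrary: t "is")
  case (Suc k)
  obtain p js where p: "is = p # js" "length js = k"
    using Suc.prems(3) by (auto simp: length_Suc_conv)
  have "fibre_poly k (\<lambda>is. t (p # is)) v = 0" for v
  proof -
    have "0 = pderiv_at p (\<lambda>v. fibre_poly (Suc k) t v) v"
      by (simp only: Suc.prems(2) pderiv_at_const)
    also have "\<dots> = (\<Sum>*q. (if p = q then 1 else 0) * fibre_deriv q (Suc k) t v)"
      using pderiv_at_fibre_poly[of "\<lambda>is _. t is" v "\<lambda>v. v" p "Suc k", OF _ differentiable_vec_nth] Suc.prems(1)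
      by (simp add: pderiv_at_coordinate del: fibre_poly.simps)
    also have "\<dots> = fibre_deriv p (Suc k) t v"
      by (simp add: if_distrib[of "\<lambda>x. x * _"] cong: if_cong)
    finally show ?thesis
      by (simp add: fibre_deriv_def)
  qed
  then show ?case
    using Suc.IH[OF symmetric_components_Cons[OF Suc.prems(1)]] p by simp
qed simp

text \<open>A symmetric tensor is determined by its polynomial function, because its components are the
  iterated derivatives of that function.\<close>

lemma fibre_poly_inject:
  assumes "symmetric_components t" "symmetric_components t'" "\<And>v. fibre_poly k t v = fibre_poly k t' v" "length is = k"
  shows "t is = t' is"
proof -
  have "symmetric_components (\<lambda>is. t is - t' is)"
    using assms(1,2) unfolding symmetric_components_def by metis
  from fibre_poly_eq_0_imp[OF this _ assms(4)] show ?thesis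
    by (simp add: fibre_poly_diff assms(3))
qed

text \<open>With \<open>g\<close> a matrix of Christoffel symbols, the left-hand side is the correction term of a covariant derivative. On
  polynomials it is the action of the linear vector field \<open>g\<^sub>j\<^sup>r v\<^sup>j \<partial>/\<partial>v\<^sup>r\<close>.\<close>

lemma fibre_poly_replace_index:
  fixes t :: "'n::finite list \<Rightarrow> real"
  assumes "symmetric_components t"
  shows "fibre_poly k (\<lambda>is. \<Sum>m<length is. \<Sum>*r. g (is ! m) r * t (is[m := r])) v
    = (\<Sum>*j r. g j r * v $ j * fibre_deriv r k t v)"
  using assms
proof (induction k arbitrary: t)
  case 0
  then show ?case
    by (simp add: fibre_deriv_def)
next
  case (Suc k)
  let ?F = "\<lambda>r. fibre_poly k (\<lambda>is. t (r # is)) v"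
  have IH: "fibre_poly k (\<lambda>is. \<Sum>m<length is. \<Sum>*r. g (is ! m) r * t (i # is[m := r])) v
    = (\<Sum>*j r. g j r * v $ j * fibre_deriv r k (\<lambda>is. t (i # is)) v)" for i
    using Suc.IH[OF symmetric_components_Cons[OF Suc.prems]] .
  have "fibre_poly (Suc k) (\<lambda>is. \<Sum>m<length is. \<Sum>*r. g (is ! m) r * t (is[m := r])) v
    = (\<Sum>*i. v $ i * (\<Sum>*r. g i r * ?F r))
      + (\<Sum>*i. v $ i * (\<Sum>*j r. g j r * v $ j * fibre_deriv r k (\<lambda>is. t (i # is)) v))"
    by (simp add: sum.lessThan_Suc_shift fibre_poly_add fibre_poly_sum fibre_poly_mult_left IH distrib_left sum.distrib
      del: sum.lessThan_Suc)
  also have "(\<Sum>*i. v $ i * (\<Sum>*j r. g j r * v $ j * fibre_deriv r k (\<lambda>is. t (i # is)) v))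
    = (\<Sum>*j r i. g j r * v $ j * (v $ i * fibre_deriv r k (\<lambda>is. t (i # is)) v))"
    (is "?L = ?R")
  proof -
    have "?L = (\<Sum>*i j r. g j r * v $ j * (v $ i * fibre_deriv r k (\<lambda>is. t (i # is)) v))"
      by (simp add: sum_distrib_left ac_simps)
    also have "\<dots> = (\<Sum>*j i r. g j r * v $ j * (v $ i * fibre_deriv r k (\<lambda>is. t (i # is)) v))"
      by (rule sum.swap)
    also have "\<dots> = ?R"
      by (intro sum.cong refl sum.swap)
    finally show ?thesis .
  qed
  also have "\<dots> = (\<Sum>*j r. g j r * v $ j * (real k * ?F r))"
    by (simp only: fibre_deriv_Cons[OF Suc.prems] flip: sum_distrib_left)
  finally show ?case
    by (simp add: fibre_deriv_def sum_distrib_left algebra_simps flip: sum.distrib)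
qed

section \<open>Phase space\<close>

text \<open>Points of phase space, the tangent bundle in a chart, are vectors indexed by a sum type, so that the partial derivatives
  in the base and fibre directions are instances of the same notion.\<close>

definition base :: "real^('n + 'n) \<Rightarrow> real^'n" where
  "base w = (\<chi> i. w $ Inl i)"

definition fibre :: "real^('n + 'n) \<Rightarrow> real^'n" where
  "fibre w = (\<chi> i. w $ Inr i)"

lemma ex_base_fibre: "\<exists>w. base w = y \<and> fibre w = v"
  by (rule exI[of _ "\<chi> A. case A of Inl i \<Rightarrow> y $ i | Inr i \<Rightarrow> v $ i"]) (simp add: base_def fibre_def)

lemma sum_antisymmetric:
  fixes u t :: "'a::finite \<Rightarrow> 'a \<Rightarrow> 'b::comm_ring"
  assumes "\<And>p q. u p q = - u q p"
  shows "(\<Sum>*p q. u p q * t q p) = - (\<Sum>*p q. u p q * t p q)"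
proof -
  have "(\<Sum>*p q. u p q * t q p) = (\<Sum>*q p. u p q * t q p)"
    by (rule sum.swap)
  also have "\<dots> = (\<Sum>*q p. - (u q p * t q p))"
    by (intro sum.cong refl) (subst assms, simp)
  finally show ?thesis
    by (simp add: sum_negf)
qed

lemma sum_UNIV_sum_type:
  fixes f :: "'a::finite + 'b::finite \<Rightarrow> 'c::comm_monoid_add"
  shows "(\<Sum>*A. f A) = (\<Sum>*i. f (Inl i)) + (\<Sum>*i. f (Inr i))"
  using sum.Plus[of UNIV UNIV f] by (simp add: comp_def)

lemma open_base_vimage:
  fixes V :: "(real^'n) set"
  assumes "open V"
  shows "open (base -` V)"
proof -
  have "continuous_on UNIV (base :: real^('n + 'n) \<Rightarrow> real^'n)"
    unfolding base_def [abs_def] by (intro continuous_intros)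
  with assms show ?thesis
    by (simp add: continuous_on_open_vimage)
qed

lemma pderiv_at_base:
  fixes f :: "real^'n \<Rightarrow> real"
  assumes "f differentiable at (base w)"
  shows "pderiv_at (Inl i) (\<lambda>w. f (base w)) w = pderiv_at i f (base w)"
    and "pderiv_at (Inr i) (\<lambda>w. f (base w)) w = 0"
proof -
  have d: "(\<lambda>w :: real^('n + 'n). base w $ b) differentiable at w" for b
    by (simp add: base_def differentiable_vec_nth)
  show "pderiv_at (Inl i) (\<lambda>w. f (base w)) w = pderiv_at i f (base w)"
    using pderiv_at_chain[of f base, OF assms d, of "Inl i"]
    by (simp add: base_def pderiv_at_coordinate if_distrib[of "\<lambda>x. _ * x"] cong: if_cong)
  show "pderiv_at (Inr i) (\<lambda>w. f (base w)) w = 0"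
    using pderiv_at_chain[of f base, OF assms d, of "Inr i"]
    by (simp add: base_def pderiv_at_coordinate)
qed

lemma smooth_on_base:
  fixes V :: "(real^'n) set"
  assumes f: "smooth_on V f" and V: "open V"
  shows "smooth_on (base -` V) (\<lambda>w. f (base w))"
proof (rule smooth_on_coinduct[where P = "\<lambda>h. \<exists>f. smooth_on V f \<and> h = (\<lambda>w. f (base w))"])
  fix h :: "real^('n + 'n) \<Rightarrow> real"
  assume "\<exists>f. smooth_on V f \<and> h = (\<lambda>w. f (base w))"
  then obtain f where f: "smooth_on V f" and h: "h = (\<lambda>w. f (base w))"
    by blast
  have d: "f differentiable at (base w)" if "w \<in> base -` V" for w
    using smooth_on_differentiable[OF f V] that by simp
  have "(\<lambda>w. f (base w)) differentiable at w" if "w \<in> base -` V" for w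
  proof -
    have "(base has_derivative base) (at w)" for w :: "real^('n + 'n)"
    proof (rule bounded_linear_imp_has_derivative)
      show "bounded_linear (base :: real^('n + 'n) \<Rightarrow> real^'n)"
        unfolding linear_conv_bounded_linear[symmetric] by (rule linearI) (simp_all add: base_def vec_eq_iff)
    qed
    then show ?thesis
      using d[OF that] unfolding differentiable_def by (blast intro: has_derivative_compose)
  qed
  then show "h differentiable at w" if "w \<in> base -` V" for w
    using that by (simp add: h)
  fix A
  show "\<exists>g. (\<exists>f. smooth_on V f \<and> g = (\<lambda>w. f (base w))) \<and> (\<forall>w\<in>base -` V. pderiv_at A h w = g w)"
  proof (cases A)
    case (Inl i)
    then show ?thesis
      using pderiv_at_base(1)[OF d] smooth_on_pderiv_at[OF f]
      by (intro exI[of _ "\<lambda>w. pderiv_at i f (base w)"]) (auto simp: h)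
  next
    case (Inr i)
    then show ?thesis
      using pderiv_at_base(2)[OF d] smooth_on_const[of V 0]
      by (intro exI[of _ "\<lambda>w. 0"] conjI exI[of _ "\<lambda>y. 0"]) (auto simp: h)
  qed
qed (use assms open_base_vimage in auto)

lemma pderiv_at_fibre:
  "pderiv_at (Inl i) (\<lambda>w. fibre w $ j) w = 0" "pderiv_at (Inr i) (\<lambda>w. fibre w $ j) w = (if i = j then 1 else 0)"
  by (simp_all add: fibre_def pderiv_at_coordinate)

lemma smooth_on_fibre: "open W \<Longrightarrow> smooth_on W (\<lambda>w. fibre w $ j)"
  by (simp add: fibre_def smooth_on_coordinate)

section \<open>The Poisson bivector on phase space\<close>

text \<open>The vertical and the complete lift of a bivector from a manifold to its tangent bundle. In the complete lift, the
  component in two fibre directions is the derivative of \<open>U\<close> along the tangent vector.\<close>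

fun vertical_lift :: "(real^'n \<Rightarrow> 'n \<Rightarrow> 'n \<Rightarrow> real) \<Rightarrow> real^('n + 'n) \<Rightarrow> 'n + 'n \<Rightarrow> 'n + 'n \<Rightarrow> real" where
  "vertical_lift U w (Inr p) (Inr q) = U (base w) p q"
| "vertical_lift U w _ _ = 0"

fun complete_lift :: "(real^'n \<Rightarrow> 'n \<Rightarrow> 'n \<Rightarrow> real) \<Rightarrow> real^('n + 'n) \<Rightarrow> 'n + 'n \<Rightarrow> 'n + 'n \<Rightarrow> real" where
  "complete_lift U w (Inl p) (Inl q) = 0"
| "complete_lift U w (Inl p) (Inr q) = U (base w) p q"
| "complete_lift U w (Inr p) (Inl q) = U (base w) p q"
| "complete_lift U w (Inr p) (Inr q) = (\<Sum>*j. fibre w $ j * pderiv_at j (\<lambda>y. U y p q) (base w))"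

definition lifted_bivector :: "(real^'n \<Rightarrow> 'n \<Rightarrow> 'n \<Rightarrow> real) \<Rightarrow> real^('n + 'n) \<Rightarrow> 'n + 'n \<Rightarrow> 'n + 'n \<Rightarrow> real fps" where
  "lifted_bivector U w A B = fps_const (vertical_lift U w A B) - fps_X * fps_const (complete_lift U w A B)"

lemma fps_const_sum: "(\<Sum>s\<in>S. fps_const (f s)) = fps_const (\<Sum>s\<in>S. f s)" for f :: "'s \<Rightarrow> real"
  by (induction S rule: infinite_finite_induct) simp_all

text \<open>The components of a Poisson tensor in a coordinate domain; \<open>jacobi_U\<close> is the Jacobi identity of its
  bracket.\<close>

locale poisson_coordinates =
  fixes V :: "(real^'n) set" and U :: "real^'n \<Rightarrow> 'n \<Rightarrow> 'n \<Rightarrow> real"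
  assumes open_V: "open V"
    and smooth_U: "\<And>p q. smooth_on V (\<lambda>y. U y p q)"
    and antisym_U: "\<And>y p q. y \<in> V \<Longrightarrow> U y p q = - U y q p"
    and jacobi_U: "\<And>y p q r. y \<in> V \<Longrightarrow> (\<Sum>*s. U y p s * pderiv_at s (\<lambda>y. U y q r) y)
      + (\<Sum>*s. U y q s * pderiv_at s (\<lambda>y. U y r p) y) + (\<Sum>*s. U y r s * pderiv_at s (\<lambda>y. U y p q) y) = 0"
begin

lemma open_phase: "open (base -` V)"
  by (rule open_base_vimage[OF open_V])

lemma smooth_lifts:
  "smooth_on (base -` V) (\<lambda>w. vertical_lift U w A B)"
  "smooth_on (base -` V) (\<lambda>w. complete_lift U w A B)"
proof -
  note b = smooth_on_base[OF smooth_U open_V] smooth_on_base[OF smooth_on_pderiv_at[OF smooth_U] open_V]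
  show "smooth_on (base -` V) (\<lambda>w. vertical_lift U w A B)"
    using b smooth_on_const by (cases A; cases B) auto
  show "smooth_on (base -` V) (\<lambda>w. complete_lift U w A B)"
    using b smooth_on_const open_phase by (cases A; cases B) (auto intro!: smooth_on_sum smooth_on_mult smooth_on_fibre)
qed

lemma smooth_lifted_bivector: "fps_smooth_on (base -` V) (\<lambda>w. lifted_bivector U w A B)"
  unfolding lifted_bivector_def using smooth_lifts open_phase
  by (intro fps_smooth_on_diff fps_smooth_on_mult fps_smooth_on_const fps_smooth_on_fps_const)

lemma antisym_pderiv_U: "y \<in> V \<Longrightarrow> pderiv_at s (\<lambda>y. U y p q) y = - pderiv_at s (\<lambda>y. U y q p) y"
proof -
  assume y: "y \<in> V"
  have "pderiv_at s (\<lambda>y. U y p q) y = pderiv_at s (\<lambda>y. - 1 * U y q p) y"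
  proof (rule pderiv_at_cong[OF open_V y])
    show "U z p q = - 1 * U z q p" if "z \<in> V" for z
      using antisym_U[OF that, of p q] by simp
  qed
  also have "\<dots> = - pderiv_at s (\<lambda>y. U y q p) y"
    using smooth_on_differentiable[OF smooth_U open_V y] by (subst pderiv_at_mult) auto
  finally show ?thesis .
qed

lemma antisym_lifted_bivector:
  assumes "w \<in> base -` V"
  shows "lifted_bivector U w A B = - lifted_bivector U w B A"
proof -
  have y: "base w \<in> V"
    using assms by simp
  have u: "U (base w) p q + U (base w) q p = 0" "v * pderiv_at s (\<lambda>y. U y p q) (base w) + v * pderiv_at s (\<lambda>y. U y q p) (base w) = 0" for p q s v
    using antisym_U[OF y, of p q] antisym_pderiv_U[OF y, of s p q] by simp_all
  have "vertical_lift U w A B = - vertical_lift U w B A"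
    by (cases A; cases B) (auto simp: eq_neg_iff_add_eq_0 u)
  moreover have "complete_lift U w A B = - complete_lift U w B A"
    by (cases A; cases B) (auto simp: eq_neg_iff_add_eq_0 u simp flip: sum.distrib)
  ultimately show ?thesis
    by (simp add: lifted_bivector_def flip: fps_const_neg)
qed

lemma pderiv_at_lifts:
  assumes "w \<in> base -` V"
  shows "pderiv_at (Inl s) (\<lambda>w. vertical_lift U w (Inr p) (Inr q)) w = pderiv_at s (\<lambda>y. U y p q) (base w)"
    "pderiv_at (Inr s) (\<lambda>w. vertical_lift U w (Inr p) (Inr q)) w = 0"
    "pderiv_at (Inl s) (\<lambda>w. complete_lift U w (Inr p) (Inl q)) w = pderiv_at s (\<lambda>y. U y p q) (base w)"
    "pderiv_at (Inr s) (\<lambda>w. complete_lift U w (Inr p) (Inl q)) w = 0"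
    "pderiv_at (Inl s) (\<lambda>w. complete_lift U w (Inl p) (Inr q)) w = pderiv_at s (\<lambda>y. U y p q) (base w)"
    "pderiv_at (Inr s) (\<lambda>w. complete_lift U w (Inl p) (Inr q)) w = 0"
    "pderiv_at (Inl s) (\<lambda>w. complete_lift U w (Inr p) (Inr q)) w
      = (\<Sum>*j. fibre w $ j * pderiv_at j (pderiv_at s (\<lambda>y. U y p q)) (base w))"
    "pderiv_at (Inr s) (\<lambda>w. complete_lift U w (Inr p) (Inr q)) w = pderiv_at s (\<lambda>y. U y p q) (base w)"
proof -
  have y: "base w \<in> V"
    using assms by simp
  note sm = smooth_U smooth_on_pderiv_at[OF smooth_U]
  have d: "(\<lambda>y. U y p q) differentiable at (base w)" "pderiv_at j (\<lambda>y. U y p q) differentiable at (base w)" for j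
    using sm smooth_on_differentiable[OF _ open_V y] by auto
  have d': "(\<lambda>w. pderiv_at j (\<lambda>y. U y p q) (base w)) differentiable at w" "(\<lambda>w. fibre w $ j) differentiable at w" for j
    using smooth_on_differentiable[OF smooth_on_base[OF sm(2) open_V] open_phase assms]
      smooth_on_differentiable[OF smooth_on_fibre[OF open_phase] open_phase assms] by auto
  show "pderiv_at (Inl s) (\<lambda>w. complete_lift U w (Inr p) (Inr q)) w
      = (\<Sum>*j. fibre w $ j * pderiv_at j (pderiv_at s (\<lambda>y. U y p q)) (base w))"
    "pderiv_at (Inr s) (\<lambda>w. complete_lift U w (Inr p) (Inr q)) w = pderiv_at s (\<lambda>y. U y p q) (base w)"
    using d d' pderiv_at_commute[OF smooth_U open_V y]
    by (simp_all add: pderiv_at_sum pderiv_at_mult pderiv_at_fibre pderiv_at_base if_distrib[of "\<lambda>x. x * _"] cong: if_cong)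
  show "pderiv_at (Inl s) (\<lambda>w. vertical_lift U w (Inr p) (Inr q)) w = pderiv_at s (\<lambda>y. U y p q) (base w)"
    "pderiv_at (Inr s) (\<lambda>w. vertical_lift U w (Inr p) (Inr q)) w = 0"
    "pderiv_at (Inl s) (\<lambda>w. complete_lift U w (Inr p) (Inl q)) w = pderiv_at s (\<lambda>y. U y p q) (base w)"
    "pderiv_at (Inr s) (\<lambda>w. complete_lift U w (Inr p) (Inl q)) w = 0"
    "pderiv_at (Inl s) (\<lambda>w. complete_lift U w (Inl p) (Inr q)) w = pderiv_at s (\<lambda>y. U y p q) (base w)"
    "pderiv_at (Inr s) (\<lambda>w. complete_lift U w (Inl p) (Inr q)) w = 0"
    by (simp_all add: pderiv_at_base[where f = "\<lambda>y. U y p q", OF d(1)])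
qed

text \<open>The complete lift contains derivatives of \<open>U\<close> along the tangent vector, so its own Jacobi identity also needs
  the differentiated one of \<open>U\<close>.\<close>

lemma jacobi_U_deriv:
  assumes y: "y \<in> V"
  shows "(\<Sum>*s. pderiv_at j (\<lambda>y. U y p s) y * pderiv_at s (\<lambda>y. U y q r) y + U y p s * pderiv_at j (pderiv_at s (\<lambda>y. U y q r)) y)
    + (\<Sum>*s. pderiv_at j (\<lambda>y. U y q s) y * pderiv_at s (\<lambda>y. U y r p) y + U y q s * pderiv_at j (pderiv_at s (\<lambda>y. U y r p)) y)
    + (\<Sum>*s. pderiv_at j (\<lambda>y. U y r s) y * pderiv_at s (\<lambda>y. U y p q) y + U y r s * pderiv_at j (pderiv_at s (\<lambda>y. U y p q)) y) = 0"
proof -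
  have d: "(\<lambda>y. U y p q) differentiable at y" "pderiv_at j (\<lambda>y. U y p q) differentiable at y" for p q j
    using smooth_U smooth_on_pderiv_at[OF smooth_U] smooth_on_differentiable[OF _ open_V y] by auto
  have "pderiv_at j (\<lambda>y. (\<Sum>*s. U y p s * pderiv_at s (\<lambda>y. U y q r) y)
      + (\<Sum>*s. U y q s * pderiv_at s (\<lambda>y. U y r p) y) + (\<Sum>*s. U y r s * pderiv_at s (\<lambda>y. U y p q) y)) y = 0"
    using pderiv_at_cong[OF open_V y jacobi_U, of "\<lambda>y. y" j] by simp
  then show ?thesis
    using d by (simp add: pderiv_at_add pderiv_at_sum pderiv_at_mult differentiable_sum differentiable_mult differentiable_add)
qed

text \<open>The vertical lift depends on the base point only but differentiates in fibre directions only.\<close>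

lemma schouten_vertical_lift:
  assumes "w \<in> base -` V"
  shows "(\<Sum>*D. vertical_lift U w A D * pderiv_at D (\<lambda>w. vertical_lift U w B C) w) = 0"
  using pderiv_at_lifts[OF assms] by (cases A; cases B; cases C) (simp_all add: sum_UNIV_sum_type)

text \<open>With three fibre directions, the cyclic sum is twice the Jacobi identity of \<open>U\<close>; with fewer, every summand vanishes.\<close>

lemma schouten_mixed_lifts:
  assumes w: "w \<in> base -` V"
  defines "S \<equiv> \<lambda>A B C. \<Sum>*D. vertical_lift U w A D * pderiv_at D (\<lambda>w. complete_lift U w B C) w
    + complete_lift U w A D * pderiv_at D (\<lambda>w. vertical_lift U w B C) w"
  shows "S A B C + S B C A + S C A B = 0"
proof -
  have y: "base w \<in> V"
    using w by simp
  have twice: "2 * (\<Sum>*s. U (base w) p s * pderiv_at s (\<lambda>y. U y q r) (base w))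
    + 2 * (\<Sum>*s. U (base w) q s * pderiv_at s (\<lambda>y. U y r p) (base w))
    + 2 * (\<Sum>*s. U (base w) r s * pderiv_at s (\<lambda>y. U y p q) (base w)) = 0" for p q r
    using jacobi_U[OF y, of p q r] by linarith
  show ?thesis
    by (cases A; cases B; cases C; simp only: S_def sum_UNIV_sum_type pderiv_at_lifts[OF w])
      (simp_all add: sum.distrib twice)
qed

text \<open>With one base direction the cyclic sum is the Jacobi identity of \<open>U\<close>, and with three fibre directions it is
  the derivative of the Jacobi identity along the fibre coordinate; with more base directions every summand vanishes.\<close>

lemma schouten_complete_lift:
  assumes w: "w \<in> base -` V"
  defines "S \<equiv> \<lambda>A B C. \<Sum>*D. complete_lift U w A D * pderiv_at D (\<lambda>w. complete_lift U w B C) w"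
  shows "S A B C + S B C A + S C A B = 0"
proof -
  have y: "base w \<in> V"
    using w by simp
  define T where "T j p q r = (\<Sum>*s. pderiv_at j (\<lambda>y. U y p s) (base w) * pderiv_at s (\<lambda>y. U y q r) (base w)
      + U (base w) p s * pderiv_at j (pderiv_at s (\<lambda>y. U y q r)) (base w))" for j p q r
  have vvv: "S (Inr p) (Inr q) (Inr r) = (\<Sum>*j. fibre w $ j * T j p q r)" for p q r
  proof -
    have "S (Inr p) (Inr q) (Inr r)
      = (\<Sum>*s j. fibre w $ j * (pderiv_at j (\<lambda>y. U y p s) (base w) * pderiv_at s (\<lambda>y. U y q r) (base w)
      + U (base w) p s * pderiv_at j (pderiv_at s (\<lambda>y. U y q r)) (base w)))"
      unfolding S_def sum_UNIV_sum_type pderiv_at_lifts[OF w]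
      by (simp add: sum_distrib_left sum_distrib_right sum.distrib distrib_left ac_simps)
    also have "\<dots> = (\<Sum>*j. fibre w $ j * T j p q r)"
      unfolding T_def sum_distrib_left by (rule sum.swap)
    finally show ?thesis .
  qed
  have "T j p q r + T j q r p + T j r p q = 0" for j p q r
    using jacobi_U_deriv[OF y] by (simp only: T_def)
  then have "(\<Sum>*j. fibre w $ j * (T j p q r + T j q r p + T j r p q)) = 0" for p q r
    by simp
  then have v: "S (Inr p) (Inr q) (Inr r) + S (Inr q) (Inr r) (Inr p) + S (Inr r) (Inr p) (Inr q) = 0" for p q r
    unfolding vvv by (simp add: distrib_left sum.distrib)
  have x: "S (Inl p) (Inr q) (Inr r) = (\<Sum>*s. U (base w) p s * pderiv_at s (\<lambda>y. U y q r) (base w))"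
    "S (Inr p) (Inl q) (Inr r) = (\<Sum>*s. U (base w) p s * pderiv_at s (\<lambda>y. U y q r) (base w))"
    "S (Inr p) (Inr q) (Inl r) = (\<Sum>*s. U (base w) p s * pderiv_at s (\<lambda>y. U y q r) (base w))"
    "S (Inl p) (Inl q) (Inr r) = 0" "S (Inl p) (Inr q) (Inl r) = 0" "S (Inr p) (Inl q) (Inl r) = 0" "S (Inl p) (Inl q) (Inl r) = 0" for p q r
    unfolding S_def sum_UNIV_sum_type pderiv_at_lifts[OF w] by simp_all
  show ?thesis
    using v jacobi_U[OF y] by (cases A; cases B; cases C) (simp_all add: x)
qed

text \<open>Sorted by powers of \<open>X\<close>, the coefficients are the three Schouten brackets of the two lifts.\<close>

lemma lifted_bivector_jacobi:
  assumes w: "w \<in> base -` V"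
  shows "(\<Sum>*D. lifted_bivector U w A D * fps_pderiv_at D (\<lambda>w. lifted_bivector U w B C) w)
      + (\<Sum>*D. lifted_bivector U w B D * fps_pderiv_at D (\<lambda>w. lifted_bivector U w C A) w)
      + (\<Sum>*D. lifted_bivector U w C D * fps_pderiv_at D (\<lambda>w. lifted_bivector U w A B) w) = 0"
proof -
  have d: "fps_pderiv_at D (\<lambda>w. lifted_bivector U w B C) w
    = fps_const (pderiv_at D (\<lambda>w. vertical_lift U w B C) w) - fps_X * fps_const (pderiv_at D (\<lambda>w. complete_lift U w B C) w)" for B C D
    unfolding lifted_bivector_def using smooth_lifts open_phase w
    by (simp add: fps_pderiv_at_diff fps_pderiv_at_mult fps_pderiv_at_fps_const fps_smooth_on_fps_const
      fps_smooth_on_mult fps_smooth_on_const)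
  let ?m = "\<lambda>A B C. \<Sum>*D. vertical_lift U w A D * pderiv_at D (\<lambda>w. complete_lift U w B C) w
    + complete_lift U w A D * pderiv_at D (\<lambda>w. vertical_lift U w B C) w"
  let ?c = "\<lambda>A B C. \<Sum>*D. complete_lift U w A D * pderiv_at D (\<lambda>w. complete_lift U w B C) w"
  have e: "(\<Sum>*D. lifted_bivector U w A D * fps_pderiv_at D (\<lambda>w. lifted_bivector U w B C) w)
    = fps_X * (fps_X * fps_const (?c A B C)) - fps_X * fps_const (?m A B C)" for A B C
  proof -
    have "(\<Sum>*D. lifted_bivector U w A D * fps_pderiv_at D (\<lambda>w. lifted_bivector U w B C) w)
      = (\<Sum>*D. fps_const (vertical_lift U w A D * pderiv_at D (\<lambda>w. vertical_lift U w B C) w))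
      - fps_X * (\<Sum>*D. fps_const (vertical_lift U w A D * pderiv_at D (\<lambda>w. complete_lift U w B C) w
          + complete_lift U w A D * pderiv_at D (\<lambda>w. vertical_lift U w B C) w))
      + fps_X * (fps_X * (\<Sum>*D. fps_const (complete_lift U w A D * pderiv_at D (\<lambda>w. complete_lift U w B C) w)))"
      unfolding d unfolding lifted_bivector_def sum_distrib_left
      by (simp only: sum.distrib[symmetric] sum_subtractf[symmetric] fps_const_add[symmetric] fps_const_mult[symmetric])
        (simp add: algebra_simps del: fps_const_add fps_const_mult)
    then show ?thesis
      by (simp only: fps_const_sum schouten_vertical_lift[OF w] fps_const_0_eq_0) simp
  qed
  have "fps_X * (fps_X * (fps_const (?c A B C) + fps_const (?c B C A) + fps_const (?c C A B)))
      - fps_X * (fps_const (?m A B C) + fps_const (?m B C A) + fps_const (?m C A B)) = 0"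
    unfolding fps_const_add schouten_complete_lift[OF w] schouten_mixed_lifts[OF w] by simp
  then show ?thesis
    unfolding e by (simp add: algebra_simps del: fps_const_add)
qed

lemma poisson_bracket_lifted_bivector_jacobi:
  assumes "fps_smooth_on (base -` V) F" "fps_smooth_on (base -` V) G" "fps_smooth_on (base -` V) H" "w \<in> base -` V"
  defines "br \<equiv> poisson_bracket (lifted_bivector U)"
  shows "br F (br G H) w + br G (br H F) w + br H (br F G) w = 0"
  unfolding br_def
  by (rule poisson_bracket_jacobi[OF open_phase smooth_lifted_bivector antisym_lifted_bivector[OF assms(4)]
    lifted_bivector_jacobi[OF assms(4)] assms(1-4)])

end

section \<open>Symbols of series in a chart\<close>

definition chart_image :: "('m, 'n::finite) chart \<Rightarrow> (real^'n) set" where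
  "chart_image c = coord c ` cdom c"

definition symbol :: "('m, 'n::finite) chart \<Rightarrow> ('m, 'n) series \<Rightarrow> real^('n + 'n) \<Rightarrow> real fps" where
  "symbol c \<alpha> w = Abs_fps (\<lambda>k. fibre_poly k (\<alpha> k c (coord_inv c (base w))) (fibre w))"

lemma symbol_nth: "fps_nth (symbol c \<alpha> w) k = fibre_poly k (\<alpha> k c (coord_inv c (base w))) (fibre w)"
  by (simp add: symbol_def)

definition poisson_coefficients :: "('m, 'n::finite) tensor \<Rightarrow> ('m, 'n) chart \<Rightarrow> real^'n \<Rightarrow> 'n \<Rightarrow> 'n \<Rightarrow> real" where
  "poisson_coefficients \<Omega> c y p q = Omega_up \<Omega> c (coord_inv c y) p q"

text \<open>The algebraic part of membership in \<open>Shat A\<close>, without smoothness and tensoriality. It is what can be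
  seen directly from the formulas for the brackets, and it suffices for a series to be determined by its symbols.\<close>

definition graded_symmetric :: "('m, 'n::finite) chart set \<Rightarrow> ('m, 'n) series \<Rightarrow> bool" where
  "graded_symmetric A \<alpha> \<longleftrightarrow> (\<forall>k c x is. \<not> (c \<in> A \<and> x \<in> cdom c \<and> length is = k) \<longrightarrow> \<alpha> k c x is = 0)
    \<and> (\<forall>k c x. symmetric_components (\<alpha> k c x))"

lemma graded_symmetric_eq_0:
  "graded_symmetric A \<alpha> \<Longrightarrow> \<not> (c \<in> A \<and> x \<in> cdom c \<and> length is = k) \<Longrightarrow> \<alpha> k c x is = 0"
  unfolding graded_symmetric_def by blast

lemma graded_symmetric_symmetric: "graded_symmetric A \<alpha> \<Longrightarrow> symmetric_components (\<alpha> k c x)"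
  unfolding graded_symmetric_def by blast

lemma graded_symmetricI:
  "(\<And>k c x is. \<not> (c \<in> A \<and> x \<in> cdom c \<and> length is = k) \<Longrightarrow> \<alpha> k c x is = 0) \<Longrightarrow>
   (\<And>k c x. symmetric_components (\<alpha> k c x)) \<Longrightarrow> graded_symmetric A \<alpha>"
  unfolding graded_symmetric_def by blast

lemma symmetric_components_add:
  "symmetric_components t \<Longrightarrow> symmetric_components t' \<Longrightarrow> symmetric_components (\<lambda>is. t is + t' is)"
  unfolding symmetric_components_def by metis

lemma symmetric_components_sum:
  "(\<And>s. s \<in> S \<Longrightarrow> symmetric_components (t s)) \<Longrightarrow> symmetric_components (\<lambda>is. \<Sum>s\<in>S. t s is)"
  unfolding symmetric_components_def by (meson sum.cong)

lemma Sk_iff: "T \<in> Sk A k \<longleftrightarrow> tensor_field A k T \<and> (\<forall>c x. symmetric_components (T c x))"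
  unfolding Sk_def symmetric_components_iff_permute_list by blast

lemma Shat_graded_symmetric: "\<alpha> \<in> Shat A \<Longrightarrow> graded_symmetric A \<alpha>"
  unfolding Shat_def graded_symmetric_def Sk_iff tensor_field_def by blast

lemma Shat_symmetric: "\<alpha> \<in> Shat A \<Longrightarrow> symmetric_components (\<alpha> k c x)"
  unfolding Shat_def Sk_iff by blast

lemma Shat_smooth: "\<alpha> \<in> Shat A \<Longrightarrow> c \<in> A \<Longrightarrow> smooth_on (chart_image c) (\<lambda>y. \<alpha> k c (coord_inv c y) is)"
  unfolding Shat_def Sk_iff tensor_field_def chart_image_def by blast

lemma graded_symmetric_eqI:
  assumes "graded_symmetric A \<alpha>" "graded_symmetric A \<beta>"
    and charts: "\<And>c x. c \<in> A \<Longrightarrow> x \<in> cdom c \<Longrightarrow> coord_inv c (coord c x) = x"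
    and "\<And>c w. c \<in> A \<Longrightarrow> w \<in> base -` chart_image c \<Longrightarrow> symbol c \<alpha> w = symbol c \<beta> w"
  shows "\<alpha> = \<beta>"
proof (intro ext)
  fix k c x "is"
  show "\<alpha> k c x is = \<beta> k c x is"
  proof (cases "c \<in> A \<and> x \<in> cdom c \<and> length is = k")
    case True
    have "fibre_poly k (\<alpha> k c x) v = fibre_poly k (\<beta> k c x) v" for v
    proof -
      obtain w where w: "base w = coord c x" "fibre w = v"
        using ex_base_fibre by blast
      then have "symbol c \<alpha> w = symbol c \<beta> w"
        using assms(4) True by (simp add: chart_image_def)
      then have "fps_nth (symbol c \<alpha> w) k = fps_nth (symbol c \<beta> w) k"
        by simp
      with True show ?thesis
        by (simp add: symbol_nth w charts)
    qed
    from fibre_poly_inject[OF graded_symmetric_symmetric[OF assms(1)] graded_symmetric_symmetric[OF assms(2)] this]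
    show ?thesis
      using True by blast
  next
    case False
    then show ?thesis
      using graded_symmetric_eq_0[OF assms(1) False] graded_symmetric_eq_0[OF assms(2) False] by simp
  qed
qed

lemma symbol_add: "symbol c (\<alpha> + \<beta>) w = symbol c \<alpha> w + symbol c \<beta> w"
  by (simp add: fps_eq_iff symbol_nth fibre_poly_add plus_fun_def)

lemma symbol_scaleR: "symbol c (r *\<^sub>R \<alpha>) w = fps_const r * symbol c \<alpha> w"
  by (simp add: fps_eq_iff symbol_nth fibre_poly_mult_left scaleR_fun_def)

lemma symbol_0: "symbol c 0 w = 0"
  by (simp add: fps_eq_iff symbol_nth zero_fun_def)

lemma sum_fun_apply: "(\<Sum>s\<in>S. f s) x = (\<Sum>s\<in>S. f s x)"
  by (induction S rule: infinite_finite_induct) simp_all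

lemma graded_symmetric_add: "graded_symmetric A \<alpha> \<Longrightarrow> graded_symmetric A \<beta> \<Longrightarrow> graded_symmetric A (\<alpha> + \<beta>)"
  by (intro graded_symmetricI)
    (simp_all add: plus_fun_def graded_symmetric_eq_0 symmetric_components_add graded_symmetric_symmetric)

lemma graded_symmetric_alg_bracket:
  assumes "graded_symmetric A \<alpha>" "graded_symmetric A \<beta>"
  shows "graded_symmetric A (alg_bracket \<Omega> \<alpha> \<beta>)"
proof (rule graded_symmetricI)
  have "alg_bracket_hom \<Omega> k (m + 2 - k) (\<alpha> k) (\<beta> (m + 2 - k)) c x is = 0"
    if no: "\<not> (c \<in> A \<and> x \<in> cdom c \<and> length is = m)" "k \<le> m + 2" for m k c x "is"
    unfolding alg_bracket_hom_def
  proof (rule symmetrize_eq_0)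
    fix js :: "'b list" assume js: "length js = length is"
    show "real k * real (m + 2 - k) * (\<Sum>*p q. \<alpha> k c x (p # take (k - 1) js)
        * (Omega_up \<Omega> c x p q * \<beta> (m + 2 - k) c x (drop (k - 1) js @ [q]))) = 0"
    proof (cases "k = 0 \<or> m + 2 - k = 0")
      case False
      have "\<alpha> k c x (p # take (k - 1) js) = 0 \<or> \<beta> (m + 2 - k) c x (drop (k - 1) js @ [q]) = 0" for p q
      proof (cases "c \<in> A \<and> x \<in> cdom c \<and> length js \<ge> k - 1")
        case True
        then have "length (drop (k - 1) js @ [q]) \<noteq> m + 2 - k"
          using no js False by auto
        then show ?thesis
          by (intro disjI2 graded_symmetric_eq_0[OF assms(2)]) blast
      next
        case 2: False
        then have "\<not> (c \<in> A \<and> x \<in> cdom c \<and> length (p # take (k - 1) js) = k)"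
          using False by (auto simp: min_def)
        then show ?thesis
          by (intro disjI1 graded_symmetric_eq_0[OF assms(1)])
      qed
      then have "(\<Sum>*p q. \<alpha> k c x (p # take (k - 1) js)
        * (Omega_up \<Omega> c x p q * \<beta> (m + 2 - k) c x (drop (k - 1) js @ [q]))) = 0"
        by (intro sum.neutral ballI) (metis mult_zero_left mult_zero_right)
      then show ?thesis
        by simp
    qed auto
  qed
  then show "alg_bracket \<Omega> \<alpha> \<beta> m c x is = 0" if "\<not> (c \<in> A \<and> x \<in> cdom c \<and> length is = m)" for m c x "is"
    using that unfolding alg_bracket_def sum_fun_apply by (intro sum.neutral) auto
  show "symmetric_components (alg_bracket \<Omega> \<alpha> \<beta> m c x)" for m c x
    unfolding alg_bracket_def alg_bracket_hom_def sum_fun_apply [abs_def]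
    by (intro symmetric_components_sum symmetric_components_symmetrize)
qed

lemma nabla_eq_0: "(\<And>z js. length js = length is \<Longrightarrow> T c z js = 0) \<Longrightarrow> nabla \<Gamma> T c x p is = 0"
  by (simp add: nabla_def cpd_def comp_def)

lemma graded_symmetric_schouten:
  assumes "graded_symmetric A \<alpha>" "graded_symmetric A \<beta>"
  shows "graded_symmetric A (schouten \<Omega> \<Gamma> \<alpha> \<beta>)"
proof (rule graded_symmetricI)
  have zero: "real k * (\<Sum>*p q. \<alpha> k c x (p # take (k - 1) js) * (Omega_up \<Omega> c x p q * nabla \<Gamma> (\<beta> l) c x q (drop (k - 1) js))) = 0"
    if \<alpha>: "graded_symmetric A \<alpha>" and \<beta>: "graded_symmetric A \<beta>" and no: "\<not> (c \<in> A \<and> x \<in> cdom c \<and> length js + 1 = k + l)"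
    for \<alpha> \<beta> :: "('a, 'b) series" and k l c x js
  proof (cases "k = 0")
    case False
    have "\<alpha> k c x (p # take (k - 1) js) = 0 \<or> nabla \<Gamma> (\<beta> l) c x q (drop (k - 1) js) = 0" for p q
    proof (cases "c \<in> A \<and> x \<in> cdom c \<and> length js \<ge> k - 1")
      case True
      with False no have "length (drop (k - 1) js) \<noteq> l"
        by auto
      then have "\<beta> l c z is = 0" if "length is = length (drop (k - 1) js)" for z "is"
        using that by (intro graded_symmetric_eq_0[OF \<beta>]) auto
      then show ?thesis
        by (intro disjI2 nabla_eq_0)
    next
      case 2: False
      then have "\<not> (c \<in> A \<and> x \<in> cdom c \<and> length (p # take (k - 1) js) = k)"
        using False by (auto simp: min_def)
      then show ?thesis
        by (intro disjI1 graded_symmetric_eq_0[OF \<alpha>])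
    qed
    then have "(\<Sum>*p q. \<alpha> k c x (p # take (k - 1) js) * (Omega_up \<Omega> c x p q * nabla \<Gamma> (\<beta> l) c x q (drop (k - 1) js))) = 0"
      by (intro sum.neutral ballI) (metis mult_zero_left mult_zero_right)
    then show ?thesis
      by simp
  qed simp
  have "schouten_hom \<Omega> \<Gamma> k (m + 1 - k) (\<alpha> k) (\<beta> (m + 1 - k)) c x is = 0"
    if no: "\<not> (c \<in> A \<and> x \<in> cdom c \<and> length is = m)" "k \<le> m + 1" for m k c x "is"
    unfolding schouten_hom_def
  proof (rule symmetrize_eq_0)
    fix js :: "'b list" assume "length js = length is"
    with no have "\<not> (c \<in> A \<and> x \<in> cdom c \<and> length js + 1 = k + (m + 1 - k))" "\<not> (c \<in> A \<and> x \<in> cdom c \<and> length js + 1 = (m + 1 - k) + k)"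
      by auto
    from zero[OF assms this(1)] zero[OF assms(2,1) this(2)]
    show "- real k * (\<Sum>*p q. \<alpha> k c x (p # take (k - 1) js) * (Omega_up \<Omega> c x p q * nabla \<Gamma> (\<beta> (m + 1 - k)) c x q (drop (k - 1) js)))
      + real (m + 1 - k) * (\<Sum>*p q. \<beta> (m + 1 - k) c x (p # take (m + 1 - k - 1) js)
        * (Omega_up \<Omega> c x p q * nabla \<Gamma> (\<alpha> k) c x q (drop (m + 1 - k - 1) js))) = 0"
      by (simp only: mult_minus_left)
  qed
  then show "schouten \<Omega> \<Gamma> \<alpha> \<beta> m c x is = 0" if "\<not> (c \<in> A \<and> x \<in> cdom c \<and> length is = m)" for m c x "is"
    using that unfolding schouten_def sum_fun_apply by (intro sum.neutral) auto
  show "symmetric_components (schouten \<Omega> \<Gamma> \<alpha> \<beta> m c x)" for m c x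
    unfolding schouten_def schouten_hom_def sum_fun_apply [abs_def]
    by (intro symmetric_components_sum symmetric_components_symmetrize)
qed

section \<open>Brackets of homogeneous tensors\<close>

text \<open>The product of the monomials in the two blocks of free indices is the monomial in all indices, so contracting one index of each
  tensor multiplies the derivatives of the polynomials. The degrees \<open>0\<close> are covered because both sides vanish.\<close>

lemma fibre_poly_alg_bracket_hom:
  assumes "symmetric_components (\<alpha> c x)" "symmetric_components (\<beta> c x)" "k + l = m + 2"
  shows "fibre_poly m (alg_bracket_hom \<Omega> k l \<alpha> \<beta> c x) v
    = (\<Sum>*p q. Omega_up \<Omega> c x p q * fibre_deriv p k (\<alpha> c x) v * fibre_deriv q l (\<beta> c x) v)"
proof (cases "k = 0 \<or> l = 0")
  case True
  then have "alg_bracket_hom \<Omega> k l \<alpha> \<beta> c x = (\<lambda>_. 0)"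
    by (auto simp: alg_bracket_hom_def symmetrize_def)
  with True show ?thesis
    by (auto simp: fibre_deriv_def)
next
  case False
  then have m: "m = (k - 1) + (l - 1)"
    using assms(3) by auto
  have "fibre_poly m (\<lambda>is. \<alpha> c x (p # take (k - 1) is) * \<beta> c x (drop (k - 1) is @ [q])) v
    = fibre_poly (k - 1) (\<lambda>is. \<alpha> c x (p # is)) v * fibre_poly (l - 1) (\<lambda>is. \<beta> c x (q # is)) v" for p q
  proof -
    have "\<beta> c x (is @ [q]) = \<beta> c x (q # is)" for "is"
      by (rule symmetric_componentsD[OF assms(2)]) simp
    then show ?thesis
      unfolding m using fibre_poly_append[of "k - 1" "l - 1" "\<lambda>is. \<alpha> c x (p # is)" "\<lambda>is. \<beta> c x (q # is)" v]
      by simp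
  qed
  then show ?thesis
    by (simp add: alg_bracket_hom_def fibre_poly_symmetrize fibre_poly_mult_left fibre_poly_sum fibre_deriv_def
      sum_distrib_left mult.left_commute[of "\<alpha> c x _"]) (simp add: ac_simps)
qed

lemma fibre_poly_schouten_hom:
  fixes \<alpha> \<beta> :: "('m, 'n::finite) tensor"
  assumes "k + l = m + 1"
  shows "fibre_poly m (schouten_hom \<Omega> \<Gamma> k l \<alpha> \<beta> c x) v
    = (\<Sum>*p q. Omega_up \<Omega> c x p q * (fibre_poly k (nabla \<Gamma> \<alpha> c x q) v * fibre_deriv p l (\<beta> c x) v
      - fibre_deriv p k (\<alpha> c x) v * fibre_poly l (nabla \<Gamma> \<beta> c x q) v))"
proof -
  have *: "fibre_poly m (\<lambda>is. real k * (\<Sum>*p q. \<alpha> c x (p # take (k - 1) is) * (Omega_up \<Omega> c x p q * nabla \<Gamma> \<beta> c x q (drop (k - 1) is)))) v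
    = (\<Sum>*p q. Omega_up \<Omega> c x p q * (fibre_deriv p k (\<alpha> c x) v * fibre_poly l (nabla \<Gamma> \<beta> c x q) v))"
    if "k + l = m + 1" for k l and \<alpha> \<beta> :: "('m, 'n) tensor"
  proof (cases "k = 0")
    case False
    then have m: "m = (k - 1) + l"
      using that by auto
    have "fibre_poly m (\<lambda>is. \<alpha> c x (p # take (k - 1) is) * nabla \<Gamma> \<beta> c x q (drop (k - 1) is)) v
      = fibre_poly (k - 1) (\<lambda>is. \<alpha> c x (p # is)) v * fibre_poly l (nabla \<Gamma> \<beta> c x q) v" for p q
      unfolding m using fibre_poly_append[of "k - 1" l "\<lambda>is. \<alpha> c x (p # is)" "nabla \<Gamma> \<beta> c x q" v]
      by simp
    then show ?thesis
      by (simp add: fibre_poly_mult_left fibre_poly_sum fibre_deriv_def sum_distrib_left mult.left_commute[of "\<alpha> c x _"])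
        (simp add: ac_simps)
  qed (simp add: fibre_deriv_def)
  show ?thesis
    unfolding schouten_hom_def fibre_poly_symmetrize mult_minus_left fibre_poly_add fibre_poly_minus
    using *[OF assms] *[of l k] assms
    by (simp add: add.commute right_diff_distrib sum_subtractf) (simp add: mult.commute)
qed

lemma fibre_poly_nabla:
  assumes "symmetric_components (T c x)"
  shows "fibre_poly k (nabla \<Gamma> T c x q) v = fibre_poly k (\<lambda>is. cpd c q (\<lambda>z. T c z is) x) v
    - (\<Sum>*j r. \<Gamma> c x q j r * v $ j * fibre_deriv r k (T c x) v)"
  unfolding nabla_def [abs_def] fibre_poly_diff fibre_poly_replace_index[OF assms] ..

section \<open>Symplectic manifolds with a symplectic connection\<close>

lemma matrix_add_rdistrib: "(B + C) ** A = B ** A + C ** A" for A :: "real^'n^'n"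
  by (simp add: matrix_matrix_mult_def vec_eq_iff sum.distrib distrib_right)

locale symplectic_connection_manifold =
  fixes A :: "('m::{t2_space, second_countable_topology}, 'n::finite) chart set"
    and \<Omega> :: "('m, 'n) tensor" and \<Gamma> :: "('m, 'n) connection"
  assumes atlas: "smooth_atlas A"
    and form: "symplectic_form A \<Omega>"
    and connection: "symplectic_connection A \<Omega> \<Gamma>"
begin

lemma chart:
  assumes "c \<in> A"
  shows "open (cdom c)" "open (chart_image c)" "homeomorphism (cdom c) (chart_image c) (coord c) (coord_inv c)"
  using atlas assms by (auto simp: smooth_atlas_def is_chart_def chart_image_def)

lemma coord_inv_coord: "c \<in> A \<Longrightarrow> x \<in> cdom c \<Longrightarrow> coord_inv c (coord c x) = x"
  using chart(3) homeomorphism_apply1 by blast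

lemma coord_coord_inv: "c \<in> A \<Longrightarrow> y \<in> chart_image c \<Longrightarrow> coord c (coord_inv c y) = y"
  using chart(3) homeomorphism_apply2 by blast

lemma coord_inv_in: "c \<in> A \<Longrightarrow> y \<in> chart_image c \<Longrightarrow> coord_inv c y \<in> cdom c"
  using chart(3) homeomorphism_image2 by blast

lemma cpd_coord_inv:
  assumes "c \<in> A" "y \<in> chart_image c"
  shows "cpd c i f (coord_inv c y) = pderiv_at i (\<lambda>y. f (coord_inv c y)) y"
  using assms by (simp add: cpd_def comp_def coord_inv_in coord_coord_inv)

lemma
  assumes "c \<in> A"
  shows smooth_Omega: "smooth_on (chart_image c) (\<lambda>y. \<Omega> c (coord_inv c y) is)"
    and Omega_antisym: "x \<in> cdom c \<Longrightarrow> \<Omega> c x [i, j] = - \<Omega> c x [j, i]"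
    and Omega_invertible: "x \<in> cdom c \<Longrightarrow> invertible (\<chi> i j. \<Omega> c x [i, j])"
  using form assms unfolding symplectic_form_def tensor_field_def chart_image_def by blast+

lemma
  assumes "c \<in> A"
  shows smooth_Christoffel: "smooth_on (chart_image c) (\<lambda>y. \<Gamma> c (coord_inv c y) i j k)"
    and Christoffel_symmetric: "x \<in> cdom c \<Longrightarrow> \<Gamma> c x i j k = \<Gamma> c x j i k"
    and nabla_Omega: "x \<in> cdom c \<Longrightarrow> nabla \<Gamma> \<Omega> c x p [i, j] = 0"
  using connection assms
  unfolding symplectic_connection_def affine_connection_def torsion_free_def chart_image_def by blast+

abbreviation U where "U \<equiv> poisson_coefficients \<Omega>"

lemma matrix_inv_Omega:
  assumes "c \<in> A" "x \<in> cdom c"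
  defines "W \<equiv> (\<chi> i j. \<Omega> c x [i, j])"
  shows "W ** matrix_inv W = mat 1" "matrix_inv W ** W = mat 1"
  using someI_ex[OF Omega_invertible[OF assms(1,2), unfolded invertible_def]] by (simp_all add: matrix_inv_def W_def)

lemma smooth_poisson_coefficients:
  assumes "c \<in> A"
  shows "smooth_on (chart_image c) (\<lambda>y. U c y p q)"
  unfolding poisson_coefficients_def Omega_up_def
proof (intro smooth_on_minus smooth_on_matrix_inv)
  show "smooth_on (chart_image c) (\<lambda>y. (\<chi> i j. \<Omega> c (coord_inv c y) [i, j]) $ i $ j)" for i j
    using smooth_Omega[OF assms, of "[i, j]"] by simp
  show "invertible (\<chi> i j. \<Omega> c (coord_inv c y) [i, j])" if "y \<in> chart_image c" for y
    by (rule Omega_invertible[OF assms coord_inv_in[OF assms that]])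
qed (rule chart(2)[OF assms])+

lemma Omega_up_antisym:
  assumes "c \<in> A" "x \<in> cdom c"
  shows "Omega_up \<Omega> c x p q = - Omega_up \<Omega> c x q p"
proof -
  define W where "W = (\<chi> i j. \<Omega> c x [i, j])"
  note inv = matrix_inv_Omega[OF assms, folded W_def]
  define M where "M = (\<chi> i j. - matrix_inv W $ j $ i)"
  have "W ** M = mat 1"
  proof -
    have "W $ i $ k * M $ k $ j = matrix_inv W $ j $ k * W $ k $ i" for i j k
      using Omega_antisym[OF assms, of i k] by (simp add: M_def W_def)
    then have "(W ** M) $ i $ j = (matrix_inv W ** W) $ j $ i" for i j
      by (simp add: matrix_matrix_mult_def)
    then show ?thesis
      by (simp add: inv vec_eq_iff mat_def)
  qed
  then have "matrix_inv W ** W ** M = matrix_inv W"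
    by (simp add: matrix_mul_assoc[symmetric])
  then have "M $ p $ q = matrix_inv W $ p $ q"
    by (simp add: inv)
  then show ?thesis
    by (simp add: M_def Omega_up_def W_def)
qed

lemma antisym_poisson_coefficients:
  assumes "c \<in> A" "y \<in> chart_image c"
  shows "U c (y) p q = - U c (y) q p"
  unfolding poisson_coefficients_def by (rule Omega_up_antisym[OF assms(1) coord_inv_in[OF assms]])

text \<open>The derivative of the inverse matrix is found by differentiating \<open>W\<^sup>-\<^sup>1 W = 1\<close>, and the derivative of the matrix \<open>W\<close> of \<open>\<Omega>\<close> is
  expressed by Christoffel symbols because \<open>\<Omega>\<close> is parallel. The result says that \<open>\<Omega>\<^bsup>qr\<^esup>\<close> is parallel too.\<close>

lemma pderiv_at_poisson_coefficients:
  assumes c: "c \<in> A" and y: "y \<in> chart_image c"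
  shows "pderiv_at s (\<lambda>y. U c y q r) y = - (\<Sum>*a. \<Gamma> c (coord_inv c y) s a q * U c y a r)
    - (\<Sum>*a. \<Gamma> c (coord_inv c y) s a r * U c y q a)"
proof -
  let ?x = "coord_inv c y"
  define W where "W y = (\<chi> i j. \<Omega> c (coord_inv c y) [i, j])" for y
  have inv: "W z ** matrix_inv (W z) = mat 1" "matrix_inv (W z) ** W z = mat 1" if "z \<in> chart_image c" for z
    using matrix_inv_Omega[OF c coord_inv_in[OF c that]] by (simp_all add: W_def)
  have smooth_N: "smooth_on (chart_image c) (\<lambda>y. matrix_inv (W y) $ i $ j)" for i j
    using smooth_on_minus[OF smooth_poisson_coefficients[OF c] chart(2)[OF c], of i j]
    by (simp add: poisson_coefficients_def Omega_up_def W_def)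
  have smooth_W: "smooth_on (chart_image c) (\<lambda>y. W y $ i $ j)" for i j
    using smooth_Omega[OF c] by (simp add: W_def)
  note d = smooth_on_differentiable[OF smooth_N chart(2)[OF c] y] smooth_on_differentiable[OF smooth_W chart(2)[OF c] y]
  define N where "N = matrix_inv (W y)"
  define dN where "dN = (\<chi> i j. pderiv_at s (\<lambda>y. matrix_inv (W y) $ i $ j) y)"
  define dW where "dW = (\<chi> i j. pderiv_at s (\<lambda>y. W y $ i $ j) y)"
  define G where "G = (\<chi> p a. \<Gamma> c ?x s p a)"
  have dW: "dW = G ** W y + W y ** transpose G"
  proof -
    have "dW $ p $ j = (G ** W y + W y ** transpose G) $ p $ j" for p j
      using nabla_Omega[OF c coord_inv_in[OF c y], of s p j] cpd_coord_inv[OF c y, of s "\<lambda>z. \<Omega> c z [p, j]"]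
      by (simp add: nabla_def dW_def W_def G_def matrix_matrix_mult_def transpose_def numeral_2_eq_2 mult.commute)
    then show ?thesis
      by (simp add: vec_eq_iff)
  qed
  have "dN ** W y + N ** dW = 0"
  proof -
    have "(dN ** W y + N ** dW) $ i $ j = pderiv_at s (\<lambda>y. (matrix_inv (W y) ** W y) $ i $ j) y" for i j
      using d by (simp add: matrix_matrix_mult_def dN_def dW_def N_def pderiv_at_sum pderiv_at_mult sum.distrib)
    also have "pderiv_at s (\<lambda>y. (matrix_inv (W y) ** W y) $ i $ j) y = pderiv_at s (\<lambda>_. mat 1 $ i $ j) y" for i j
      by (rule pderiv_at_cong[OF chart(2)[OF c] y]) (simp add: inv)
    finally show ?thesis
      by (simp add: vec_eq_iff)
  qed
  then have "(dN ** W y + N ** dW) ** N = 0"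
    by (simp add: matrix_matrix_mult_def vec_eq_iff)
  then have "dN ** (W y ** N) + N ** G ** (W y ** N) + (N ** W y) ** transpose G ** N = 0"
    by (simp add: dW matrix_add_ldistrib matrix_add_rdistrib matrix_mul_assoc add.assoc)
  then have "dN + N ** G + transpose G ** N = 0"
    using inv[OF y] by (simp add: N_def)
  then have "dN $ q $ r = - (\<Sum>*a. N $ q $ a * \<Gamma> c ?x s a r) - (\<Sum>*a. \<Gamma> c ?x s a q * N $ a $ r)"
    by (simp add: vec_eq_iff matrix_matrix_mult_def G_def transpose_def eq_neg_iff_add_eq_0 algebra_simps)
  moreover have "pderiv_at s (\<lambda>y. U c y q r) y = - dN $ q $ r"
    using d pderiv_at_mult[of "\<lambda>_. - 1" y "\<lambda>y. matrix_inv (W y) $ q $ r" s]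
    by (simp add: poisson_coefficients_def Omega_up_def W_def[symmetric] dN_def)
  ultimately show ?thesis
    by (simp add: poisson_coefficients_def Omega_up_def W_def[symmetric] N_def sum_negf mult.commute)
qed

text \<open>As \<open>\<Omega>\<^bsup>pq\<^esup>\<close> is parallel, the Jacobi identity is a cyclic sum of differences of terms \<open>K\<close> with two contracted
  Christoffel indices. By the absence of torsion these terms are symmetric in their last two arguments, and they cancel in pairs.\<close>

lemma poisson_coordinates: "c \<in> A \<Longrightarrow> poisson_coordinates (chart_image c) (U c)"
proof
  assume c: "c \<in> A"
  show "open (chart_image c)" "\<And>p q. smooth_on (chart_image c) (\<lambda>y. U c y p q)"
    using chart(2)[OF c] smooth_poisson_coefficients[OF c] by auto
  fix y p q r assume y: "y \<in> chart_image c"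
  show anti: "U c y p q = - U c y q p" for p q
    by (rule antisym_poisson_coefficients[OF c y])
  define K where "K q p r = (\<Sum>*s a. U c y p s * U c y r a * \<Gamma> c (coord_inv c y) s a q)" for q p r
  have K: "K q p r = K q r p" for p q r
    unfolding K_def by (subst sum.swap)
      (simp add: Christoffel_symmetric[OF c coord_inv_in[OF c y], of _ _ q] mult.commute mult.left_commute)
  have "(\<Sum>*s. U c y p s * pderiv_at s (\<lambda>y. U c y q r) y) = K q p r - K r p q" for p q r
  proof -
    have "(\<Sum>*s. U c y p s * pderiv_at s (\<lambda>y. U c y q r) y)
      = (\<Sum>*s a. U c y p s * (- U c y a r) * \<Gamma> c (coord_inv c y) s a q - U c y p s * U c y q a * \<Gamma> c (coord_inv c y) s a r)"
      by (simp add: pderiv_at_poisson_coefficients[OF c y] right_diff_distrib sum_distrib_left sum_subtractf sum_negf ac_simps)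
    also have "\<dots> = K q p r - K r p q"
      by (simp only: K_def anti[of r, symmetric] sum_subtractf)
    finally show ?thesis .
  qed
  then show "(\<Sum>*s. U c y p s * pderiv_at s (\<lambda>y. U c y q r) y) + (\<Sum>*s. U c y q s * pderiv_at s (\<lambda>y. U c y r p) y)
      + (\<Sum>*s. U c y r s * pderiv_at s (\<lambda>y. U c y p q) y) = 0"
    using K[of q p r] K[of r p q] K[of p q r] by simp
qed

section \<open>The bracket of two series is the Poisson bracket of their symbols\<close>

lemma smooth_symbol:
  assumes "c \<in> A" "\<alpha> \<in> Shat A"
  shows "fps_smooth_on (base -` chart_image c) (symbol c \<alpha>)"
  unfolding fps_smooth_on_def symbol_nth
  using smooth_on_base[OF Shat_smooth[OF assms(2,1)] chart(2)[OF assms(1)]] open_base_vimage[OF chart(2)[OF assms(1)]]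
  by (intro allI fibre_poly_smooth_on smooth_on_fibre)

lemma
  assumes c: "c \<in> A" and \<alpha>: "\<alpha> \<in> Shat A" and w: "w \<in> base -` chart_image c"
  defines "x \<equiv> coord_inv c (base w)"
  shows fibre_derivative_symbol_nth: "fps_nth (fps_pderiv_at (Inr p) (symbol c \<alpha>) w) k = fibre_deriv p k (\<alpha> k c x) (fibre w)"
    and base_derivative_symbol_nth: "fps_nth (fps_pderiv_at (Inl q) (symbol c \<alpha>) w) k
      = fibre_poly k (\<lambda>is. cpd c q (\<lambda>z. \<alpha> k c z is) x) (fibre w)"
proof -
  let ?T = "\<lambda>is w. \<alpha> k c (coord_inv c (base w)) is"
  have y: "base w \<in> chart_image c"
    using w by simp
  have d: "?T is differentiable at w" "(\<lambda>w. fibre w $ p) differentiable at w" for "is" p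
    using smooth_on_differentiable[OF smooth_on_base[OF Shat_smooth[OF \<alpha> c] chart(2)[OF c]] open_base_vimage[OF chart(2)[OF c]] w]
      smooth_on_differentiable[OF smooth_on_fibre open_UNIV UNIV_I] by auto
  have *: "pderiv_at B (\<lambda>w. fibre_poly k (\<lambda>is. ?T is w) (fibre w)) w = fibre_poly k (\<lambda>is. pderiv_at B (?T is) w) (fibre w)
      + (\<Sum>*p. pderiv_at B (\<lambda>w. fibre w $ p) w * fibre_deriv p k (\<lambda>is. ?T is w) (fibre w))" for B
    using d Shat_symmetric[OF \<alpha>] by (intro pderiv_at_fibre_poly)
  have base: "pderiv_at (Inl q) (?T is) w = cpd c q (\<lambda>z. \<alpha> k c z is) x" "pderiv_at (Inr p) (?T is) w = 0" for "is"
    using pderiv_at_base[OF smooth_on_differentiable[OF Shat_smooth[OF \<alpha> c] chart(2)[OF c] y]] cpd_coord_inv[OF c y]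
    by (simp_all add: x_def)
  show "fps_nth (fps_pderiv_at (Inr p) (symbol c \<alpha>) w) k = fibre_deriv p k (\<alpha> k c x) (fibre w)"
    "fps_nth (fps_pderiv_at (Inl q) (symbol c \<alpha>) w) k = fibre_poly k (\<lambda>is. cpd c q (\<lambda>z. \<alpha> k c z is) x) (fibre w)"
    using *[of "Inr p"] *[of "Inl q"] base
    by (simp_all add: symbol_nth pderiv_at_fibre x_def if_distrib[of "\<lambda>x. x * _"] cong: if_cong)
qed

text \<open>The horizontal derivative of the symbol, which is the symbol of the covariant derivative.\<close>

definition nabla_symbol where
  "nabla_symbol c w \<alpha> q = fps_pderiv_at (Inl q) (symbol c \<alpha>) w
    - (\<Sum>*r. fps_const (\<Sum>*j. \<Gamma> c (coord_inv c (base w)) q j r * fibre w $ j) * fps_pderiv_at (Inr r) (symbol c \<alpha>) w)"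

lemma nabla_symbol_nth:
  assumes "c \<in> A" "\<alpha> \<in> Shat A" "w \<in> base -` chart_image c"
  shows "fps_nth (nabla_symbol c w \<alpha> q) k = fibre_poly k (nabla \<Gamma> (\<alpha> k) c (coord_inv c (base w)) q) (fibre w)"
  using fibre_poly_nabla[of "\<alpha> k" c "coord_inv c (base w)", OF Shat_symmetric[OF assms(2)]]
  by (simp add: nabla_symbol_def fibre_derivative_symbol_nth[OF assms] base_derivative_symbol_nth[OF assms]
    fps_sum_nth sum_distrib_right del: fps_pderiv_at_nth) (rule sum.swap)

context
  fixes c w \<alpha> \<beta>
  assumes c: "c \<in> A" and w: "w \<in> base -` chart_image c" and \<alpha>: "\<alpha> \<in> Shat A" and \<beta>: "\<beta> \<in> Shat A"
begin

text \<open>Derivatives in fibre directions are taken coefficientwise and so do not lower the exponent of \<open>X\<close>, whereas the algebraic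
  bracket lowers the degree by two; this is the reason for the factor \<open>X\<^sup>2\<close>.\<close>

lemma symbol_alg_bracket:
  "fps_X ^ 2 * symbol c (alg_bracket \<Omega> \<alpha> \<beta>) w = (\<Sum>*p q. fps_const (U c (base w) p q)
    * (fps_pderiv_at (Inr p) (symbol c \<alpha>) w * fps_pderiv_at (Inr q) (symbol c \<beta>) w))" (is "_ = ?R")
proof (rule fps_ext)
  fix n
  let ?x = "coord_inv c (base w)" and ?v = "fibre w"
  let ?t = "\<lambda>n k p q. Omega_up \<Omega> c ?x p q * fibre_deriv p k (\<alpha> k c ?x) ?v * fibre_deriv q (n - k) (\<beta> (n - k) c ?x) ?v"
  define h where "h n k = (\<Sum>*p q. ?t n k p q)" for n k
  have rhs: "fps_nth ?R n = (\<Sum>k\<le>n. h n k)"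
  proof -
    have "fps_nth ?R n
      = (\<Sum>*p q. \<Sum>k\<le>n. ?t n k p q)"
      unfolding fps_sum_nth fps_mult_left_const_nth
      by (simp add: fps_mult_nth fibre_derivative_symbol_nth[OF c _ w] \<alpha> \<beta> poisson_coefficients_def
        sum_distrib_left mult.assoc atLeast0AtMost del: fps_pderiv_at_nth)
    also have "\<dots> = (\<Sum>*p. \<Sum>k\<le>n. \<Sum>*q. ?t n k p q)"
      by (intro sum.cong refl sum.swap)
    also have "\<dots> = (\<Sum>k\<le>n. h n k)"
      unfolding h_def by (rule sum.swap)
    finally show ?thesis .
  qed
  show "fps_nth (fps_X ^ 2 * symbol c (alg_bracket \<Omega> \<alpha> \<beta>) w) n = fps_nth ?R n"
  proof (cases "n < 2")
    case True
    then have "h n k = 0" if "k \<le> n" for k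
      using that by (cases "k = 0") (auto simp: h_def fibre_deriv_def less_2_cases_iff)
    with True show ?thesis
      by (simp add: rhs fps_X_power_mult_nth)
  next
    case False
    then obtain m where n: "n = m + 2"
      by (metis add.commute le_Suc_ex not_less)
    have "fibre_poly m (alg_bracket \<Omega> \<alpha> \<beta> m c ?x) ?v = (\<Sum>k\<le>n. h n k)"
      unfolding alg_bracket_def sum_fun_apply [abs_def] fibre_poly_sum n h_def
      by (intro sum.cong refl fibre_poly_alg_bracket_hom Shat_symmetric[OF \<alpha>] Shat_symmetric[OF \<beta>]) simp
    then show ?thesis
      by (simp add: rhs) (simp add: n fps_X_power_mult_nth symbol_nth)
  qed
qed

lemma symbol_schouten_nabla:
  "fps_X ^ 2 * symbol c (schouten \<Omega> \<Gamma> \<alpha> \<beta>) w = fps_X * (\<Sum>*p q. fps_const (U c (base w) p q)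
    * (nabla_symbol c w \<alpha> q * fps_pderiv_at (Inr p) (symbol c \<beta>) w - fps_pderiv_at (Inr p) (symbol c \<alpha>) w * nabla_symbol c w \<beta> q))"
    (is "_ = fps_X * ?R")
proof -
  let ?x = "coord_inv c (base w)" and ?v = "fibre w"
  let ?t = "\<lambda>n k p q. Omega_up \<Omega> c ?x p q * (fibre_poly k (nabla \<Gamma> (\<alpha> k) c ?x q) ?v * fibre_deriv p (n - k) (\<beta> (n - k) c ?x) ?v
      - fibre_deriv p k (\<alpha> k c ?x) ?v * fibre_poly (n - k) (nabla \<Gamma> (\<beta> (n - k)) c ?x q) ?v)"
  define h where "h n k = (\<Sum>*p q. ?t n k p q)" for n k
  have rhs: "fps_nth ?R n = (\<Sum>k\<le>n. h n k)" for n
  proof -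
    have "fps_nth ?R n
      = (\<Sum>*p q. \<Sum>k\<le>n. ?t n k p q)"
      unfolding fps_sum_nth fps_mult_left_const_nth
      by (simp add: fps_mult_nth fibre_derivative_symbol_nth[OF c _ w] nabla_symbol_nth[OF c _ w] \<alpha> \<beta> poisson_coefficients_def
        sum_distrib_left atLeast0AtMost sum_subtractf right_diff_distrib del: fps_pderiv_at_nth)
    also have "\<dots> = (\<Sum>*p. \<Sum>k\<le>n. \<Sum>*q. ?t n k p q)"
      by (intro sum.cong refl sum.swap)
    also have "\<dots> = (\<Sum>k\<le>n. h n k)"
      unfolding h_def by (rule sum.swap)
    finally show ?thesis .
  qed
  have "fps_nth (fps_X * symbol c (schouten \<Omega> \<Gamma> \<alpha> \<beta>) w) n = fps_nth ?R n" for n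
  proof (cases n)
    case 0
    then show ?thesis
      by (simp add: rhs) (simp add: h_def fibre_deriv_def)
  next
    case (Suc m)
    have "fibre_poly m (schouten \<Omega> \<Gamma> \<alpha> \<beta> m c ?x) ?v = (\<Sum>k\<le>n. h n k)"
      unfolding schouten_def sum_fun_apply [abs_def] fibre_poly_sum Suc h_def Suc_eq_plus1
      by (intro sum.cong refl fibre_poly_schouten_hom) simp
    then show ?thesis
      by (simp add: rhs) (simp add: Suc symbol_nth)
  qed
  then have "fps_X * symbol c (schouten \<Omega> \<Gamma> \<alpha> \<beta>) w = ?R"
    by (rule fps_ext)
  then show ?thesis
    by (simp add: power2_eq_square mult.assoc)
qed

text \<open>The Christoffel symbols disappear. Together they contribute
  \<open>\<Omega>\<^bsup>pq\<^esup> \<Gamma>\<^bsub>qj\<^esub>\<^sup>r v\<^sup>j - \<Omega>\<^bsup>rq\<^esup> \<Gamma>\<^bsub>qj\<^esub>\<^sup>p v\<^sup>j\<close>, which is \<open>- v\<^sup>j \<partial>\<^sub>j \<Omega>\<^bsup>pr\<^esup>\<close> since the connection is torsion-free and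
  \<open>\<Omega>\<close> parallel.\<close>

lemma symbol_schouten:
  defines "f \<equiv> symbol c \<alpha>" and "g \<equiv> symbol c \<beta>"
  shows "fps_X ^ 2 * symbol c (schouten \<Omega> \<Gamma> \<alpha> \<beta>) w
    = fps_X * (\<Sum>*p q. fps_const (U c (base w) p q)
        * (fps_pderiv_at (Inl q) f w * fps_pderiv_at (Inr p) g w - fps_pderiv_at (Inr p) f w * fps_pderiv_at (Inl q) g w))
      - fps_X * (\<Sum>*p r. fps_const (complete_lift (U c) w (Inr p) (Inr r))
        * (fps_pderiv_at (Inr p) f w * fps_pderiv_at (Inr r) g w))"
proof -
  let ?x = "coord_inv c (base w)"
  have y: "base w \<in> chart_image c"
    using w by simp
  define u where "u p q = U c (base w) p q" for p q
  define M where "M q r = (\<Sum>*j. \<Gamma> c ?x q j r * fibre w $ j)" for q r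
  define L where "L p r = complete_lift (U c) w (Inr p) (Inr r)" for p r
  have L: "(\<Sum>*q. u p q * M q r - u r q * M q p) = - L p r" for p r
  proof -
    let ?t = "\<lambda>j q. u p q * (\<Gamma> c ?x j q r * fibre w $ j) + u q r * (\<Gamma> c ?x j q p * fibre w $ j)"
    have "L p r = - (\<Sum>*j q. ?t j q)"
      by (simp add: L_def pderiv_at_poisson_coefficients[OF c y] u_def right_diff_distrib sum_distrib_left
        sum.distrib sum_negf sum_subtractf ac_simps)
    also have "(\<Sum>*j q. ?t j q)
      = (\<Sum>*q j. ?t j q)"
      by (rule sum.swap)
    also have "\<dots> = (\<Sum>*q j. u p q * (\<Gamma> c ?x q j r * fibre w $ j) - u r q * (\<Gamma> c ?x q j p * fibre w $ j))"
    proof (intro sum.cong refl)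
      fix q j
      have "u q r = - u r q"
        unfolding u_def by (rule antisym_poisson_coefficients[OF c y])
      then show "u p q * (\<Gamma> c ?x j q r * fibre w $ j) + u q r * (\<Gamma> c ?x j q p * fibre w $ j)
        = u p q * (\<Gamma> c ?x q j r * fibre w $ j) - u r q * (\<Gamma> c ?x q j p * fibre w $ j)"
        using Christoffel_symmetric[OF c coord_inv_in[OF c y], of j q] by simp
    qed
    also have "\<dots> = (\<Sum>*q. u p q * M q r - u r q * M q p)"
      by (simp add: M_def sum_distrib_left sum_subtractf)
    finally show ?thesis
      by simp
  qed
  define fx fv gx gv where "fx q = fps_pderiv_at (Inl q) f w" and "fv p = fps_pderiv_at (Inr p) f w"
    and "gx q = fps_pderiv_at (Inl q) g w" and "gv p = fps_pderiv_at (Inr p) g w" for p q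
  have "(\<Sum>*p q. fps_const (u p q) * (nabla_symbol c w \<alpha> q * gv p - fv p * nabla_symbol c w \<beta> q))
    = (\<Sum>*p q. fps_const (u p q) * (fx q * gv p - fv p * gx q))
      - ((\<Sum>*p q r. fps_const (u p q * M q r) * (fv r * gv p))
        - (\<Sum>*p q r. fps_const (u p q * M q r) * (fv p * gv r)))"
  proof -
    have "fps_const (u p q) * (nabla_symbol c w \<alpha> q * gv p - fv p * nabla_symbol c w \<beta> q)
      = fps_const (u p q) * (fx q * gv p - fv p * gx q) - ((\<Sum>*r. fps_const (u p q * M q r) * (fv r * gv p))
        - (\<Sum>*r. fps_const (u p q * M q r) * (fv p * gv r)))" for p q
    proof -
      have "(\<Sum>*r. fps_const (u p q * M q r) * (fv r * gv p)) = fps_const (u p q) * ((\<Sum>*r. fps_const (M q r) * fv r) * gv p)"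
        "(\<Sum>*r. fps_const (u p q * M q r) * (fv p * gv r)) = fps_const (u p q) * (fv p * (\<Sum>*r. fps_const (M q r) * gv r))"
        unfolding sum_distrib_left sum_distrib_right fps_const_mult[symmetric] by (simp_all only: ac_simps)
      then show ?thesis
        unfolding nabla_symbol_def fx_def fv_def gx_def gv_def f_def g_def M_def by (simp add: algebra_simps)
    qed
    then show ?thesis
      by (simp only: sum_subtractf)
  qed
  also have "(\<Sum>*p q r. fps_const (u p q * M q r) * (fv r * gv p))
    = (\<Sum>*p r q. fps_const (u p q * M q r) * (fv r * gv p))"
    by (intro sum.cong refl sum.swap)
  also have "\<dots> = (\<Sum>*r p q. fps_const (u p q * M q r) * (fv r * gv p))"
    by (rule sum.swap)
  also have "(\<Sum>*p q r. fps_const (u p q * M q r) * (fv p * gv r))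
    = (\<Sum>*p r q. fps_const (u p q * M q r) * (fv p * gv r))"
    by (intro sum.cong refl sum.swap)
  also have "(\<Sum>*p r q. fps_const (u r q * M q p) * (fv p * gv r))
      - (\<Sum>*p r q. fps_const (u p q * M q r) * (fv p * gv r))
    = (\<Sum>*p r. fps_const (L p r) * (fv p * gv r))"
  proof -
    have "(\<Sum>*q. fps_const (u r q * M q p) * (fv p * gv r)) - (\<Sum>*q. fps_const (u p q * M q r) * (fv p * gv r))
      = - (fps_const (\<Sum>*q. u p q * M q r - u r q * M q p) * (fv p * gv r))" for p r
      by (simp add: sum_subtractf left_diff_distrib sum_distrib_right flip: fps_const_sum fps_const_sub)
    then show ?thesis
      unfolding sum_subtractf[symmetric] L by (simp flip: fps_const_neg)
  qed
  finally show ?thesis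
    unfolding symbol_schouten_nabla u_def fx_def fv_def gx_def gv_def L_def f_def g_def by (simp only: right_diff_distrib)
qed

lemma symbol_full_bracket_expand:
  defines "u \<equiv> U c (base w)"
    and "fx \<equiv> \<lambda>p. fps_pderiv_at (Inl p) (symbol c \<alpha>) w" and "fv \<equiv> \<lambda>p. fps_pderiv_at (Inr p) (symbol c \<alpha>) w"
    and "gx \<equiv> \<lambda>p. fps_pderiv_at (Inl p) (symbol c \<beta>) w" and "gv \<equiv> \<lambda>p. fps_pderiv_at (Inr p) (symbol c \<beta>) w"
  shows "fps_X ^ 2 * symbol c (full_bracket \<Omega> \<Gamma> \<alpha> \<beta>) w = (\<Sum>*p q. fps_const (u p q) * (fv p * gv q))
    + fps_X * (\<Sum>*p q. fps_const (u p q) * (fx q * gv p - fv p * gx q))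
    - fps_X * (\<Sum>*p q. fps_const (complete_lift (U c) w (Inr p) (Inr q)) * (fv p * gv q))"
  unfolding full_bracket_def symbol_add distrib_left symbol_alg_bracket symbol_schouten
    u_def fx_def fv_def gx_def gv_def by simp

theorem symbol_full_bracket:
  "fps_X ^ 2 * symbol c (full_bracket \<Omega> \<Gamma> \<alpha> \<beta>) w
    = poisson_bracket (lifted_bivector (U c)) (symbol c \<alpha>) (symbol c \<beta>) w"
proof -
  define u where "u p q = U c (base w) p q" for p q
  define fx fv gx gv where "fx q = fps_pderiv_at (Inl q) (symbol c \<alpha>) w" and "fv p = fps_pderiv_at (Inr p) (symbol c \<alpha>) w"
    and "gx q = fps_pderiv_at (Inl q) (symbol c \<beta>) w" and "gv p = fps_pderiv_at (Inr p) (symbol c \<beta>) w" for p q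
  define L where "L p r = complete_lift (U c) w (Inr p) (Inr r)" for p r
  have anti: "u p q = - u q p" for p q
    unfolding u_def using w by (intro antisym_poisson_coefficients[OF c]) simp
  have anti': "fps_const (u p q) = - fps_const (u q p)" for p q
    using anti[of p q] by (simp flip: fps_const_neg)
  note swap = sum_antisymmetric[OF anti', where t = "\<lambda>p q. fx p * gv q"]
  have "poisson_bracket (lifted_bivector (U c)) (symbol c \<alpha>) (symbol c \<beta>) w
    = (\<Sum>*p q. - (fps_X * (fps_const (u p q) * (fx p * gv q))))
    + ((\<Sum>*p q. - (fps_X * (fps_const (u p q) * (fv p * gx q))))
    + ((\<Sum>*p q. fps_const (u p q) * (fv p * gv q)) - (\<Sum>*p q. fps_X * (fps_const (L p q) * (fv p * gv q)))))"
    unfolding poisson_bracket_def sum_UNIV_sum_type lifted_bivector_def u_def L_def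
      fx_def[symmetric] fv_def[symmetric] gx_def[symmetric] gv_def[symmetric] sum.distrib
    by (simp add: left_diff_distrib sum_subtractf mult.assoc del: complete_lift.simps(4))
  also have "\<dots> = (\<Sum>*p q. fps_const (u p q) * (fv p * gv q))
    + (fps_X * (\<Sum>*p q. fps_const (u p q) * (fx q * gv p - fv p * gx q))
      - fps_X * (\<Sum>*p q. fps_const (L p q) * (fv p * gv q)))"
    unfolding sum_negf sum_distrib_left[symmetric] right_diff_distrib sum_subtractf swap by simp
  also have "\<dots> = fps_X ^ 2 * symbol c (full_bracket \<Omega> \<Gamma> \<alpha> \<beta>) w"
    unfolding symbol_full_bracket_expand u_def fx_def fv_def gx_def gv_def L_def by simp
  finally show ?thesis ..
qed

end

lemma graded_symmetric_full_bracket: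
  "graded_symmetric A \<alpha> \<Longrightarrow> graded_symmetric A \<beta> \<Longrightarrow> graded_symmetric A (full_bracket \<Omega> \<Gamma> \<alpha> \<beta>)"
  unfolding full_bracket_def by (intro graded_symmetric_add graded_symmetric_alg_bracket graded_symmetric_schouten)

lemma smooth_Omega_up: "c \<in> A \<Longrightarrow> smooth_on (chart_image c) (\<lambda>y. Omega_up \<Omega> c (coord_inv c y) p q)"
  using smooth_poisson_coefficients by (simp add: poisson_coefficients_def)

lemma smooth_on_nabla:
  assumes c: "c \<in> A" and T: "\<And>is. smooth_on (chart_image c) (\<lambda>y. T c (coord_inv c y) is)"
  shows "smooth_on (chart_image c) (\<lambda>y. nabla \<Gamma> T c (coord_inv c y) q is)"
proof -
  have "smooth_on (chart_image c) (\<lambda>y. pderiv_at q (\<lambda>y. T c (coord_inv c y) is) y)"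
    using smooth_on_pderiv_at[OF T] by simp
  then have "smooth_on (chart_image c) (\<lambda>y. cpd c q (\<lambda>z. T c z is) (coord_inv c y))"
    using smooth_on_cong[OF chart(2)[OF c], of "\<lambda>y. cpd c q (\<lambda>z. T c z is) (coord_inv c y)" "\<lambda>y. pderiv_at q (\<lambda>y. T c (coord_inv c y) is) y"]
      cpd_coord_inv[OF c] by simp
  then show ?thesis
    unfolding nabla_def using T smooth_Christoffel[OF c] chart(2)[OF c]
    by (intro smooth_on_diff smooth_on_sum smooth_on_mult)
qed

lemma smooth_on_symmetrize:
  assumes "open V" "\<And>is. smooth_on V (\<lambda>y. t y is)"
  shows "smooth_on V (\<lambda>y. symmetrize (t y) is)"
  unfolding symmetrize_def divide_inverse using assms by (intro smooth_on_mult smooth_on_sum smooth_on_const)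

lemma smooth_on_full_bracket:
  assumes c: "c \<in> A" and "\<alpha> \<in> Shat A" "\<beta> \<in> Shat A"
  shows "smooth_on (chart_image c) (\<lambda>y. full_bracket \<Omega> \<Gamma> \<alpha> \<beta> m c (coord_inv c y) is)"
proof -
  note sm = Shat_smooth[OF assms(2) c] Shat_smooth[OF assms(3) c]
  note rules = smooth_on_add smooth_on_sum smooth_on_symmetrize smooth_on_mult smooth_on_const smooth_Omega_up[OF c]
    smooth_on_nabla[OF c] chart(2)[OF c] sm
  have "smooth_on (chart_image c) (\<lambda>y. alg_bracket \<Omega> \<alpha> \<beta> m c (coord_inv c y) is)"
    unfolding alg_bracket_def alg_bracket_hom_def sum_fun_apply by (intro rules)
  moreover have "smooth_on (chart_image c) (\<lambda>y. schouten \<Omega> \<Gamma> \<alpha> \<beta> m c (coord_inv c y) is)"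
    unfolding schouten_def schouten_hom_def sum_fun_apply by (intro rules)
  ultimately show ?thesis
    unfolding full_bracket_def plus_fun_def by (intro smooth_on_add chart(2)[OF c])
qed

end

section \<open>Changes of coordinates\<close>

lemma symmetric_components_transform:
  fixes t :: "'n::finite list \<Rightarrow> real" and J :: "'n \<Rightarrow> 'n \<Rightarrow> real"
  assumes "symmetric_components t"
  shows "symmetric_components (\<lambda>js. if length js = k then \<Sum>is | length is = k. t is * (\<Prod>m<k. J (is ! m) (js ! m)) else 0)"
  unfolding symmetric_components_iff_permute_list
proof (intro allI impI)
  fix js :: "'n list" and \<sigma> assume "\<sigma> permutes {..<length js}"
  moreover have "(\<Sum>is | length is = k. t is * (\<Prod>m<k. J (is ! m) (permute_list \<sigma> js ! m)))
      = (\<Sum>is | length is = k. t is * (\<Prod>m<k. J (is ! m) (js ! m)))"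
    if "\<sigma> permutes {..<k}" "length js = k"
  proof -
    have "(\<Sum>is | length is = k. t is * (\<Prod>m<k. J (is ! m) (permute_list \<sigma> js ! m)))
      = (\<Sum>is | length is = k. t (permute_list \<sigma> is) * (\<Prod>m<k. J (permute_list \<sigma> is ! m) (permute_list \<sigma> js ! m)))"
      by (rule sum_permute_list[OF that(1), symmetric])
    also have "\<dots> = (\<Sum>is | length is = k. t is * (\<Prod>m<k. J (is ! m) (js ! m)))"
    proof (intro sum.cong refl arg_cong2[where f = "(*)"])
      fix "is" assume "is \<in> {is :: 'n list. length is = k}"
      then have k: "length is = k"
        by simp
      show "t (permute_list \<sigma> is) = t is"
        using k that by (intro symmetric_componentsD[OF assms]) simp
      have "(\<Prod>m<k. J (permute_list \<sigma> is ! m) (permute_list \<sigma> js ! m)) = (\<Prod>m<k. J (is ! \<sigma> m) (js ! \<sigma> m))"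
        using k that by (intro prod.cong refl) (simp add: permute_list_nth)
      also have "\<dots> = (\<Prod>m<k. J (is ! m) (js ! m))"
        using prod.permute[OF that(1), of "\<lambda>m. J (is ! m) (js ! m)"] by (simp add: comp_def)
      finally show "(\<Prod>m<k. J (permute_list \<sigma> is ! m) (permute_list \<sigma> js ! m)) = (\<Prod>m<k. J (is ! m) (js ! m))" .
    qed
    finally show ?thesis .
  qed
  ultimately show "(if length (permute_list \<sigma> js) = k then \<Sum>is | length is = k. t is * (\<Prod>m<k. J (is ! m) (permute_list \<sigma> js ! m)) else 0)
    = (if length js = k then \<Sum>is | length is = k. t is * (\<Prod>m<k. J (is ! m) (js ! m)) else 0)"
    by auto
qed

lemma poisson_bracket_cong:
  assumes "open V" "w \<in> V" "\<And>z. z \<in> V \<Longrightarrow> F z = F' z" "\<And>z. z \<in> V \<Longrightarrow> G z = G' z"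
  shows "poisson_bracket P F G w = poisson_bracket P F' G' w"
  unfolding poisson_bracket_def using fps_pderiv_at_cong[OF assms(1,2,3)] fps_pderiv_at_cong[OF assms(1,2,4)] by simp

definition tangent_map :: "(real^'n \<Rightarrow> real^'n) \<Rightarrow> real^('n + 'n) \<Rightarrow> real^('n + 'n)" where
  "tangent_map \<phi> w = (\<chi> A. case A of Inl a \<Rightarrow> \<phi> (base w) $ a
    | Inr a \<Rightarrow> \<Sum>*i. pderiv_at i (\<lambda>y. \<phi> y $ a) (base w) * fibre w $ i)"

lemma base_tangent_map: "base (tangent_map \<phi> w) = \<phi> (base w)"
  by (simp add: base_def tangent_map_def)

lemma fibre_tangent_map: "fibre (tangent_map \<phi> w) = (\<chi> a. \<Sum>*i. pderiv_at i (\<lambda>y. \<phi> y $ a) (base w) * fibre w $ i)"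
  by (simp add: fibre_def tangent_map_def)

text \<open>A smooth map, such as a change of coordinates, which relates two Poisson tensors.\<close>

locale poisson_map = source: poisson_coordinates V U + target: poisson_coordinates V' U'
  for V U V' U' and \<phi> :: "real^'n \<Rightarrow> real^'n" +
  assumes smooth_\<phi>: "\<And>a. smooth_on V (\<lambda>y. \<phi> y $ a)"
    and maps_to: "\<And>y. y \<in> V \<Longrightarrow> \<phi> y \<in> V'"
    and preserves: "\<And>y a b. y \<in> V \<Longrightarrow> U' (\<phi> y) a b
      = (\<Sum>*p q. U y p q * pderiv_at p (\<lambda>y. \<phi> y $ a) y * pderiv_at q (\<lambda>y. \<phi> y $ b) y)"
begin

abbreviation J where "J a i \<equiv> pderiv_at i (\<lambda>y. \<phi> y $ a)"

lemma smooth_J: "smooth_on V (J a i)"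
  by (rule smooth_on_pderiv_at[OF smooth_\<phi>])

lemma smooth_tangent_map: "smooth_on (base -` V) (\<lambda>w. tangent_map \<phi> w $ A)"
  using smooth_on_base[OF smooth_\<phi> source.open_V] smooth_on_base[OF smooth_J source.open_V]
  by (cases A) (auto simp: tangent_map_def intro!: smooth_on_sum smooth_on_mult smooth_on_fibre source.open_phase)

lemma pderiv_at_tangent_map:
  assumes "w \<in> base -` V"
  shows "pderiv_at (Inl i) (\<lambda>w. tangent_map \<phi> w $ Inl a) w = J a i (base w)"
    and "pderiv_at (Inr i) (\<lambda>w. tangent_map \<phi> w $ Inl a) w = 0"
    and "pderiv_at (Inl i) (\<lambda>w. tangent_map \<phi> w $ Inr a) w = (\<Sum>*k. fibre w $ k * pderiv_at k (J a i) (base w))"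
    and "pderiv_at (Inr i) (\<lambda>w. tangent_map \<phi> w $ Inr a) w = J a i (base w)"
proof -
  have y: "base w \<in> V"
    using assms by simp
  have d: "(\<lambda>y. \<phi> y $ a) differentiable at (base w)" "J a k differentiable at (base w)" for k
    using smooth_on_differentiable[OF _ source.open_V y] smooth_\<phi> smooth_J by auto
  have d': "(\<lambda>w. J a k (base w)) differentiable at w" "(\<lambda>w. fibre w $ k) differentiable at w" for k
    using smooth_on_differentiable[OF smooth_on_base[OF smooth_J source.open_V] source.open_phase assms]
      smooth_on_differentiable[OF smooth_on_fibre[OF source.open_phase] source.open_phase assms] by auto
  show "pderiv_at (Inl i) (\<lambda>w. tangent_map \<phi> w $ Inl a) w = J a i (base w)"
    "pderiv_at (Inr i) (\<lambda>w. tangent_map \<phi> w $ Inl a) w = 0"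
    by (simp_all add: tangent_map_def pderiv_at_base[where f = "\<lambda>y. \<phi> y $ a", OF d(1)])
  show "pderiv_at (Inl i) (\<lambda>w. tangent_map \<phi> w $ Inr a) w = (\<Sum>*k. fibre w $ k * pderiv_at k (J a i) (base w))"
    "pderiv_at (Inr i) (\<lambda>w. tangent_map \<phi> w $ Inr a) w = J a i (base w)"
    using d d' pderiv_at_commute[OF smooth_\<phi> source.open_V y]
    by (simp_all add: tangent_map_def pderiv_at_sum pderiv_at_mult pderiv_at_fibre pderiv_at_base
      if_distrib[of "\<lambda>x. _ * x"] mult.commute[of "if _ then _ else _"] mult.commute[of "fibre w $ _"] cong: if_cong)
qed

lemma vertical_lift_tangent_map:
  assumes w: "w \<in> base -` V"
  shows "vertical_lift U' (tangent_map \<phi> w) B C = (\<Sum>*A A'. vertical_lift U w A A'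
    * pderiv_at A (\<lambda>w. tangent_map \<phi> w $ B) w * pderiv_at A' (\<lambda>w. tangent_map \<phi> w $ C) w)"
  using w preserves[of "base w"]
  by (cases B; cases C) (simp_all add: sum_UNIV_sum_type pderiv_at_tangent_map[OF w] base_tangent_map)

text \<open>In the fibre directions this is the derivative of the relation between \<open>U\<close> and \<open>U'\<close> along the tangent vector,
  together with the symmetry of the second derivatives of \<open>\<phi>\<close>.\<close>

lemma complete_lift_tangent_map:
  assumes w: "w \<in> base -` V"
  shows "complete_lift U' (tangent_map \<phi> w) B C = (\<Sum>*A A'. complete_lift U w A A'
    * pderiv_at A (\<lambda>w. tangent_map \<phi> w $ B) w * pderiv_at A' (\<lambda>w. tangent_map \<phi> w $ C) w)"
proof -
  let ?y = "base w" and ?v = "fibre w"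
  have y: "?y \<in> V"
    using w by simp
  have vv: "complete_lift U' (tangent_map \<phi> w) (Inr a) (Inr b)
    = (\<Sum>*p q. U ?y p q * (\<Sum>*k. ?v $ k * pderiv_at k (J a p) ?y) * J b q ?y)
    + (\<Sum>*p q. U ?y p q * J a p ?y * (\<Sum>*k. ?v $ k * pderiv_at k (J b q) ?y))
    + (\<Sum>*p q. (\<Sum>*k. ?v $ k * pderiv_at k (\<lambda>y. U y p q) ?y) * J a p ?y * J b q ?y)" for a b
  proof -
    let ?t = "\<lambda>k p q. ?v $ k * (pderiv_at k (\<lambda>y. U y p q) ?y * J a p ?y * J b q ?y
        + U ?y p q * pderiv_at k (J a p) ?y * J b q ?y + U ?y p q * J a p ?y * pderiv_at k (J b q) ?y)"
    have dU': "(\<lambda>y. U' y a b) differentiable at (\<phi> ?y)"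
      by (rule smooth_on_differentiable[OF target.smooth_U target.open_V maps_to[OF y]])
    have d: "(\<lambda>y. \<phi> y $ a) differentiable at ?y" "J a i differentiable at ?y" "(\<lambda>y. U y p q) differentiable at ?y" for a i p q
      using smooth_on_differentiable[OF _ source.open_V y] smooth_\<phi> smooth_J source.smooth_U by auto
    have "complete_lift U' (tangent_map \<phi> w) (Inr a) (Inr b)
      = (\<Sum>*e k. ?v $ k * (pderiv_at e (\<lambda>y. U' y a b) (\<phi> ?y) * J e k ?y))"
      by (simp add: base_tangent_map fibre_tangent_map sum_distrib_left sum_distrib_right ac_simps)
    also have "\<dots> = (\<Sum>*k e. ?v $ k * (pderiv_at e (\<lambda>y. U' y a b) (\<phi> ?y) * J e k ?y))"
      by (rule sum.swap)
    also have "\<dots> = (\<Sum>*k. ?v $ k * pderiv_at k (\<lambda>y. U' (\<phi> y) a b) ?y)"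
      using pderiv_at_chain[of "\<lambda>y. U' y a b" \<phi>, OF dU' d(1)] by (simp add: sum_distrib_left)
    also have "\<dots> = (\<Sum>*k. ?v $ k * pderiv_at k (\<lambda>y. \<Sum>*p q. U y p q * J a p y * J b q y) ?y)"
      using pderiv_at_cong[OF source.open_V y preserves] by simp
    also have "\<dots> = (\<Sum>*k p q. ?t k p q)"
      using d by (simp add: pderiv_at_sum pderiv_at_mult differentiable_sum differentiable_mult sum_distrib_left distrib_right)
    also have "\<dots> = (\<Sum>*p k q. ?t k p q)"
      by (rule sum.swap)
    also have "\<dots> = (\<Sum>*p q k. ?t k p q)"
      by (intro sum.cong refl sum.swap)
    finally show ?thesis
      by (simp add: sum_distrib_left sum_distrib_right distrib_left sum.distrib ac_simps)
  qed
  show ?thesis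
  proof (cases B)
    case B: (Inl a)
    show ?thesis
      using preserves[OF y] by (cases C) (simp_all add: B sum_UNIV_sum_type pderiv_at_tangent_map[OF w] base_tangent_map)
  next
    case B: (Inr a)
    show ?thesis
    proof (cases C)
      case (Inl b)
      then show ?thesis
        using preserves[OF y] by (simp add: B sum_UNIV_sum_type pderiv_at_tangent_map[OF w] base_tangent_map)
    next
      case (Inr b)
      show ?thesis
        unfolding B Inr vv by (simp add: sum_UNIV_sum_type pderiv_at_tangent_map[OF w] sum.distrib)
    qed
  qed
qed

lemma poisson_bracket_tangent_map:
  assumes w: "w \<in> base -` V" and FG: "fps_smooth_on (base -` V') F" "fps_smooth_on (base -` V') G"
  shows "poisson_bracket (lifted_bivector U) (\<lambda>w. F (tangent_map \<phi> w)) (\<lambda>w. G (tangent_map \<phi> w)) w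
    = poisson_bracket (lifted_bivector U') F G (tangent_map \<phi> w)"
proof (rule poisson_bracket_pullback[OF target.open_phase _ _ FG])
  show "tangent_map \<phi> w \<in> base -` V'"
    using w maps_to by (simp add: base_tangent_map)
  show "(\<lambda>w. tangent_map \<phi> w $ B) differentiable at w" for B
    by (rule smooth_on_differentiable[OF smooth_tangent_map source.open_phase w])
  fix B C
  let ?D = "\<lambda>A B. pderiv_at A (\<lambda>w. tangent_map \<phi> w $ B) w"
  have "(\<Sum>*A A'. lifted_bivector U w A A' * fps_const (?D A B) * fps_const (?D A' C))
    = (\<Sum>*A A'. fps_const (vertical_lift U w A A' * ?D A B * ?D A' C)
      - fps_X * fps_const (complete_lift U w A A' * ?D A B * ?D A' C))"
    by (simp add: lifted_bivector_def left_diff_distrib mult.assoc)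
  also have "\<dots> = lifted_bivector U' (tangent_map \<phi> w) B C"
    unfolding lifted_bivector_def vertical_lift_tangent_map[OF w] complete_lift_tangent_map[OF w]
    by (simp add: sum_subtractf sum_distrib_left[symmetric] fps_const_sum)
  finally show "lifted_bivector U' (tangent_map \<phi> w) B C
    = (\<Sum>*A A'. lifted_bivector U w A A' * fps_const (?D A B) * fps_const (?D A' C))" ..
qed

end

context symplectic_connection_manifold
begin

context
  fixes c d assumes c: "c \<in> A" and d: "d \<in> A"
begin

definition transition where "transition y = coord c (coord_inv d y)"

definition overlap where "overlap = coord d ` (cdom c \<inter> cdom d)"

lemma overlap_subset: "overlap \<subseteq> chart_image d"
  by (auto simp: overlap_def chart_image_def)

lemma overlap_iff: "y \<in> overlap \<longleftrightarrow> y \<in> chart_image d \<and> coord_inv d y \<in> cdom c"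
  using coord_coord_inv[OF d] coord_inv_in[OF d] coord_inv_coord[OF d] unfolding overlap_def chart_image_def by force

lemma open_overlap: "open overlap"
proof -
  have "overlap = chart_image d \<inter> coord_inv d -` cdom c"
    using overlap_iff by blast
  moreover have "continuous_on (chart_image d) (coord_inv d)"
    using chart(3)[OF d] by (simp add: homeomorphism_def)
  ultimately show ?thesis
    using chart(2)[OF d] chart(1)[OF c] by (simp add: continuous_open_preimage)
qed

lemma coord_inv_transition: "y \<in> overlap \<Longrightarrow> coord_inv c (transition y) = coord_inv d y"
  by (simp add: transition_def overlap_iff coord_inv_coord[OF c])

lemma transition_in: "y \<in> overlap \<Longrightarrow> transition y \<in> chart_image c"
  by (simp add: transition_def overlap_iff chart_image_def)

lemma smooth_transition: "smooth_on overlap (\<lambda>y. transition y $ a)"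
  using atlas c d unfolding smooth_atlas_def transition_def overlap_def by blast

lemma jac_eq_pderiv_at_transition:
  "y \<in> overlap \<Longrightarrow> jac c d (coord_inv d y) a i = pderiv_at i (\<lambda>y. transition y $ a) y"
  using cpd_coord_inv[OF d] overlap_subset unfolding jac_def transition_def by blast

text \<open>In matrix form, \<open>W' = J\<^sup>T W J\<close>. As \<open>W'\<close> is invertible, so is \<open>J\<close>, and the inverse matrices are related by
  \<open>N = J N' J\<^sup>T\<close>.\<close>

lemma Omega_up_transform:
  assumes x: "x \<in> cdom c \<inter> cdom d"
  shows "Omega_up \<Omega> c x a b = (\<Sum>*p q. Omega_up \<Omega> d x p q * jac c d x a p * jac c d x b q)"
proof -
  define J where "J = (\<chi> a i. jac c d x a i)"
  define W W' where "W = (\<chi> i j. \<Omega> c x [i, j])" and "W' = (\<chi> i j. \<Omega> d x [i, j])"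
  define N N' where "N = matrix_inv W" and "N' = matrix_inv W'"
  have inv: "W ** N = mat 1" "N' ** W' = mat 1"
    using matrix_inv_Omega[OF c, of x] matrix_inv_Omega[OF d, of x] x by (auto simp: W_def W'_def N_def N'_def)
  have "\<Omega> d x js = (\<Sum>is | length is = 2. \<Omega> c x is * (\<Prod>m<2. jac c d x (is ! m) (js ! m)))" if "length js = 2" for js
    using form c d x that unfolding symplectic_form_def tensor_field_def by blast
  then have "\<Omega> d x [i, j] = (\<Sum>*a b. \<Omega> c x [a, b] * (jac c d x a i * jac c d x b j))" for i j
    by (simp add: numeral_2_eq_2 sum_lists_length_Suc)
  then have "W' $ i $ j = (transpose J ** W ** J) $ i $ j" for i j
    unfolding matrix_matrix_mult_def
    by (simp add: W_def W'_def J_def transpose_def sum_distrib_right sum_distrib_left) (subst sum.swap, simp add: ac_simps)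
  then have W': "W' = transpose J ** W ** J"
    by (simp add: vec_eq_iff)
  have "(N' ** transpose J ** W) ** J = mat 1"
    using inv(2) by (simp add: W' matrix_mul_assoc)
  then have "J ** (N' ** transpose J ** W) = mat 1"
    by (simp add: matrix_left_right_inverse)
  then have "(J ** N' ** transpose J) ** (W ** N) = N"
    by (simp add: matrix_mul_assoc)
  then have "N $ a $ b = (J ** N' ** transpose J) $ a $ b"
    by (simp add: inv)
  also have "\<dots> = (\<Sum>*q p. N' $ p $ q * J $ a $ p * J $ b $ q)"
    by (simp add: matrix_matrix_mult_def transpose_def sum_distrib_left sum_distrib_right ac_simps)
  also have "\<dots> = (\<Sum>*p q. N' $ p $ q * J $ a $ p * J $ b $ q)"
    by (rule sum.swap)
  finally show ?thesis
    by (simp add: Omega_up_def N_def N'_def W_def W'_def J_def sum_negf)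
qed

lemma poisson_map_transition: "poisson_map overlap (U d) (chart_image c) (U c) transition"
proof -
  interpret cc: poisson_coordinates "chart_image c" "U c"
    by (rule poisson_coordinates[OF c])
  interpret dd: poisson_coordinates "chart_image d" "U d"
    by (rule poisson_coordinates[OF d])
  show ?thesis
  proof
    show "open overlap" "\<And>a. smooth_on overlap (\<lambda>y. transition y $ a)"
      by (rule open_overlap smooth_transition)+
    show "smooth_on overlap (\<lambda>y. U d y p q)" for p q
      by (rule smooth_on_subset[OF dd.smooth_U dd.open_V open_overlap overlap_subset])
    fix y p q r assume y: "y \<in> overlap"
    then have yd: "y \<in> chart_image d"
      using overlap_subset by blast
    show "transition y \<in> chart_image c"
      by (rule transition_in[OF y])
    show "U d y p q = - U d y q p"
      by (rule dd.antisym_U[OF yd])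
    show "(\<Sum>*s. U d y p s * pderiv_at s (\<lambda>y. U d y q r) y) + (\<Sum>*s. U d y q s * pderiv_at s (\<lambda>y. U d y r p) y)
      + (\<Sum>*s. U d y r s * pderiv_at s (\<lambda>y. U d y p q) y) = 0"
      by (rule dd.jacobi_U[OF yd])
    have "coord_inv d y \<in> cdom c \<inter> cdom d"
      using y coord_inv_in[OF d yd] by (simp add: overlap_iff)
    from Omega_up_transform[OF this]
    show "U c (transition y) p q = (\<Sum>*p' q'. U d y p' q' * pderiv_at p' (\<lambda>y. transition y $ p) y * pderiv_at q' (\<lambda>y. transition y $ q) y)"
      by (simp add: poisson_coefficients_def coord_inv_transition[OF y] jac_eq_pderiv_at_transition[OF y])
  qed
qed

lemma fibre_poly_transition:
  assumes "base w \<in> overlap"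
  shows "fibre_poly k t (fibre (tangent_map transition w))
    = fibre_poly k (\<lambda>js. \<Sum>is | length is = k. t is * (\<Prod>m<k. jac c d (coord_inv d (base w)) (is ! m) (js ! m))) (fibre w)"
  unfolding fibre_tangent_map jac_eq_pderiv_at_transition[OF assms]
  using fibre_poly_change_of_variables[of k t "\<lambda>a i. pderiv_at i (\<lambda>y. transition y $ a) (base w)" "fibre w"] by simp

lemma symbol_transition:
  assumes w: "base w \<in> overlap" and \<alpha>: "\<alpha> \<in> Shat A"
  shows "symbol d \<alpha> w = symbol c \<alpha> (tangent_map transition w)"
proof (rule fps_ext)
  fix k
  let ?x = "coord_inv d (base w)"
  have x: "?x \<in> cdom c \<inter> cdom d"
    using w coord_inv_in[OF d] by (simp add: overlap_iff)
  have "\<alpha> k d ?x js = (\<Sum>is | length is = k. \<alpha> k c ?x is * (\<Prod>m<k. jac c d ?x (is ! m) (js ! m)))" if "length js = k" for js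
    using \<alpha> c d x that unfolding Shat_def Sk_iff tensor_field_def by blast
  then show "fps_nth (symbol d \<alpha> w) k = fps_nth (symbol c \<alpha> (tangent_map transition w)) k"
    by (simp add: symbol_nth base_tangent_map coord_inv_transition[OF w] fibre_poly_transition[OF w] cong: fibre_poly_cong)
qed

lemma symbol_full_bracket_transition:
  assumes w: "base w \<in> overlap" and \<alpha>: "\<alpha> \<in> Shat A" and \<beta>: "\<beta> \<in> Shat A"
  shows "symbol d (full_bracket \<Omega> \<Gamma> \<alpha> \<beta>) w = symbol c (full_bracket \<Omega> \<Gamma> \<alpha> \<beta>) (tangent_map transition w)"
proof -
  interpret poisson_map overlap "U d" "chart_image c" "U c" transition
    by (rule poisson_map_transition)
  have wd: "w \<in> base -` chart_image d" and wc: "tangent_map transition w \<in> base -` chart_image c"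
    using w overlap_subset transition_in by (auto simp: base_tangent_map)
  have "fps_X ^ 2 * symbol d (full_bracket \<Omega> \<Gamma> \<alpha> \<beta>) w = poisson_bracket (lifted_bivector (U d)) (symbol d \<alpha>) (symbol d \<beta>) w"
    by (rule symbol_full_bracket[OF d wd \<alpha> \<beta>])
  also have "\<dots> = poisson_bracket (lifted_bivector (U d)) (\<lambda>w. symbol c \<alpha> (tangent_map transition w)) (\<lambda>w. symbol c \<beta> (tangent_map transition w)) w"
    using w by (intro poisson_bracket_cong[OF source.open_phase] symbol_transition \<alpha> \<beta>) simp_all
  also have "\<dots> = poisson_bracket (lifted_bivector (U c)) (symbol c \<alpha>) (symbol c \<beta>) (tangent_map transition w)"
    using w by (intro poisson_bracket_tangent_map smooth_symbol c \<alpha> \<beta>) simp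
  also have "\<dots> = fps_X ^ 2 * symbol c (full_bracket \<Omega> \<Gamma> \<alpha> \<beta>) (tangent_map transition w)"
    by (rule symbol_full_bracket[OF c wc \<alpha> \<beta>, symmetric])
  finally show ?thesis
    by simp
qed

text \<open>Both sides are symmetric in \<open>js\<close>, so it is enough that their polynomials agree, which is the invariance
  of the symbol of the bracket under the tangent map.\<close>

lemma full_bracket_transform:
  assumes x: "x \<in> cdom c \<inter> cdom d" and \<alpha>: "\<alpha> \<in> Shat A" and \<beta>: "\<beta> \<in> Shat A" and js: "length js = k"
  defines "T \<equiv> full_bracket \<Omega> \<Gamma> \<alpha> \<beta> k"
  shows "T d x js = (\<Sum>is | length is = k. T c x is * (\<Prod>m<k. jac c d x (is ! m) (js ! m)))"
proof -
  define S where "S js = (if length js = k then \<Sum>is | length is = k. T c x is * (\<Prod>m<k. jac c d x (is ! m) (js ! m)) else 0)" for js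
  have sym: "symmetric_components (T e x)" for e
    unfolding T_def by (intro graded_symmetric_symmetric[of A] graded_symmetric_full_bracket Shat_graded_symmetric \<alpha> \<beta>)
  then have symS: "symmetric_components S"
    unfolding S_def by (rule symmetric_components_transform)
  have poly: "fibre_poly k (T d x) v = fibre_poly k S v" for v
  proof -
    obtain w where w: "base w = coord d x" "fibre w = v"
      using ex_base_fibre by blast
    have o: "base w \<in> overlap" and inv: "coord_inv d (base w) = x"
      using x coord_inv_coord[OF d] by (auto simp: w overlap_def)
    have "fps_nth (symbol d (full_bracket \<Omega> \<Gamma> \<alpha> \<beta>) w) k = fps_nth (symbol c (full_bracket \<Omega> \<Gamma> \<alpha> \<beta>) (tangent_map transition w)) k"
      using symbol_full_bracket_transition[OF o \<alpha> \<beta>] by simp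
    then have "fibre_poly k (T d x) v = fibre_poly k (\<lambda>js. \<Sum>is | length is = k. T c x is * (\<Prod>m<k. jac c d x (is ! m) (js ! m))) v"
      by (simp only: symbol_nth base_tangent_map coord_inv_transition[OF o] inv fibre_poly_transition[OF o] T_def w(2))
    also have "\<dots> = fibre_poly k S v"
      by (rule fibre_poly_cong) (simp add: S_def)
    finally show ?thesis .
  qed
  have "T d x js = S js"
    by (rule fibre_poly_inject[OF sym symS poly js])
  then show ?thesis
    by (simp add: S_def js)
qed

end

lemma full_bracket_in_Shat:
  assumes \<alpha>: "\<alpha> \<in> Shat A" and \<beta>: "\<beta> \<in> Shat A"
  shows "full_bracket \<Omega> \<Gamma> \<alpha> \<beta> \<in> Shat A"
proof -
  have g: "graded_symmetric A (full_bracket \<Omega> \<Gamma> \<alpha> \<beta>)"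
    by (intro graded_symmetric_full_bracket Shat_graded_symmetric \<alpha> \<beta>)
  have "tensor_field A k (full_bracket \<Omega> \<Gamma> \<alpha> \<beta> k)" for k
    unfolding tensor_field_def
  proof (intro conjI ballI allI impI)
    show "full_bracket \<Omega> \<Gamma> \<alpha> \<beta> k c x is = 0" if "\<not> (c \<in> A \<and> x \<in> cdom c \<and> length is = k)" for c x "is"
      by (rule graded_symmetric_eq_0[OF g that])
    show "smooth_on (coord c ` cdom c) (\<lambda>y. full_bracket \<Omega> \<Gamma> \<alpha> \<beta> k c (coord_inv c y) is)" if "c \<in> A" for c "is"
      using smooth_on_full_bracket[OF that \<alpha> \<beta>] by (simp add: chart_image_def)
  qed (rule full_bracket_transform[OF _ _ _ \<alpha> \<beta>])
  then show ?thesis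
    using graded_symmetric_symmetric[OF g] by (simp add: Shat_def Sk_iff)
qed

end

section \<open>The Lie algebra of all series\<close>

lemma poisson_bracket_add_left:
  assumes "open V" "w \<in> V" "fps_smooth_on V F" "fps_smooth_on V F'"
  shows "poisson_bracket P (\<lambda>w. F w + F' w) G w = poisson_bracket P F G w + poisson_bracket P F' G w"
  unfolding poisson_bracket_def
  by (simp add: fps_pderiv_at_add[OF assms] distrib_left distrib_right sum.distrib)

lemma poisson_bracket_mult_left:
  assumes "open V" "w \<in> V" "fps_smooth_on V F"
  shows "poisson_bracket P (\<lambda>w. k * F w) G w = k * poisson_bracket P F G w"
  unfolding poisson_bracket_def
  by (simp add: fps_pderiv_at_mult[OF assms(1,2) fps_smooth_on_const assms(3)] sum_distrib_left ac_simps)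

lemma poisson_bracket_swap:
  assumes "\<And>A B. P w A B = - P w B A"
  shows "poisson_bracket P F G w = - poisson_bracket P G F w"
proof -
  have "poisson_bracket P F G w = (\<Sum>*B A. P w A B * fps_pderiv_at A F w * fps_pderiv_at B G w)"
    unfolding poisson_bracket_def by (rule sum.swap)
  also have "\<dots> = (\<Sum>*B A. - (P w B A * fps_pderiv_at B G w * fps_pderiv_at A F w))"
    by (intro sum.cong refl) (subst assms, simp)
  finally show ?thesis
    by (simp add: poisson_bracket_def sum_negf)
qed

lemma lie_algebra_surjective_image:
  assumes L: "lie_algebra L br" and lin: "linear g" and Q: "g ` L = Q"
    and hom: "\<And>x y. x \<in> L \<Longrightarrow> y \<in> L \<Longrightarrow> g (br x y) = br' (g x) (g y)"
  shows "lie_algebra Q br'"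
proof -
  have sub: "subspace L" and clo: "\<And>x y. x \<in> L \<Longrightarrow> y \<in> L \<Longrightarrow> br x y \<in> L"
    and add: "\<And>x y z. x \<in> L \<Longrightarrow> y \<in> L \<Longrightarrow> z \<in> L \<Longrightarrow> br (x + y) z = br x z + br y z"
      "\<And>x y z. x \<in> L \<Longrightarrow> y \<in> L \<Longrightarrow> z \<in> L \<Longrightarrow> br x (y + z) = br x y + br x z"
    and scale: "\<And>r x y. x \<in> L \<Longrightarrow> y \<in> L \<Longrightarrow> br (r *\<^sub>R x) y = r *\<^sub>R br x y"
      "\<And>r x y. x \<in> L \<Longrightarrow> y \<in> L \<Longrightarrow> br x (r *\<^sub>R y) = r *\<^sub>R br x y"
    and self: "\<And>x. x \<in> L \<Longrightarrow> br x x = 0"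
    and jac: "\<And>x y z. x \<in> L \<Longrightarrow> y \<in> L \<Longrightarrow> z \<in> L \<Longrightarrow> br x (br y z) + br y (br z x) + br z (br x y) = 0"
    using L unfolding lie_algebra_def by blast+
  note mem = subspace_add[OF sub] subspace_scale[OF sub] clo
  note g = linear_add[OF lin] linear_cmul[OF lin] linear_0[OF lin]
  have "subspace Q"
    unfolding Q[symmetric] using lin sub by (rule linear_subspace_image)
  moreover have "br' (g x) (g y) \<in> g ` L" if "x \<in> L" "y \<in> L" for x y
    using hom[OF that] clo[OF that] by (metis imageI)
  moreover have "br' (g x + g y) (g z) = br' (g x) (g z) + br' (g y) (g z)" "br' (g x) (g y + g z) = br' (g x) (g y) + br' (g x) (g z)"
    if "x \<in> L" "y \<in> L" "z \<in> L" for x y z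
    using that add by (simp_all add: g[symmetric] hom[symmetric] mem)
  moreover have "br' (r *\<^sub>R g x) (g y) = r *\<^sub>R br' (g x) (g y)" "br' (g x) (r *\<^sub>R g y) = r *\<^sub>R br' (g x) (g y)"
    if "x \<in> L" "y \<in> L" for r x y
    using that scale by (simp_all add: g[symmetric] hom[symmetric] mem)
  moreover have "br' (g x) (g x) = 0" if "x \<in> L" for x
    using that self by (simp add: hom[symmetric] g)
  moreover have "br' (g x) (br' (g y) (g z)) + br' (g y) (br' (g z) (g x)) + br' (g z) (br' (g x) (g y)) = 0"
    if "x \<in> L" "y \<in> L" "z \<in> L" for x y z
    using that jac[OF that] by (simp add: g(1)[symmetric] hom[symmetric] mem g(3))
  ultimately show ?thesis
    unfolding lie_algebra_def Q[symmetric] by simp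
qed

context symplectic_connection_manifold
begin

lemma tensor_field_0: "tensor_field A k (0 :: ('m, 'n) tensor)"
  by (simp add: tensor_field_def smooth_on_const)

lemma tensor_field_linear_combination:
  assumes "tensor_field A k T" "tensor_field A k T'"
  shows "tensor_field A k (a *\<^sub>R T + b *\<^sub>R T')"
  unfolding tensor_field_def
proof (intro conjI ballI allI impI)
  show "(a *\<^sub>R T + b *\<^sub>R T') c x is = 0" if "\<not> (c \<in> A \<and> x \<in> cdom c \<and> length is = k)" for c x "is"
  proof -
    have "T c x is = 0" "T' c x is = 0"
      using assms that unfolding tensor_field_def by blast+
    then show ?thesis
      by (simp add: scaleR_fun_def)
  qed
  show "smooth_on (coord c ` cdom c) (\<lambda>y. (a *\<^sub>R T + b *\<^sub>R T') c (coord_inv c y) is)" if "c \<in> A" for c "is"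
  proof -
    have "smooth_on (coord c ` cdom c) (\<lambda>y. a * T c (coord_inv c y) is + b * T' c (coord_inv c y) is)"
      using assms that chart(2)[OF that] unfolding tensor_field_def chart_image_def
      by (intro smooth_on_add smooth_on_mult smooth_on_const) auto
    then show ?thesis
      by (simp add: scaleR_fun_def)
  qed
  fix c d x js assume *: "c \<in> A" "d \<in> A" "x \<in> cdom c \<inter> cdom d" "length (js :: 'n list) = k"
  have "T d x js = (\<Sum>is | length is = k. T c x is * (\<Prod>m<k. jac c d x (is ! m) (js ! m)))"
    "T' d x js = (\<Sum>is | length is = k. T' c x is * (\<Prod>m<k. jac c d x (is ! m) (js ! m)))"
    using assms * unfolding tensor_field_def by blast+
  then show "(a *\<^sub>R T + b *\<^sub>R T') d x js = (\<Sum>is | length is = k. (a *\<^sub>R T + b *\<^sub>R T') c x is * (\<Prod>m<k. jac c d x (is ! m) (js ! m)))"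
    by (simp add: scaleR_fun_def distrib_right sum.distrib sum_distrib_left mult.assoc)
qed

lemma subspace_Sk: "subspace (Sk A k)"
proof -
  have "symmetric_components ((a *\<^sub>R T + b *\<^sub>R T') c x)" if "T \<in> Sk A k" "T' \<in> Sk A k" for a b and T T' :: "('m, 'n) tensor" and c x
    using that unfolding Sk_iff symmetric_components_def scaleR_fun_def plus_fun_def by metis
  then have comb: "a *\<^sub>R T + b *\<^sub>R T' \<in> Sk A k" if "T \<in> Sk A k" "T' \<in> Sk A k" for a b T T'
    using that tensor_field_linear_combination by (simp add: Sk_iff)
  show ?thesis
    unfolding subspace_def
  proof (intro conjI ballI allI)
    show "0 \<in> Sk A k"
      by (simp add: Sk_iff tensor_field_0 symmetric_components_def)
    show "T + T' \<in> Sk A k" if "T \<in> Sk A k" "T' \<in> Sk A k" for T T'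
      using comb[OF that, of 1 1] by simp
    show "r *\<^sub>R T \<in> Sk A k" if "T \<in> Sk A k" for r T
      using comb[OF that that, of r 0] by simp
  qed
qed

lemma subspace_Shat: "subspace (Shat A)"
  unfolding subspace_def Shat_def using subspace_0[OF subspace_Sk] subspace_add[OF subspace_Sk] subspace_scale[OF subspace_Sk]
  by (auto simp: scaleR_fun_def [of _ "_ :: ('m, 'n) series"])

lemma proj_in_Shat: "\<alpha> \<in> Shat A \<Longrightarrow> proj k \<alpha> \<in> Shat A"
  unfolding Shat_def proj_def using subspace_0[OF subspace_Sk] by auto

lemma Shat_eqI:
  assumes "\<alpha> \<in> Shat A" "\<beta> \<in> Shat A"
    and "\<And>c w. c \<in> A \<Longrightarrow> w \<in> base -` chart_image c \<Longrightarrow> symbol c \<alpha> w = symbol c \<beta> w"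
  shows "\<alpha> = \<beta>"
  by (rule graded_symmetric_eqI[OF Shat_graded_symmetric[OF assms(1)] Shat_graded_symmetric[OF assms(2)] coord_inv_coord assms(3)])

abbreviation br where "br \<equiv> full_bracket \<Omega> \<Gamma>"

lemma open_phase: "c \<in> A \<Longrightarrow> open (base -` chart_image c)"
  by (rule open_base_vimage[OF chart(2)])

context
  fixes c w assumes c: "c \<in> A" and w: "w \<in> base -` chart_image c"
begin

lemma symbol_br_add_left:
  assumes "\<alpha> \<in> Shat A" "\<alpha>' \<in> Shat A" "\<beta> \<in> Shat A"
  shows "symbol c (br (\<alpha> + \<alpha>') \<beta>) w = symbol c (br \<alpha> \<beta>) w + symbol c (br \<alpha>' \<beta>) w"
proof -
  have "fps_X ^ 2 * symbol c (br (\<alpha> + \<alpha>') \<beta>) w = poisson_bracket (lifted_bivector (U c)) (\<lambda>w. symbol c \<alpha> w + symbol c \<alpha>' w) (symbol c \<beta>) w"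
    by (simp add: symbol_full_bracket[OF c w subspace_add[OF subspace_Shat assms(1,2)] assms(3)] symbol_add [abs_def])
  also have "\<dots> = fps_X ^ 2 * (symbol c (br \<alpha> \<beta>) w + symbol c (br \<alpha>' \<beta>) w)"
    by (simp only: distrib_left symbol_full_bracket[OF c w] assms
      poisson_bracket_add_left[OF open_phase[OF c] w smooth_symbol[OF c assms(1)] smooth_symbol[OF c assms(2)]])
  finally show ?thesis
    by simp
qed

lemma symbol_br_scaleR_left:
  assumes "\<alpha> \<in> Shat A" "\<beta> \<in> Shat A"
  shows "symbol c (br (r *\<^sub>R \<alpha>) \<beta>) w = fps_const r * symbol c (br \<alpha> \<beta>) w"
proof -
  have "fps_X ^ 2 * symbol c (br (r *\<^sub>R \<alpha>) \<beta>) w = poisson_bracket (lifted_bivector (U c)) (\<lambda>w. fps_const r * symbol c \<alpha> w) (symbol c \<beta>) w"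
    by (simp add: symbol_full_bracket[OF c w subspace_scale[OF subspace_Shat assms(1)] assms(2)] symbol_scaleR [abs_def])
  also have "\<dots> = fps_X ^ 2 * (fps_const r * symbol c (br \<alpha> \<beta>) w)"
    by (simp only: mult.left_commute[of "fps_X ^ 2"] symbol_full_bracket[OF c w] assms
      poisson_bracket_mult_left[OF open_phase[OF c] w smooth_symbol[OF c assms(1)]])
  finally show ?thesis
    by simp
qed

lemma symbol_br_swap:
  assumes "\<alpha> \<in> Shat A" "\<beta> \<in> Shat A"
  shows "symbol c (br \<alpha> \<beta>) w = - symbol c (br \<beta> \<alpha>) w"
proof -
  have "fps_X ^ 2 * symbol c (br \<alpha> \<beta>) w = - (fps_X ^ 2 * symbol c (br \<beta> \<alpha>) w)"
    unfolding symbol_full_bracket[OF c w assms] symbol_full_bracket[OF c w assms(2,1)]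
    by (rule poisson_bracket_swap) (rule poisson_coordinates.antisym_lifted_bivector[OF poisson_coordinates[OF c] w])
  then have "fps_X ^ 2 * symbol c (br \<alpha> \<beta>) w = fps_X ^ 2 * (- symbol c (br \<beta> \<alpha>) w)"
    by simp
  then show ?thesis
    by (subst (asm) mult_cancel_left) simp
qed

text \<open>One factor \<open>X\<^sup>2\<close> is needed for each of the two brackets; the inner one is moved through the outer Poisson bracket,
  where constants such as \<open>X\<^sup>2\<close> can be taken out.\<close>

lemma symbol_br_br:
  assumes "\<alpha> \<in> Shat A" "\<beta> \<in> Shat A" "\<gamma> \<in> Shat A"
  defines "pb \<equiv> poisson_bracket (lifted_bivector (U c))"
  shows "fps_X ^ 4 * symbol c (br \<alpha> (br \<beta> \<gamma>)) w = pb (symbol c \<alpha>) (pb (symbol c \<beta>) (symbol c \<gamma>)) w"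
proof -
  note br = full_bracket_in_Shat[OF assms(2,3)]
  \<comment> \<open>Constants are only taken out of the first argument, so the arguments are exchanged and exchanged back.\<close>
  have swap: "pb F G w = - pb G F w" for F G
    unfolding pb_def by (rule poisson_bracket_swap) (rule poisson_coordinates.antisym_lifted_bivector[OF poisson_coordinates[OF c] w])
  have "fps_X ^ 4 * symbol c (br \<alpha> (br \<beta> \<gamma>)) w = fps_X ^ 2 * pb (symbol c \<alpha>) (symbol c (br \<beta> \<gamma>)) w"
    unfolding pb_def symbol_full_bracket[OF c w assms(1) br, symmetric] by (simp add: mult.assoc[symmetric] flip: power_add)
  also have "\<dots> = - (fps_X ^ 2 * pb (symbol c (br \<beta> \<gamma>)) (symbol c \<alpha>) w)"
    by (subst swap) simp
  also have "\<dots> = - pb (\<lambda>w. fps_X ^ 2 * symbol c (br \<beta> \<gamma>) w) (symbol c \<alpha>) w"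
    unfolding pb_def by (simp add: poisson_bracket_mult_left[OF open_phase[OF c] w smooth_symbol[OF c br]])
  also have "\<dots> = pb (symbol c \<alpha>) (\<lambda>w. fps_X ^ 2 * symbol c (br \<beta> \<gamma>) w) w"
    by (subst swap) simp
  also have "\<dots> = pb (symbol c \<alpha>) (pb (symbol c \<beta>) (symbol c \<gamma>)) w"
    unfolding pb_def using symbol_full_bracket[OF c _ assms(2,3)]
    by (intro poisson_bracket_cong[OF open_phase[OF c] w]) simp_all
  finally show ?thesis .
qed

lemma symbol_br_jacobi:
  assumes "\<alpha> \<in> Shat A" "\<beta> \<in> Shat A" "\<gamma> \<in> Shat A"
  shows "symbol c (br \<alpha> (br \<beta> \<gamma>)) w + symbol c (br \<beta> (br \<gamma> \<alpha>)) w + symbol c (br \<gamma> (br \<alpha> \<beta>)) w = 0"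
proof -
  have "fps_X ^ 4 * (symbol c (br \<alpha> (br \<beta> \<gamma>)) w + symbol c (br \<beta> (br \<gamma> \<alpha>)) w + symbol c (br \<gamma> (br \<alpha> \<beta>)) w) = 0"
    unfolding distrib_left using assms
    by (simp only: symbol_br_br poisson_coordinates.poisson_bracket_lifted_bivector_jacobi[OF poisson_coordinates[OF c]
      smooth_symbol[OF c] smooth_symbol[OF c] smooth_symbol[OF c] w])
  then show ?thesis
    by simp
qed

end

lemma lie_algebra_Shat: "lie_algebra (Shat A) br"
proof -
  note S = subspace_add[OF subspace_Shat] subspace_scale[OF subspace_Shat] subspace_neg[OF subspace_Shat] subspace_0[OF subspace_Shat]
    full_bracket_in_Shat
  note symbol = symbol_add symbol_scaleR symbol_0
  have add: "br (x + y) z = br x z + br y z" if "x \<in> Shat A" "y \<in> Shat A" "z \<in> Shat A" for x y z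
    using that by (intro Shat_eqI S) (simp_all add: symbol symbol_br_add_left)
  have scale: "br (r *\<^sub>R x) y = r *\<^sub>R br x y" if "x \<in> Shat A" "y \<in> Shat A" for r x y
    using that by (intro Shat_eqI S) (simp_all add: symbol symbol_br_scaleR_left)
  have swap: "br x y = - br y x" if "x \<in> Shat A" "y \<in> Shat A" for x y
  proof (rule Shat_eqI)
    show "symbol c (br x y) w = symbol c (- br y x) w" if "c \<in> A" "w \<in> base -` chart_image c" for c w
      using symbol_br_swap[OF that \<open>x \<in> Shat A\<close> \<open>y \<in> Shat A\<close>] symbol_scaleR[of c "- 1" "br y x" w]
      by (simp flip: fps_const_neg)
  qed (use that S in auto)
  have self: "br x x = 0" if "x \<in> Shat A" for x
  proof -
    have "2 *\<^sub>R br x x = br x x + br x x"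
      by (simp add: scaleR_2)
    also have "\<dots> = 0"
      using swap[OF that that] by (simp add: eq_neg_iff_add_eq_0)
    finally show ?thesis
      by simp
  qed
  have "br x (y + z) = br x y + br x z" if "x \<in> Shat A" "y \<in> Shat A" "z \<in> Shat A" for x y z
  proof -
    have "br x (y + z) = - (br y x + br z x)"
      using swap[of x "y + z"] add[of y z x] that S(1) by simp
    then show ?thesis
      using swap[of x y] swap[of x z] that by simp
  qed
  moreover have "br x (r *\<^sub>R y) = r *\<^sub>R br x y" if "x \<in> Shat A" "y \<in> Shat A" for r x y
  proof -
    have "br x (r *\<^sub>R y) = - (r *\<^sub>R br y x)"
      using swap[of x "r *\<^sub>R y"] scale[of y x r] that S(2) by simp
    then show ?thesis
      using swap[of x y] that by simp
  qed
  moreover have "br x (br y z) + br y (br z x) + br z (br x y) = 0" if "x \<in> Shat A" "y \<in> Shat A" "z \<in> Shat A" for x y z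
    using that by (intro Shat_eqI S) (simp_all add: symbol symbol_br_jacobi)
  ultimately show ?thesis
    unfolding lie_algebra_def using subspace_Shat S(5) add scale self by simp
qed

section \<open>Series whose linear part is the differential of the constant part\<close>

lemma Hhat_iff: "\<alpha> \<in> Hhat A \<longleftrightarrow> \<alpha> \<in> Shat A \<and> (\<exists>f. smooth_fun A f \<and> \<alpha> 0 = scalar A f \<and> \<alpha> 1 = differential A f)"
  by (simp add: Hhat_def delta_star_def)

lemma smooth_fun_chart: "smooth_fun A f \<Longrightarrow> c \<in> A \<Longrightarrow> smooth_on (chart_image c) (\<lambda>y. f (coord_inv c y))"
  by (simp add: smooth_fun_def chart_image_def comp_def)

lemma differential_Cons: "c \<in> A \<Longrightarrow> differential A f c x [i] = cpd c i f x"
  by (simp add: differential_def)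

lemma differential_eqI:
  assumes "T \<in> Sk A 1" "\<And>c x i. c \<in> A \<Longrightarrow> x \<in> cdom c \<Longrightarrow> T c x [i] = cpd c i f x"
  shows "T = differential A f"
proof (intro ext)
  fix c x "is"
  have zero: "T c x is = 0" if "\<not> (c \<in> A \<and> x \<in> cdom c \<and> length is = 1)"
    using assms(1) that unfolding Sk_iff tensor_field_def by blast
  show "T c x is = differential A f c x is"
  proof (cases "c \<in> A \<and> x \<in> cdom c \<and> length is = 1")
    case True
    then show ?thesis
      using assms(2) by (cases "is") (auto simp: differential_Cons)
  next
    case False
    then show ?thesis
      using zero by (auto simp: differential_def cpd_def split: list.split)
  qed
qed

lemma smooth_fun_linear_combination:
  assumes "smooth_fun A f" "smooth_fun A g"
  shows "smooth_fun A (\<lambda>x. a * f x + b * g x)"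
  unfolding smooth_fun_def
proof
  fix c assume c: "c \<in> A"
  show "smooth_on (coord c ` cdom c) ((\<lambda>x. a * f x + b * g x) \<circ> coord_inv c)"
    unfolding comp_def chart_image_def[symmetric]
    using smooth_fun_chart[OF assms(1) c] smooth_fun_chart[OF assms(2) c] chart(2)[OF c]
    by (intro smooth_on_add smooth_on_mult smooth_on_const)
qed

lemma differential_linear_combination:
  assumes "smooth_fun A f" "smooth_fun A g"
  shows "differential A (\<lambda>x. a * f x + b * g x) = a *\<^sub>R differential A f + b *\<^sub>R differential A g"
proof -
  have "cpd c i (\<lambda>x. a * f x + b * g x) x = a * cpd c i f x + b * cpd c i g x" if c: "c \<in> A" for c i x
  proof (cases "x \<in> cdom c")
    case True
    then have y: "coord c x \<in> chart_image c"
      by (simp add: chart_image_def)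
    show ?thesis
      using True smooth_on_differentiable[OF smooth_fun_chart[OF assms(1) c] chart(2)[OF c] y]
        smooth_on_differentiable[OF smooth_fun_chart[OF assms(2) c] chart(2)[OF c] y]
      by (simp add: cpd_def comp_def pderiv_at_add pderiv_at_mult)
  qed (simp add: cpd_def)
  then show ?thesis
    by (auto simp: fun_eq_iff differential_def scaleR_fun_def split: list.split)
qed

lemma subspace_Hhat: "subspace (Hhat A)"
proof -
  have comb: "a *\<^sub>R \<alpha> + b *\<^sub>R \<beta> \<in> Hhat A" if H: "\<alpha> \<in> Hhat A" "\<beta> \<in> Hhat A" for a b and \<alpha> \<beta> :: "('m, 'n) series"
  proof -
    obtain f where f: "smooth_fun A f" "\<alpha> 0 = scalar A f" "\<alpha> 1 = differential A f"
      using H(1) unfolding Hhat_iff by blast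
    obtain g where g: "smooth_fun A g" "\<beta> 0 = scalar A g" "\<beta> 1 = differential A g"
      using H(2) unfolding Hhat_iff by blast
    note fg = f g
    have "(a *\<^sub>R \<alpha> + b *\<^sub>R \<beta>) 0 = scalar A (\<lambda>x. a * f x + b * g x)"
      by (auto simp: fun_eq_iff scaleR_fun_def fg scalar_def)
    moreover have "(a *\<^sub>R \<alpha> + b *\<^sub>R \<beta>) 1 = differential A (\<lambda>x. a * f x + b * g x)"
      unfolding differential_linear_combination[OF fg(1,4)] by (simp add: scaleR_fun_def fg[unfolded One_nat_def])
    moreover have "a *\<^sub>R \<alpha> + b *\<^sub>R \<beta> \<in> Shat A"
      using H subspace_Shat by (simp add: Hhat_iff subspace_add subspace_scale)
    ultimately show ?thesis
      using smooth_fun_linear_combination[OF fg(1,4)] unfolding Hhat_iff by blast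
  qed
  have zero: "0 \<in> Hhat A"
  proof -
    have "smooth_fun A (\<lambda>_. 0)"
      by (simp add: smooth_fun_def comp_def smooth_on_const)
    moreover have "(0 :: ('m, 'n) series) 0 = scalar A (\<lambda>_. 0)" "(0 :: ('m, 'n) series) 1 = differential A (\<lambda>_. 0)"
      by (auto simp: fun_eq_iff scalar_def differential_def cpd_def comp_def split: list.split)
    ultimately show ?thesis
      using subspace_0[OF subspace_Shat] unfolding Hhat_iff by blast
  qed
  show ?thesis
    unfolding subspace_def
  proof (intro conjI ballI allI)
    show "\<alpha> + \<beta> \<in> Hhat A" if "\<alpha> \<in> Hhat A" "\<beta> \<in> Hhat A" for \<alpha> \<beta>
      using comb[OF that, of 1 1] by simp
    show "r *\<^sub>R \<alpha> \<in> Hhat A" if "\<alpha> \<in> Hhat A" for r \<alpha>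
      using comb[OF that that, of r 0] by simp
  qed (rule zero)
qed

lemma
  assumes c: "c \<in> A" and w: "w \<in> base -` chart_image c" and \<alpha>: "\<alpha> \<in> Shat A"
    and f: "smooth_fun A f" "\<alpha> 0 = scalar A f" "\<alpha> 1 = differential A f"
  defines "f' \<equiv> \<lambda>p. pderiv_at p (\<lambda>y. f (coord_inv c y))"
  shows fibre_derivative_Hhat_0: "fps_nth (fps_pderiv_at (Inr p) (symbol c \<alpha>) w) 0 = 0"
    and fibre_derivative_Hhat_1: "fps_nth (fps_pderiv_at (Inr p) (symbol c \<alpha>) w) 1 = f' p (base w)"
    and base_derivative_Hhat_0: "fps_nth (fps_pderiv_at (Inl p) (symbol c \<alpha>) w) 0 = f' p (base w)"
    and base_derivative_Hhat_1: "fps_nth (fps_pderiv_at (Inl p) (symbol c \<alpha>) w) 1 = (\<Sum>*j. fibre w $ j * pderiv_at j (f' p) (base w))"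
proof -
  have y: "base w \<in> chart_image c"
    using w by simp
  note nth = fibre_derivative_symbol_nth[OF c \<alpha> w] base_derivative_symbol_nth[OF c \<alpha> w]
  show "fps_nth (fps_pderiv_at (Inr p) (symbol c \<alpha>) w) 0 = 0"
    unfolding nth by (simp add: fibre_deriv_def)
  show "fps_nth (fps_pderiv_at (Inr p) (symbol c \<alpha>) w) 1 = f' p (base w)"
    unfolding nth f(3) by (simp add: fibre_deriv_def differential_Cons[OF c] cpd_coord_inv[OF c y] f'_def)
  have "pderiv_at p (\<lambda>y. \<alpha> 0 c (coord_inv c y) []) (base w) = f' p (base w)"
    unfolding f'_def f(2) using c by (intro pderiv_at_cong[OF chart(2)[OF c] y]) (simp add: scalar_def coord_inv_in)
  then show "fps_nth (fps_pderiv_at (Inl p) (symbol c \<alpha>) w) 0 = f' p (base w)"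
    unfolding nth by (simp add: cpd_coord_inv[OF c y])
  have "pderiv_at p (\<lambda>y. \<alpha> 1 c (coord_inv c y) [j]) (base w) = pderiv_at j (f' p) (base w)" for j
  proof -
    have "pderiv_at p (\<lambda>y. \<alpha> 1 c (coord_inv c y) [j]) (base w) = pderiv_at p (f' j) (base w)"
      unfolding f'_def f(3) by (intro pderiv_at_cong[OF chart(2)[OF c] y]) (simp add: differential_Cons[OF c] cpd_coord_inv[OF c])
    also have "\<dots> = pderiv_at j (f' p) (base w)"
      unfolding f'_def by (rule pderiv_at_commute[OF smooth_fun_chart[OF f(1) c] chart(2)[OF c] y])
    finally show ?thesis .
  qed
  then show "fps_nth (fps_pderiv_at (Inl p) (symbol c \<alpha>) w) 1 = (\<Sum>*j. fibre w $ j * pderiv_at j (f' p) (base w))"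
    unfolding nth One_nat_def by (simp add: cpd_coord_inv[OF c y])
qed

context
  fixes \<alpha> \<beta> f g
  assumes \<alpha>: "\<alpha> \<in> Shat A" and f: "smooth_fun A f" "\<alpha> 0 = scalar A f" "\<alpha> 1 = differential A f"
    and \<beta>: "\<beta> \<in> Shat A" and g: "smooth_fun A g" "\<beta> 0 = scalar A g" "\<beta> 1 = differential A g"
begin

text \<open>The Poisson bracket of the functions \<open>f\<close> and \<open>g\<close> in a chart.\<close>

definition hamiltonian_bracket where
  "hamiltonian_bracket c y = (\<Sum>*p q. U c y p q
    * (pderiv_at p (\<lambda>y. f (coord_inv c y)) y * pderiv_at q (\<lambda>y. g (coord_inv c y)) y))"

context
  fixes c w assumes c: "c \<in> A" and w: "w \<in> base -` chart_image c"
begin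

lemma anti: "U c (base w) p q = - U c (base w) q p"
  using w by (intro antisym_poisson_coefficients c) simp

lemma symbol_br_nth_0: "fps_nth (symbol c (br \<alpha> \<beta>) w) 0 = - hamiltonian_bracket c (base w)"
proof -
  let ?f = "\<lambda>p. pderiv_at p (\<lambda>y. f (coord_inv c y)) (base w)" and ?g = "\<lambda>p. pderiv_at p (\<lambda>y. g (coord_inv c y)) (base w)"
  note co = fibre_derivative_Hhat_0[OF c w \<alpha> f] fibre_derivative_Hhat_1[OF c w \<alpha> f] base_derivative_Hhat_0[OF c w \<alpha> f]
    fibre_derivative_Hhat_0[OF c w \<beta> g] fibre_derivative_Hhat_1[OF c w \<beta> g] base_derivative_Hhat_0[OF c w \<beta> g]
  have mult: "fps_nth (a * b) 1 = fps_nth a 0 * fps_nth b 1 + fps_nth a 1 * fps_nth b 0"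
    "fps_nth (a * b) 2 = fps_nth a 0 * fps_nth b 2 + fps_nth a 1 * fps_nth b 1 + fps_nth a 2 * fps_nth b 0" for a b :: "real fps"
    by (simp_all add: fps_mult_nth eval_nat_numeral)
  have X: "fps_nth (fps_X * a) 2 = fps_nth a 1" for a :: "real fps"
    by simp
  have "fps_nth (symbol c (br \<alpha> \<beta>) w) 0 = fps_nth (fps_X ^ 2 * symbol c (br \<alpha> \<beta>) w) 2"
    by (simp add: fps_X_power_mult_nth)
  also have "\<dots> = (\<Sum>*p q. U c (base w) p q * (?f p * ?g q))
    + (\<Sum>*p q. U c (base w) p q * (?f q * ?g p - ?f p * ?g q))"
    unfolding symbol_full_bracket_expand[OF c w \<alpha> \<beta>] fps_add_nth fps_sub_nth X fps_sum_nth fps_mult_left_const_nth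
    unfolding mult fps_sub_nth co by simp
  also have "\<dots> = (\<Sum>*p q. U c (base w) p q * (?f q * ?g p))"
    by (simp add: right_diff_distrib sum_subtractf)
  also have "\<dots> = - hamiltonian_bracket c (base w)"
    unfolding hamiltonian_bracket_def by (rule sum_antisymmetric[OF anti])
  finally show ?thesis .
qed

text \<open>The quadratic parts \<open>fv2\<close> and \<open>gv2\<close> drop out because the algebraic bracket with a linear part cancels the Schouten
  bracket with the corresponding constant part.\<close>

lemma symbol_br_nth_1:
  "fps_nth (symbol c (br \<alpha> \<beta>) w) 1 = - (\<Sum>*j. fibre w $ j * pderiv_at j (hamiltonian_bracket c) (base w))"
proof -
  let ?f = "\<lambda>p. pderiv_at p (\<lambda>y. f (coord_inv c y))" and ?g = "\<lambda>p. pderiv_at p (\<lambda>y. g (coord_inv c y))"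
  let ?y = "base w" and ?v = "fibre w"
  let ?u = "U c (base w)" and ?F = "\<lambda>p. \<Sum>*j. fibre w $ j * pderiv_at j (?f p) (base w)"
    and ?G = "\<lambda>p. \<Sum>*j. fibre w $ j * pderiv_at j (?g p) (base w)"
    and ?L = "\<lambda>p q. \<Sum>*j. fibre w $ j * pderiv_at j (\<lambda>y. U c y p q) (base w)"
  let ?t = "\<lambda>j p q. ?v $ j * (pderiv_at j (\<lambda>y. U c y p q) ?y * (?f p ?y * ?g q ?y)
      + ?u p q * (pderiv_at j (?f p) ?y * ?g q ?y + ?f p ?y * pderiv_at j (?g q) ?y))"
  define fv2 gv2 where "fv2 p = fps_nth (fps_pderiv_at (Inr p) (symbol c \<alpha>) w) 2"
    and "gv2 p = fps_nth (fps_pderiv_at (Inr p) (symbol c \<beta>) w) 2" for p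
  have y: "?y \<in> chart_image c"
    using w by simp
  note co = fibre_derivative_Hhat_0[OF c w \<alpha> f] fibre_derivative_Hhat_1[OF c w \<alpha> f] base_derivative_Hhat_0[OF c w \<alpha> f]
    fibre_derivative_Hhat_0[OF c w \<beta> g] fibre_derivative_Hhat_1[OF c w \<beta> g] base_derivative_Hhat_0[OF c w \<beta> g]
    base_derivative_Hhat_1[OF c w \<alpha> f] base_derivative_Hhat_1[OF c w \<beta> g] fv2_def[symmetric] gv2_def[symmetric]
  have mult: "fps_nth (a * b) 2 = fps_nth a 0 * fps_nth b 2 + fps_nth a 1 * fps_nth b 1 + fps_nth a 2 * fps_nth b 0"
    "fps_nth (a * b) 3 = fps_nth a 0 * fps_nth b 3 + fps_nth a 1 * fps_nth b 2 + fps_nth a 2 * fps_nth b 1 + fps_nth a 3 * fps_nth b 0" for a b :: "real fps"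
    by (simp_all add: fps_mult_nth eval_nat_numeral)
  have X: "fps_nth (fps_X * a) 3 = fps_nth a 2" for a :: "real fps"
    by simp
  have dU: "(\<lambda>y. U c y p q) differentiable at ?y" and df: "?f p differentiable at ?y" and dg: "?g p differentiable at ?y" for p q
    using smooth_on_differentiable[OF _ chart(2)[OF c] y] smooth_poisson_coefficients[OF c]
      smooth_on_pderiv_at[OF smooth_fun_chart[OF f(1) c]] smooth_on_pderiv_at[OF smooth_fun_chart[OF g(1) c]] by auto
  have "fps_nth (symbol c (br \<alpha> \<beta>) w) 1 = fps_nth (fps_X ^ 2 * symbol c (br \<alpha> \<beta>) w) 3"
    by (simp add: fps_X_power_mult_nth)
  also have "\<dots> = (\<Sum>*p q. ?u p q * (?f p ?y * gv2 q + fv2 p * ?g q ?y))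
    + (\<Sum>*p q. ?u p q * (?f q ?y * gv2 p + ?F q * ?g p ?y
        - (?f p ?y * ?G q + fv2 p * ?g q ?y)))
    - (\<Sum>*p q. ?L p q * (?f p ?y * ?g q ?y))"
    unfolding symbol_full_bracket_expand[OF c w \<alpha> \<beta>] fps_add_nth fps_sub_nth X fps_sum_nth fps_mult_left_const_nth
    unfolding mult fps_sub_nth co by simp
  also have "\<dots> = (\<Sum>*p q. ?u p q * (?f p ?y * gv2 q))
    + (\<Sum>*p q. ?u p q * (?f q ?y * gv2 p))
    + (\<Sum>*p q. ?u p q * (?F q * ?g p ?y))
    - (\<Sum>*p q. ?u p q * (?f p ?y * ?G q))
    - (\<Sum>*p q. ?L p q * (?f p ?y * ?g q ?y))"
    by (simp add: distrib_left right_diff_distrib sum.distrib sum_subtractf)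
  also have "\<dots> = - (\<Sum>*p q. ?u p q * (?F p * ?g q ?y))
    - (\<Sum>*p q. ?u p q * (?f p ?y * ?G q))
    - (\<Sum>*p q. ?L p q * (?f p ?y * ?g q ?y))"
    using sum_antisymmetric[OF anti, where t = "\<lambda>p q. ?f p ?y * gv2 q"]
      sum_antisymmetric[OF anti, where t = "\<lambda>p q. ?F p * ?g q ?y"] by simp
  also have "\<dots> = - (\<Sum>*p q j. ?t j p q)"
    by (simp add: sum_distrib_left sum_distrib_right sum.distrib distrib_left ac_simps)
  also have "(\<Sum>*p q j. ?t j p q)
    = (\<Sum>*p j q. ?t j p q)"
    by (intro sum.cong refl sum.swap)
  also have "\<dots> = (\<Sum>*j p q. ?t j p q)"
    by (rule sum.swap)
  also have "\<dots> = (\<Sum>*j. ?v $ j * pderiv_at j (hamiltonian_bracket c) ?y)"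
    unfolding hamiltonian_bracket_def [abs_def] using dU df dg
    by (simp add: pderiv_at_sum pderiv_at_mult differentiable_sum differentiable_mult sum_distrib_left)
  finally show ?thesis .
qed

end

lemma full_bracket_in_Hhat: "br \<alpha> \<beta> \<in> Hhat A"
proof -
  have S: "br \<alpha> \<beta> \<in> Shat A"
    by (rule full_bracket_in_Shat[OF \<alpha> \<beta>])
  then have "br \<alpha> \<beta> 0 \<in> Sk A 0"
    unfolding Shat_def by blast
  then obtain h where h: "smooth_fun A h" "br \<alpha> \<beta> 0 = scalar A h"
    unfolding Sk_0[OF atlas] by blast
  have "br \<alpha> \<beta> 1 = differential A h"
  proof (rule differential_eqI)
    show "br \<alpha> \<beta> 1 \<in> Sk A 1"
      using S unfolding Shat_def by blast
    fix c x i assume c: "c \<in> A" and x: "x \<in> cdom c"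
    have y: "coord c x \<in> chart_image c"
      using x by (simp add: chart_image_def)
    have h_eq: "h (coord_inv c z) = - hamiltonian_bracket c z" if z: "z \<in> chart_image c" for z
    proof -
      obtain w :: "real^('n + 'n)" where w: "base w = z"
        using ex_base_fibre by blast
      then have "fps_nth (symbol c (br \<alpha> \<beta>) w) 0 = - hamiltonian_bracket c z"
        using symbol_br_nth_0[OF c, of w] z by simp
      then show ?thesis
        using c z by (simp add: symbol_nth h w scalar_def coord_inv_in)
    qed
    obtain w where w: "base w = coord c x" "fibre w = axis i 1"
      using ex_base_fibre by blast
    have "br \<alpha> \<beta> 1 c x [i] = fps_nth (symbol c (br \<alpha> \<beta>) w) 1"
      by (simp add: symbol_nth w coord_inv_coord[OF c x] axis_def if_distrib[of "\<lambda>x. x * _"] cong: if_cong)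
    also have "\<dots> = - pderiv_at i (hamiltonian_bracket c) (coord c x)"
      using symbol_br_nth_1[OF c, of w] y by (simp add: w axis_def if_distrib[of "\<lambda>x. x * _"] cong: if_cong)
    also have "\<dots> = pderiv_at i (\<lambda>y. h (coord_inv c y)) (coord c x)"
    proof -
      have "pderiv_at i (hamiltonian_bracket c) (coord c x) = pderiv_at i (\<lambda>y. - 1 * h (coord_inv c y)) (coord c x)"
        by (rule pderiv_at_cong[OF chart(2)[OF c] y]) (simp add: h_eq)
      also have "\<dots> = - pderiv_at i (\<lambda>y. h (coord_inv c y)) (coord c x)"
        using smooth_on_differentiable[OF smooth_fun_chart[OF h(1) c] chart(2)[OF c] y] by (subst pderiv_at_mult) auto
      finally show ?thesis
        by simp
    qed
    also have "\<dots> = cpd c i h x"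
      using x by (simp add: cpd_def comp_def)
    finally show "br \<alpha> \<beta> 1 c x [i] = cpd c i h x" .
  qed
  with S h show ?thesis
    unfolding Hhat_iff by blast
qed

end

end

section \<open>The short exact sequence\<close>

lemma proj_eq_0: "i < k \<Longrightarrow> proj k \<alpha> i = 0"
  by (simp add: proj_def)

lemma proj_eq: "k \<le> i \<Longrightarrow> proj k \<alpha> i = \<alpha> i"
  by (simp add: proj_def)

lemma linear_proj: "linear (proj k)"
  by (rule linearI) (auto simp: proj_def fun_eq_iff scaleR_fun_def)

lemma symbol_proj_1: "symbol c (proj 1 \<alpha>) w = symbol c \<alpha> w - fps_const (fps_nth (symbol c \<alpha> w) 0)"
  by (rule fps_ext) (simp add: symbol_nth proj_def zero_fun_def)

context symplectic_connection_manifold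
begin

lemma
  assumes c: "c \<in> A" and w: "w \<in> base -` chart_image c" and \<alpha>: "\<alpha> \<in> Shat A"
    and f: "smooth_fun A f" "\<alpha> 0 = scalar A f" "\<alpha> 1 = differential A f"
  defines "f' \<equiv> \<lambda>p. fps_const (pderiv_at p (\<lambda>y. f (coord_inv c y)) (base w))"
  shows fibre_derivative_proj_1: "fps_pderiv_at (Inr p) (symbol c (proj 1 \<alpha>)) w = fps_pderiv_at (Inr p) (symbol c \<alpha>) w"
    and fibre_derivative_proj_2: "fps_pderiv_at (Inr p) (symbol c (proj 2 \<alpha>)) w = fps_pderiv_at (Inr p) (symbol c \<alpha>) w - fps_X * f' p"
    and base_derivative_proj_1: "fps_pderiv_at (Inl p) (symbol c (proj 1 \<alpha>)) w = fps_pderiv_at (Inl p) (symbol c \<alpha>) w - f' p"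
proof -
  note nth = fibre_derivative_symbol_nth[OF c _ w] base_derivative_symbol_nth[OF c _ w]
  note co = fibre_derivative_Hhat_0[OF c w \<alpha> f] fibre_derivative_Hhat_1[OF c w \<alpha> f] base_derivative_Hhat_0[OF c w \<alpha> f]
  show "fps_pderiv_at (Inr p) (symbol c (proj 1 \<alpha>)) w = fps_pderiv_at (Inr p) (symbol c \<alpha>) w"
  proof (rule fps_ext)
    fix n
    show "fps_nth (fps_pderiv_at (Inr p) (symbol c (proj 1 \<alpha>)) w) n = fps_nth (fps_pderiv_at (Inr p) (symbol c \<alpha>) w) n"
      unfolding nth[OF \<alpha>] nth[OF proj_in_Shat[OF \<alpha>]] by (cases n) (simp_all add: fibre_deriv_def proj_def)
  qed
  show "fps_pderiv_at (Inr p) (symbol c (proj 2 \<alpha>)) w = fps_pderiv_at (Inr p) (symbol c \<alpha>) w - fps_X * f' p"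
  proof (rule fps_ext)
    fix n :: nat
    consider "n = 0" | "n = 1" | "n \<ge> 2"
      by linarith
    then show "fps_nth (fps_pderiv_at (Inr p) (symbol c (proj 2 \<alpha>)) w) n = fps_nth (fps_pderiv_at (Inr p) (symbol c \<alpha>) w - fps_X * f' p) n"
    proof cases
      case 3
      then show ?thesis
        unfolding fps_sub_nth nth[OF \<alpha>] nth[OF proj_in_Shat[OF \<alpha>]] by (simp add: proj_def f'_def)
    next
      case 2
      then show ?thesis
        unfolding fps_sub_nth nth[OF proj_in_Shat[OF \<alpha>]] 2 co by (simp add: proj_def fibre_deriv_def f'_def)
    next
      case 1
      then show ?thesis
        unfolding fps_sub_nth nth[OF proj_in_Shat[OF \<alpha>]] 1 co by (simp add: fibre_deriv_def)
    qed
  qed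
  show "fps_pderiv_at (Inl p) (symbol c (proj 1 \<alpha>)) w = fps_pderiv_at (Inl p) (symbol c \<alpha>) w - f' p"
  proof (rule fps_ext)
    fix n :: nat
    show "fps_nth (fps_pderiv_at (Inl p) (symbol c (proj 1 \<alpha>)) w) n = fps_nth (fps_pderiv_at (Inl p) (symbol c \<alpha>) w - f' p) n"
    proof (cases "n = 0")
      case True
      show ?thesis
        unfolding fps_sub_nth nth[OF proj_in_Shat[OF \<alpha>]] True co by (simp add: proj_def f'_def cpd_def comp_def)
    next
      case False
      then show ?thesis
        unfolding fps_sub_nth nth[OF \<alpha>] nth[OF proj_in_Shat[OF \<alpha>]] by (simp add: proj_def f'_def)
    qed
  qed
qed

text \<open>Removing the constant parts and, in the algebraic bracket, also the linear parts changes
  the symbol of the bracket by \<open>\<Omega>\<^bsup>pq\<^esup> \<partial>\<^sub>p f \<partial>\<^sub>q g\<close> only, and this removes exactly its constant coefficient.\<close>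

lemma proj_1_full_bracket:
  assumes \<alpha>: "\<alpha> \<in> Hhat A" and \<beta>: "\<beta> \<in> Hhat A"
  shows "proj 1 (br \<alpha> \<beta>) = top_bracket \<Omega> \<Gamma> (proj 1 \<alpha>) (proj 1 \<beta>)"
proof -
  obtain f where f: "\<alpha> \<in> Shat A" "smooth_fun A f" "\<alpha> 0 = scalar A f" "\<alpha> 1 = differential A f"
    using \<alpha> unfolding Hhat_iff by blast
  obtain g where g: "\<beta> \<in> Shat A" "smooth_fun A g" "\<beta> 0 = scalar A g" "\<beta> 1 = differential A g"
    using \<beta> unfolding Hhat_iff by blast
  note S = proj_in_Shat[OF f(1)] proj_in_Shat[OF g(1)]
  have top: "top_bracket \<Omega> \<Gamma> (proj 1 \<alpha>) (proj 1 \<beta>) = alg_bracket \<Omega> (proj 2 \<alpha>) (proj 2 \<beta>) + schouten \<Omega> \<Gamma> (proj 1 \<alpha>) (proj 1 \<beta>)"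
  proof -
    have "proj 2 (proj 1 \<gamma>) = proj 2 \<gamma>" "proj 1 (proj 1 \<gamma>) = proj 1 \<gamma>" for \<gamma> :: "('m, 'n) series"
      by (auto simp: proj_def)
    then show ?thesis
      by (simp add: top_bracket_def)
  qed
  show ?thesis
    unfolding top
  proof (rule graded_symmetric_eqI[OF _ _ coord_inv_coord])
    show "graded_symmetric A (proj 1 (br \<alpha> \<beta>))"
      by (intro Shat_graded_symmetric proj_in_Shat full_bracket_in_Shat f(1) g(1))
    show "graded_symmetric A (alg_bracket \<Omega> (proj 2 \<alpha>) (proj 2 \<beta>) + schouten \<Omega> \<Gamma> (proj 1 \<alpha>) (proj 1 \<beta>))"
      by (intro graded_symmetric_add graded_symmetric_alg_bracket graded_symmetric_schouten Shat_graded_symmetric S)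
    fix c and w :: "real^('n + 'n)"
    assume c: "c \<in> A" and w: "w \<in> base -` chart_image c"
    define u where "u p q = fps_const (U c (base w) p q)" for p q
    define fx fv gx gv where "fx p = fps_pderiv_at (Inl p) (symbol c \<alpha>) w" and "fv p = fps_pderiv_at (Inr p) (symbol c \<alpha>) w"
      and "gx p = fps_pderiv_at (Inl p) (symbol c \<beta>) w" and "gv p = fps_pderiv_at (Inr p) (symbol c \<beta>) w" for p
    define f' g' where "f' p = fps_const (pderiv_at p (\<lambda>y. f (coord_inv c y)) (base w))"
      and "g' p = fps_const (pderiv_at p (\<lambda>y. g (coord_inv c y)) (base w))" for p
    define L where "L p q = fps_const (complete_lift (U c) w (Inr p) (Inr q))" for p q
    have anti: "u p q = - u q p" for p q
      unfolding u_def using w by (subst antisym_poisson_coefficients[OF c]) (simp_all flip: fps_const_neg)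
    have "fps_X ^ 2 * symbol c (alg_bracket \<Omega> (proj 2 \<alpha>) (proj 2 \<beta>) + schouten \<Omega> \<Gamma> (proj 1 \<alpha>) (proj 1 \<beta>)) w
      = (\<Sum>*p q. u p q * ((fv p - fps_X * f' p) * (gv q - fps_X * g' q)))
        + (fps_X * (\<Sum>*p q. u p q * ((fx q - f' q) * gv p - fv p * (gx q - g' q)))
          - fps_X * (\<Sum>*p q. L p q * (fv p * gv q)))"
      unfolding symbol_add distrib_left symbol_alg_bracket[OF c w S] symbol_schouten[OF c w S]
        fibre_derivative_proj_1[OF c w f] fibre_derivative_proj_2[OF c w f] base_derivative_proj_1[OF c w f]
        fibre_derivative_proj_1[OF c w g] fibre_derivative_proj_2[OF c w g] base_derivative_proj_1[OF c w g]
        u_def fx_def fv_def gx_def gv_def f'_def g'_def L_def ..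
    also have "\<dots> = fps_X ^ 2 * symbol c (br \<alpha> \<beta>) w
      - fps_X * ((\<Sum>*p q. u p q * (f' p * gv q)) + (\<Sum>*p q. u p q * (f' q * gv p)))
      + fps_X ^ 2 * (\<Sum>*p q. u p q * (f' p * g' q))"
    proof -
      have "u p q * ((fv p - fps_X * f' p) * (gv q - fps_X * g' q)) = u p q * (fv p * gv q) - fps_X * (u p q * (f' p * gv q))
          - fps_X * (u p q * (fv p * g' q)) + fps_X ^ 2 * (u p q * (f' p * g' q))"
        "u p q * ((fx q - f' q) * gv p - fv p * (gx q - g' q)) = u p q * (fx q * gv p - fv p * gx q) - u p q * (f' q * gv p) + u p q * (fv p * g' q)" for p q
        by (simp_all add: algebra_simps power2_eq_square)
      then show ?thesis
        unfolding symbol_full_bracket_expand[OF c w f(1) g(1)]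
        by (simp add: sum.distrib sum_subtractf sum_distrib_left[symmetric] u_def[symmetric] fx_def[symmetric] fv_def[symmetric]
          gx_def[symmetric] gv_def[symmetric] L_def[symmetric] del: complete_lift.simps)
          (simp add: algebra_simps)
    qed
    also have "\<dots> = fps_X ^ 2 * (symbol c (br \<alpha> \<beta>) w + (\<Sum>*p q. u p q * (f' p * g' q)))"
      using sum_antisymmetric[OF anti, where t = "\<lambda>p q. f' p * gv q"] by (simp add: distrib_left)
    finally have "symbol c (alg_bracket \<Omega> (proj 2 \<alpha>) (proj 2 \<beta>) + schouten \<Omega> \<Gamma> (proj 1 \<alpha>) (proj 1 \<beta>)) w
      = symbol c (br \<alpha> \<beta>) w + (\<Sum>*p q. u p q * (f' p * g' q))"
      by simp
    also have "(\<Sum>*p q. u p q * (f' p * g' q)) = - fps_const (fps_nth (symbol c (br \<alpha> \<beta>) w) 0)"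
      unfolding symbol_br_nth_0[OF f g c w] hamiltonian_bracket_def[OF f g]
      by (simp add: u_def f'_def g'_def fps_const_sum)
    finally have top_br: "symbol c (alg_bracket \<Omega> (proj 2 \<alpha>) (proj 2 \<beta>) + schouten \<Omega> \<Gamma> (proj 1 \<alpha>) (proj 1 \<beta>)) w
      = symbol c (br \<alpha> \<beta>) w + - fps_const (fps_nth (symbol c (br \<alpha> \<beta>) w) 0)" .
    show "symbol c (proj 1 (br \<alpha> \<beta>)) w
      = symbol c (alg_bracket \<Omega> (proj 2 \<alpha>) (proj 2 \<beta>) + schouten \<Omega> \<Gamma> (proj 1 \<alpha>) (proj 1 \<beta>)) w"
      by (simp only: top_br symbol_proj_1 diff_conv_add_uminus)
  qed
qed

lemma lie_algebra_Hhat: "lie_algebra (Hhat A) br"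
proof -
  have "br \<alpha> \<beta> \<in> Hhat A" if \<alpha>: "\<alpha> \<in> Hhat A" and \<beta>: "\<beta> \<in> Hhat A" for \<alpha> \<beta>
  proof -
    obtain f where f: "\<alpha> \<in> Shat A" "smooth_fun A f" "\<alpha> 0 = scalar A f" "\<alpha> 1 = differential A f"
      using \<alpha> unfolding Hhat_iff by blast
    obtain g where g: "\<beta> \<in> Shat A" "smooth_fun A g" "\<beta> 0 = scalar A g" "\<beta> 1 = differential A g"
      using \<beta> unfolding Hhat_iff by blast
    show ?thesis
      by (rule full_bracket_in_Hhat[OF f g])
  qed
  moreover have "\<alpha> \<in> Shat A" if "\<alpha> \<in> Hhat A" for \<alpha>
    using that by (simp add: Hhat_iff)
  ultimately show ?thesis
    using lie_algebra_Shat subspace_Hhat unfolding lie_algebra_def by simp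
qed

lemma proj_1_image_Hhat: "proj 1 ` Hhat A = Bhat1 A"
proof (intro equalityI subsetI)
  fix \<beta> assume "\<beta> \<in> proj 1 ` Hhat A"
  then obtain \<alpha> where H: "\<alpha> \<in> Hhat A" "\<beta> = proj 1 \<alpha>"
    by blast
  then obtain f where \<alpha>: "\<alpha> \<in> Shat A" and f: "smooth_fun A f" "\<alpha> 1 = differential A f"
    unfolding Hhat_iff by blast
  have "\<beta> \<in> Shat A" "\<beta> 0 = 0" "\<beta> 1 = differential A f"
    using \<alpha> f by (simp_all add: H(2) proj_in_Shat proj_eq_0 proj_eq)
  with f(1) show "\<beta> \<in> Bhat1 A"
    unfolding Bhat1_def by blast
next
  fix \<beta> assume "\<beta> \<in> Bhat1 A"
  then obtain f where \<beta>: "\<beta> \<in> Shat A" "\<beta> 0 = 0" and f: "smooth_fun A f" "\<beta> 1 = differential A f"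
    unfolding Bhat1_def by blast
  let ?\<alpha> = "\<beta>(0 := scalar A f)"
  have "scalar A f \<in> Sk A 0"
    using f by (simp add: Sk_0[OF atlas])
  then have "?\<alpha> \<in> Hhat A"
    using \<beta> f unfolding Hhat_iff by (auto simp: Shat_def)
  moreover have "\<beta> = proj 1 ?\<alpha>"
    using \<beta>(2) by (auto simp: proj_def fun_eq_iff)
  ultimately show "\<beta> \<in> proj 1 ` Hhat A"
    by blast
qed

lemma iota_in_Hhat: "iota A r \<in> Hhat A"
proof -
  have f: "smooth_fun A (\<lambda>_. - r)"
    by (simp add: smooth_fun_def comp_def smooth_on_const)
  then have "scalar A (\<lambda>_. - r) \<in> Sk A 0"
    by (simp add: Sk_0[OF atlas])
  then have "iota A r \<in> Shat A"
    using subspace_0[OF subspace_Sk] by (auto simp: Shat_def iota_def)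
  moreover have "differential A (\<lambda>_. - r) = 0"
    by (auto simp: fun_eq_iff differential_def cpd_def comp_def split: list.split)
  ultimately show ?thesis
    using f unfolding Hhat_iff by (auto simp: iota_def)
qed

lemma full_bracket_iota: "br (iota A r) (iota A s) = 0"
proof (rule Shat_eqI)
  have S: "iota A r \<in> Shat A" for r
    using iota_in_Hhat by (simp add: Hhat_iff)
  then show "br (iota A r) (iota A s) \<in> Shat A"
    by (intro full_bracket_in_Shat)
  show "0 \<in> Shat A"
    by (rule subspace_0[OF subspace_Shat])
  fix c and w :: "real^('n + 'n)" assume c: "c \<in> A" and w: "w \<in> base -` chart_image c"
  have symbol: "symbol c (iota A r) z = fps_const (- r)" if "z \<in> base -` chart_image c" for r z
    using that c by (auto simp: fps_eq_iff symbol_nth iota_def scalar_def coord_inv_in zero_fun_def)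
  have "fps_X ^ 2 * symbol c (br (iota A r) (iota A s)) w = poisson_bracket (lifted_bivector (U c)) (\<lambda>_. fps_const (- r)) (\<lambda>_. fps_const (- s)) w"
    unfolding symbol_full_bracket[OF c w S S] by (rule poisson_bracket_cong[OF open_phase[OF c] w]) (simp_all add: symbol)
  then show "symbol c (br (iota A r) (iota A s)) w = symbol c 0 w"
    by (simp add: poisson_bracket_def symbol_0)
qed

lemma ex_chart: "\<exists>c\<in>A. x \<in> cdom c"
  using atlas unfolding smooth_atlas_def by blast

lemma differential_0_imp_locally_constant:
  assumes f: "smooth_fun A f" "differential A f = 0"
  obtains N where "open N" "x \<in> N" "\<And>z. z \<in> N \<Longrightarrow> f z = f x"
proof -
  obtain c where c: "c \<in> A" "x \<in> cdom c"
    using ex_chart by blast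
  have y: "coord c x \<in> chart_image c"
    using c by (simp add: chart_image_def)
  then obtain r where r: "r > 0" "ball (coord c x) r \<subseteq> chart_image c"
    using chart(2)[OF c(1)] open_contains_ball by blast
  have "((\<lambda>y. f (coord_inv c y)) has_derivative (\<lambda>h. 0)) (at y within ball (coord c x) r)" if "y \<in> ball (coord c x) r" for y
  proof -
    have yc: "y \<in> chart_image c"
      using that r by blast
    have "pderiv_at i (\<lambda>y. f (coord_inv c y)) y = 0" for i
    proof -
      have "cpd c i f (coord_inv c y) = 0"
        using fun_cong[OF fun_cong[OF fun_cong[OF f(2)]], of c "coord_inv c y" "[i]"] by (simp add: differential_Cons[OF c(1)])
      then show ?thesis
        by (simp add: cpd_coord_inv[OF c(1) yc])
    qed
    then show ?thesis
      using has_derivative_pderiv_at[OF smooth_on_differentiable[OF smooth_fun_chart[OF f(1) c(1)] chart(2)[OF c(1)] yc]]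
      by (simp add: has_derivative_at_withinI)
  qed
  then obtain k where k: "\<And>y. y \<in> ball (coord c x) r \<Longrightarrow> f (coord_inv c y) = k"
    using has_derivative_zero_constant[OF convex_ball] by blast
  show ?thesis
  proof
    have "continuous_on (cdom c) (coord c)"
      using chart(3)[OF c(1)] by (simp add: homeomorphism_def)
    then show "open (cdom c \<inter> coord c -` ball (coord c x) r)"
      using chart(1)[OF c(1)] by (simp add: continuous_open_preimage)
    show "x \<in> cdom c \<inter> coord c -` ball (coord c x) r"
      using c r by simp
    have "f z = k" if "z \<in> cdom c \<inter> coord c -` ball (coord c x) r" for z
      using that k[of "coord c z"] coord_inv_coord[OF c(1), of z] by simp
    then show "f z = f x" if "z \<in> cdom c \<inter> coord c -` ball (coord c x) r" for z
      using that c r by simp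
  qed
qed

lemma differential_0_imp_constant:
  assumes conn: "connected (UNIV :: 'm set)" and f: "smooth_fun A f" "differential A f = 0"
  shows "f x = f a"
proof -
  have "open {x. f x \<in> B}" for B
  proof (subst open_subopen, intro ballI)
    fix x assume x: "x \<in> {x. f x \<in> B}"
    obtain N where N: "open N" "x \<in> N" "\<And>z. z \<in> N \<Longrightarrow> f z = f x"
      by (rule differential_0_imp_locally_constant[OF f, of x]) (rule that)
    have "N \<subseteq> {x. f x \<in> B}"
      using x N(3) by auto
    with N(1,2) show "\<exists>N. open N \<and> x \<in> N \<and> N \<subseteq> {x. f x \<in> B}"
      by blast
  qed
  from connectedD[OF conn this[of "{f a}"] this[of "- {f a}"]] show ?thesis
    by auto
qed

lemma kernel_proj_1:
  assumes "connected (UNIV :: 'm set)"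
  shows "{\<alpha> \<in> Hhat A. proj 1 \<alpha> = 0} = range (iota A)"
proof (intro equalityI subsetI)
  fix \<alpha> assume "\<alpha> \<in> {\<alpha> \<in> Hhat A. proj 1 \<alpha> = 0}"
  then obtain f where f: "smooth_fun A f" "\<alpha> 0 = scalar A f" "\<alpha> 1 = differential A f" and p: "proj 1 \<alpha> = 0"
    unfolding Hhat_iff by blast
  have \<alpha>: "\<alpha> k = 0" if "k \<noteq> 0" for k
    using fun_cong[OF p, of k] that by (simp add: proj_def)
  have "differential A f = 0"
    using f(3) \<alpha>[of 1] by simp
  then have "f x = f undefined" for x
    by (rule differential_0_imp_constant[OF assms f(1)])
  then have "f = (\<lambda>_. - (- f undefined))"
    by auto
  then have "\<alpha> = iota A (- f undefined)"
    using f(2) \<alpha> by (metis iota_def ext)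
  then show "\<alpha> \<in> range (iota A)"
    by blast
next
  fix \<alpha> assume "\<alpha> \<in> range (iota A)"
  then show "\<alpha> \<in> {\<alpha> \<in> Hhat A. proj 1 \<alpha> = 0}"
    using iota_in_Hhat by (auto simp: iota_def proj_def fun_eq_iff)
qed

lemma iota_linear: "iota A (r + s) = iota A r + iota A s" "iota A (k * r) = k *\<^sub>R iota A r"
  by (auto simp: iota_def fun_eq_iff scalar_def scaleR_fun_def)

lemma iota_eq_0_iff: "iota A r = 0 \<longleftrightarrow> r = 0"
proof
  assume iota: "iota A r = 0"
  obtain c where c: "c \<in> A" "(undefined :: 'm) \<in> cdom c"
    using ex_chart by blast
  have "iota A r 0 c undefined [] = 0"
    by (simp add: iota)
  then show "r = 0"
    using c by (simp add: iota_def scalar_def)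
qed (auto simp: iota_def scalar_def fun_eq_iff)

end

theorem lemma3p11:
  fixes A :: "('m::{t2_space, second_countable_topology}, 'n::finite) chart set"
    and \<Omega> :: "('m, 'n) tensor"
    and \<Gamma> :: "('m, 'n) connection"
  assumes "smooth_atlas A"
    and "connected (UNIV :: 'm set)"
    and "symplectic_form A \<Omega>"
    and "symplectic_connection A \<Omega> \<Gamma>"
  shows "lie_short_exact
           (UNIV :: real set) (\<lambda>_ _. 0)
           (iota A)
           (Hhat A) (full_bracket \<Omega> \<Gamma>)
           (proj 1)
           (Bhat1 A) (top_bracket \<Omega> \<Gamma>)"
proof -
  interpret symplectic_connection_manifold A \<Omega> \<Gamma>
    by standard (fact assms)+
  have "lie_algebra (UNIV :: real set) (\<lambda>_ _. 0)"
    by (simp add: lie_algebra_def)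
  moreover have "lie_algebra (Bhat1 A) (top_bracket \<Omega> \<Gamma>)"
    by (rule lie_algebra_surjective_image[where g = "proj 1" and br' = "top_bracket \<Omega> \<Gamma>",
      OF lie_algebra_Hhat linear_proj proj_1_image_Hhat]) (rule proj_1_full_bracket)
  moreover have "lie_hom (UNIV :: real set) (\<lambda>_ _. 0) (Hhat A) br (iota A)"
    using iota_eq_0_iff[of 0] by (simp add: lie_hom_def iota_in_Hhat iota_linear full_bracket_iota)
  moreover have "lie_hom (Hhat A) br (Bhat1 A) (top_bracket \<Omega> \<Gamma>) (proj 1)"
    unfolding lie_hom_def using proj_1_image_Hhat linear_add[OF linear_proj] linear_cmul[OF linear_proj] proj_1_full_bracket
    by blast
  moreover have "{r \<in> UNIV. iota A r = 0} = {0}"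
    by (auto simp: iota_eq_0_iff)
  ultimately show ?thesis
    unfolding lie_short_exact_def using lie_algebra_Hhat kernel_proj_1[OF assms(2)] proj_1_image_Hhat by blast
qed

end
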